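(* Fix an integer $m\ge3$, and let $H$ be a finite index subgroup of the Hecke group $\Gamma_m$ of index $m$. Then for (Lebesgue) almost every real $x$, the Rosen $\lambda_m$-continued fraction approximants $p_n/q_n$ of $x$ are distributed in the cusps of $H$ according to the relative (to $\Gamma_m$) cusp widths; that is, for every cusp $\kappa$ of $H$, $$\lim_{N\to\infty}\frac{\#\{1\le n\le N\mid p_n/q_n\in\kappa\}}{N}=\frac{w(\kappa)}{[\Gamma_m:H]}.$$
   Context: Let $\lambda=\lambda_m=2\cos(\pi/m)$. The Hecke group $\Gamma_m\subset\mathrm{PSL}(2,\mathbb R)$ is the group generated by $\iota=\begin{pmatrix}0&-1\\1&0\end{pmatrix}$ and $\gamma_m=\begin{pmatrix}1&\lambda_m\\0&1\end{pmatrix}$; it is a Fuchsian group with a single cusp, i.e. its parabolic fixed points in $\mathbb R\cup\{\infty\}$ form the single orbit $\Gamma_m\cdot\infty$. A cusp $\kappa$ of $H$ is an $H$-orbit in $\Gamma_m\cdot\infty$ (Möbius action). Its width $w(\kappa)$ is the index of the $H$-stabilizer of a point of $\kappa$ inside the $\Gamma_m$-stabilizer of that point. Rosen continued fractions: let $\mathbb I_m=[-\lambda/2,\lambda/2)$ and define $T_m:\mathbb I_m\to\mathbb I_m$ by $T_m(x)=\left|\frac1x\right|-\lambda\left\lfloor\left|\frac1{\lambda x}\right|+\frac12\right\rfloor$ for $x\ne0$, $T_m(0)=0$. For $n\ge1$ set $\varepsilon_n(x)=\operatorname{sgn}(T_m^{n-1}x)$ and $r_n(x)=r(T_m^{n-1}x)$,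 where $r(y)=\left\lfloor\left|\frac1{\lambda y}\right|+\frac12\right\rfloor$. The approximants $p_n/q_n$ of $x\in\mathbb I_m$ are given by $$p_{-1}=1,\ p_0=0,\ p_n=\lambda r_np_{n-1}+\varepsilon_np_{n-2};\qquad q_{-1}=0,\ q_0=1,\ q_n=\lambda r_nq_{n-1}+\varepsilon_nq_{n-2}\quad(n\ge1).$$ For general real $x$, let $r_0\in\mathbb Z$ be the integer with $x-r_0\lambda\in\mathbb I_m$; the $n$-th approximant of $x$ is $r_0\lambda$ plus the $n$-th approximant of $x-r_0\lambda$. For almost every $x$ all approximants are defined. *)

theory Defs
  imports "HOL-Analysis.Analysis" "HOL-Algebra.Group_Action" "HOL-Algebra.Generated_Groups"
begin

definition SL2R :: "(real^2^2) monoid" where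
  "SL2R = \<lparr>carrier = {A. det A = 1}, mult = (**), one = mat 1\<rparr>"

definition PSL2R :: "(real^2^2) set monoid" where
  "PSL2R = SL2R Mod {mat 1, - mat 1}"

definition proj_class :: "real^2^2 \<Rightarrow> (real^2^2) set" where
  "proj_class A = {mat 1, - mat 1} #>\<^bsub>SL2R\<^esub> A"

definition hecke_lambda :: "nat \<Rightarrow> real" where
  "hecke_lambda m = 2 * cos (pi / real m)"

definition Hecke_group :: "nat \<Rightarrow> (real^2^2) set monoid" where
  "Hecke_group m = subgroup_generated PSL2R
     {proj_class (vector [vector [0, -1], vector [1, 0]]),
      proj_class (vector [vector [1, hecke_lambda m], vector [0, 1]])}"

(* The projective line over the reals is modelled by type real option, with None the point
   at infinity. *)

definition ratio :: "real \<Rightarrow> real \<Rightarrow> real option" where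
  "ratio p q = (if q = 0 then None else Some (p / q))"

fun moebius_act :: "real^2^2 \<Rightarrow> real option \<Rightarrow> real option" where
  "moebius_act A None = ratio (A$1$1) (A$2$1)"
| "moebius_act A (Some x) = ratio (A$1$1 * x + A$1$2) (A$2$1 * x + A$2$2)"

(* A and -A act in the same way, so the image of an element g of PSL2R below is a singleton. *)
definition proj_action :: "(real^2^2) set \<Rightarrow> real option \<Rightarrow> real option" where
  "proj_action g z = the_elem ((\<lambda>A. moebius_act A z) ` g)"

definition group_index :: "('a, 'b) monoid_scheme \<Rightarrow> 'a set \<Rightarrow> nat" where
  "group_index G H = card (rcosets\<^bsub>G\<^esub> H)"

definition cusps :: "nat \<Rightarrow> (real^2^2) set set \<Rightarrow> real option set set" where
  "cusps m H = orbits (Hecke_group m\<lparr>carrier := H\<rparr>) (orbit (Hecke_group m) proj_action None)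
     proj_action"

(* The stabilizers of two points of the same cusp are conjugate by an element of H, so the
   width does not depend on the chosen point. *)
definition cusp_width :: "nat \<Rightarrow> (real^2^2) set set \<Rightarrow> real option set \<Rightarrow> nat" where
  "cusp_width m H \<kappa> = (let z = (SOME z. z \<in> \<kappa>) in
     group_index (Hecke_group m\<lparr>carrier := stabilizer (Hecke_group m) proj_action z\<rparr>)
       (stabilizer (Hecke_group m\<lparr>carrier := H\<rparr>) proj_action z))"

definition rosen_interval :: "nat \<Rightarrow> real set" where
  "rosen_interval m = {- hecke_lambda m / 2 ..< hecke_lambda m / 2}"

definition rosen_digit :: "nat \<Rightarrow> real \<Rightarrow> int" where
  "rosen_digit m y = \<lfloor>\<bar>1 / (hecke_lambda m * y)\<bar> + 1 / 2\<rfloor>"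

definition rosen_map :: "nat \<Rightarrow> real \<Rightarrow> real" where
  "rosen_map m x =
     (if x = 0 then 0 else \<bar>1 / x\<bar> - hecke_lambda m * real_of_int (rosen_digit m x))"

definition rosen_eps :: "nat \<Rightarrow> real \<Rightarrow> nat \<Rightarrow> real" where
  "rosen_eps m x n = sgn ((rosen_map m ^^ (n - 1)) x)"

definition rosen_r :: "nat \<Rightarrow> real \<Rightarrow> nat \<Rightarrow> int" where
  "rosen_r m x n = rosen_digit m ((rosen_map m ^^ (n - 1)) x)"

(* The recursions for p and q start at index -1; rosen_p_shifted m x k is p with index k - 1,
   and likewise for q. *)

fun rosen_p_shifted :: "nat \<Rightarrow> real \<Rightarrow> nat \<Rightarrow> real" where
  "rosen_p_shifted m x 0 = 1"
| "rosen_p_shifted m x (Suc 0) = 0"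
| "rosen_p_shifted m x (Suc (Suc k)) =
     hecke_lambda m * real_of_int (rosen_r m x (Suc k)) * rosen_p_shifted m x (Suc k)
     + rosen_eps m x (Suc k) * rosen_p_shifted m x k"

fun rosen_q_shifted :: "nat \<Rightarrow> real \<Rightarrow> nat \<Rightarrow> real" where
  "rosen_q_shifted m x 0 = 0"
| "rosen_q_shifted m x (Suc 0) = 1"
| "rosen_q_shifted m x (Suc (Suc k)) =
     hecke_lambda m * real_of_int (rosen_r m x (Suc k)) * rosen_q_shifted m x (Suc k)
     + rosen_eps m x (Suc k) * rosen_q_shifted m x k"

definition rosen_p :: "nat \<Rightarrow> real \<Rightarrow> nat \<Rightarrow> real" where
  "rosen_p m x n = rosen_p_shifted m x (Suc n)"

definition rosen_q :: "nat \<Rightarrow> real \<Rightarrow> nat \<Rightarrow> real" where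
  "rosen_q m x n = rosen_q_shifted m x (Suc n)"

definition rosen_r0 :: "nat \<Rightarrow> real \<Rightarrow> int" where
  "rosen_r0 m x = (THE r. x - real_of_int r * hecke_lambda m \<in> rosen_interval m)"

(* The n-th approximant of an arbitrary real x, as a point of the projective line. Its value
   is not meaningful when one of the iterates 0, ..., n - 1 of the Rosen map at x - s
   vanishes, which happens for only countably many x. *)
definition rosen_approximant :: "nat \<Rightarrow> real \<Rightarrow> nat \<Rightarrow> real option" where
  "rosen_approximant m x n =
     (let s = real_of_int (rosen_r0 m x) * hecke_lambda m
      in map_option (\<lambda>y. s + y) (ratio (rosen_p m (x - s) n) (rosen_q m (x - s) n)))"

end

(* Proof idea. Read p_n/q_n as g_n(0) with g_n in the Hecke group. Then the coset H g_n, together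
   with the parity of the number of digits of sign +1, moves by a permutation of a finite set that
   depends only on the n-th Rosen digit, and the states lying over a cusp have density
   w / [Gamma : H]. So it suffices that for almost every x the states visited are equidistributed,
   i.e. that the sums of an observable f of mean 0 over the states are o(N).

   No invariant measure is needed. Densities with a bounded Lipschitz constant of the logarithm on
   the intervals of a finite Markov partition are preserved by the inverse branches of the Rosen map,
   which contract and have bounded distortion. From every such interval and every state one reaches
   the full interval in any prescribed state; hence a fixed fraction of the mass can be split off
   that is constant in x and uniform in the state, and this part contributes 0 to all later sums.
   Iterating, the mean of the N-th sum is bounded uniformly in N and in the initial density, so the
   second moment is O(N), and summability along the squares gives convergence almost
   everywhere. *)

theory Submission
  imports Defs "HOL-Library.Nat_Bijection" "HOL-Library.Discrete_Functions"
begin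

section \<open>Inverse branches of the Rosen map\<close>

text \<open>Two obstacles shape the estimates: there are infinitely many branches, and those of
  small digits need not be full. Every bound is therefore phrased as the nonnegativity of an
  integral that is affine in the bound. One branch can then be kept and all others discarded by
  positivity; a limit over the digits is taken only in \<open>branch_nonneg\<close>.

  The bound on the mean keeps the number N of terms fixed while digits are consumed: for each digit
  one term is lost at the front and one is gained at the end, at a cost of at most
  \<open>2 * F0\<close> times the mass. So the words that lead to the various target states may have
  different lengths, and periodicity of the walk is no obstacle.

  The second moment needs the mean bound for all admissible densities, intervals and states at once.
  Once the first digit is cut off, the first summand is a constant, and the cross term is that
  constant times a mean taken over a new interval, with a new density and from a new state.\<close>

locale rosen_expansion =
  fixes m :: nat
  assumes m3: "m \<ge> 3"
begin

abbreviation L :: real where "L \<equiv> hecke_lambda m"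
abbreviation T :: "real \<Rightarrow> real" where "T \<equiv> rosen_map m"

text \<open>The open interval makes all branch domains open. The left end that it omits matters only
  through its countably many preimages.\<close>

definition I0 :: "real set" where "I0 = {- (L/2)<..<L/2}"

text \<open>An integer k encodes the digit with sign sgn k and partial quotient |k|.\<close>

definition signed_digit :: "real \<Rightarrow> int" where
  "signed_digit x = (if x < 0 then - rosen_digit m x else rosen_digit m x)"

definition inv_branch :: "int \<Rightarrow> real \<Rightarrow> real" where
  "inv_branch k y = sgn (real_of_int k) / (L * \<bar>real_of_int k\<bar> + y)"

definition branch_domain :: "int \<Rightarrow> real set \<Rightarrow> real set" where
  "branch_domain k J = {y \<in> I0. k \<noteq> 0 \<and> inv_branch k y \<in> J}"

text \<open>One summand of the Perron-Frobenius operator: the factor is the absolute derivative of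
  \<open>inv_branch k\<close>, so this is the density, after one step of \<open>T\<close>, of the
  part of h whose first digit is k.\<close>

definition transfer :: "int \<Rightarrow> (real \<Rightarrow> real) \<Rightarrow> real \<Rightarrow> real" where
  "transfer k h y = h (inv_branch k y) / (L * \<bar>real_of_int k\<bar> + y)\<^sup>2"

lemma L_ge_1: "1 \<le> L" and L_less_2: "L < 2"
proof -
  have "pi / real m \<le> pi / 3" using m3 by (intro divide_left_mono) auto
  then have "cos (pi/3) \<le> cos (pi / real m)"
    using m3 by (intro cos_monotone_0_pi_le) auto
  then show "1 \<le> L" by (simp add: hecke_lambda_def cos_60)
  have "cos (pi / real m) < cos 0"
    using m3 by (intro cos_monotone_0_pi) (auto simp: field_simps)
  then show "L < 2" by (simp add: hecke_lambda_def)
qed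

lemma L_pos [simp]: "0 < L"
  using L_ge_1 by linarith

lemma L_neq_0 [simp]: "L \<noteq> 0"
  using L_pos by linarith

lemma L_nonneg [simp]: "0 \<le> L" and abs_L [simp]: "\<bar>L\<bar> = L"
  using L_pos by linarith+

lemma mem_I0: "y \<in> I0 \<longleftrightarrow> - L < 2 * y \<and> 2 * y < L"
  by (auto simp: I0_def)

lemma digit_eqI:
  assumes "- L \<le> 2 * (\<bar>1/x\<bar> - L * real_of_int r)" "2 * (\<bar>1/x\<bar> - L * real_of_int r) < L"
  shows "rosen_digit m x = r"
proof -
  have "\<bar>1 / (L * x)\<bar> = \<bar>1/x\<bar> / L" by (simp add: abs_mult)
  moreover have "- 1/2 \<le> \<bar>1/x\<bar> / L - r" "\<bar>1/x\<bar> / L - r < 1/2"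
    using assms L_pos unfolding left_diff_distrib
    by (simp_all only: pos_le_divide_eq pos_divide_less_eq le_diff_eq diff_less_eq) argo+
  ultimately show ?thesis
    unfolding rosen_digit_def
    by (intro floor_unique) linarith+
qed

lemma rosen_map_eqI:
  assumes "x \<noteq> 0" "\<bar>1/x\<bar> = L * real_of_int r + y" "- L \<le> 2 * y" "2 * y < L"
  shows "rosen_digit m x = r" "T x = y"
proof -
  show "rosen_digit m x = r" using assms by (intro digit_eqI) auto
  then show "T x = y" using assms by (simp add: rosen_map_def)
qed

lemma digit_map_eq:
  assumes "x \<noteq> 0"
  shows "\<bar>1/x\<bar> = L * real_of_int (rosen_digit m x) + T x"
  using assms by (simp add: rosen_map_def)

lemma map_range: "- L \<le> 2 * T x" "2 * T x < L"
proof -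
  have "x \<noteq> 0 \<Longrightarrow> \<bar>1 / (L * x)\<bar> = \<bar>1/x\<bar> / L" by (simp add: abs_mult)
  moreover have "of_int (rosen_digit m x) \<le> \<bar>1 / (L * x)\<bar> + 1/2"
    "\<bar>1 / (L * x)\<bar> + 1/2 < of_int (rosen_digit m x) + 1"
    unfolding rosen_digit_def by linarith+
  ultimately show "- L \<le> 2 * T x" "2 * T x < L"
    using L_pos by (auto simp: rosen_map_def field_simps simp del: L_pos)
qed

lemma digit_pos:
  assumes "x \<noteq> 0" "\<bar>x\<bar> \<le> L/2"
  shows "rosen_digit m x \<ge> 1"
proof -
  have "L * \<bar>x\<bar> \<le> L * (L/2)" using assms by (intro mult_left_mono) auto
  also have "\<dots> < 2" using L_less_2 L_ge_1 mult_strict_mono[of L 2 L 2] by simp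
  finally have "\<bar>1 / (L * x)\<bar> > 1/2" using assms by (simp add: abs_mult field_simps)
  then show ?thesis unfolding rosen_digit_def by linarith
qed

lemma map_minus: "T (- x) = T x" "rosen_digit m (- x) = rosen_digit m x"
  by (auto simp: rosen_map_def rosen_digit_def)

lemma denom_pos:
  assumes "y \<in> I0" "k \<noteq> 0"
  shows "L * \<bar>real_of_int k\<bar> + y > L/2"
proof -
  have "1 \<le> \<bar>real_of_int k\<bar>" using assms by linarith
  then have "L \<le> L * \<bar>real_of_int k\<bar>" by simp
  with assms show ?thesis unfolding mem_I0 by argo
qed

lemma denom_pos': "y \<in> I0 \<Longrightarrow> k \<noteq> 0 \<Longrightarrow> L * \<bar>real_of_int k\<bar> + y > 0"
  using denom_pos[of y k] L_pos by linarith

lemma abs_inv_branch: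
  assumes "y \<in> I0" "k \<noteq> 0"
  shows "\<bar>inv_branch k y\<bar> = 1 / (L * \<bar>real_of_int k\<bar> + y)"
  using denom_pos'[OF assms] assms(2) by (simp add: inv_branch_def abs_divide abs_sgn_eq)

lemma inv_branch_neq_0: "y \<in> I0 \<Longrightarrow> k \<noteq> 0 \<Longrightarrow> inv_branch k y \<noteq> 0"
  using denom_pos'[of y k] by (auto simp: inv_branch_def sgn_if)

lemma inv_branch_less_0: "y \<in> I0 \<Longrightarrow> k \<noteq> 0 \<Longrightarrow> inv_branch k y < 0 \<longleftrightarrow> k < 0"
  using denom_pos'[of y k] by (auto simp: inv_branch_def sgn_if field_simps)

lemma map_inv_branch:
  assumes "y \<in> I0" "k \<noteq> 0"
  shows "T (inv_branch k y) = y" "signed_digit (inv_branch k y) = k"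
proof -
  have *: "\<bar>1 / inv_branch k y\<bar> = L * real_of_int \<bar>k\<bar> + y"
    using abs_inv_branch[OF assms] denom_pos'[OF assms] by (simp add: abs_divide)
  have "T (inv_branch k y) = y" "rosen_digit m (inv_branch k y) = \<bar>k\<bar>"
    using rosen_map_eqI[OF inv_branch_neq_0[OF assms] *] assms by (auto simp: mem_I0)
  then show "T (inv_branch k y) = y" "signed_digit (inv_branch k y) = k"
    using inv_branch_less_0[OF assms] by (auto simp: signed_digit_def)
qed

lemma inv_branch_map:
  assumes "x \<noteq> 0" "\<bar>x\<bar> \<le> L/2"
  shows "signed_digit x \<noteq> 0" "inv_branch (signed_digit x) (T x) = x"
proof -
  have r: "rosen_digit m x \<ge> 1" using digit_pos assms by blast
  then show "signed_digit x \<noteq> 0" by (auto simp: signed_digit_def)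
  have "L * \<bar>real_of_int (signed_digit x)\<bar> + T x = 1 / \<bar>x\<bar>"
    using r digit_map_eq[OF assms(1)] by (simp add: signed_digit_def)
  moreover have "sgn (real_of_int (signed_digit x)) = sgn x"
    using r assms(1) by (simp add: signed_digit_def sgn_if)
  ultimately show "inv_branch (signed_digit x) (T x) = x"
    using mult_sgn_abs[of x] by (simp add: inv_branch_def)
qed

lemma inj_inv_branch: "inj_on (inv_branch k) (branch_domain k J)"
  by (rule inj_on_inverseI[of _ T]) (auto simp: branch_domain_def map_inv_branch)

lemma inv_branch_image_disjoint: "k \<noteq> l \<Longrightarrow> inv_branch k ` branch_domain k J \<inter> inv_branch l `
    branch_domain l J' = {}"
  by (auto simp: branch_domain_def dest: arg_cong[of _ _ signed_digit] simp: map_inv_branch)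

lemma inv_branch_image_branch_domain:
  assumes "J \<subseteq> I0"
  shows "inv_branch k ` branch_domain k J = {x \<in> J. x \<noteq> 0 \<and> signed_digit x = k \<and> T x \<in> I0}" (is "?A
      = ?B")
proof (intro equalityI subsetI)
  fix x assume "x \<in> ?A"
  then show "x \<in> ?B"
    using assms by (auto simp: branch_domain_def map_inv_branch inv_branch_neq_0 subset_eq)
next
  fix x assume *: "x \<in> {x \<in> J. x \<noteq> 0 \<and> signed_digit x = k \<and> T x \<in> I0}"
  then have "x \<in> I0" using assms by auto
  then have "\<bar>x\<bar> \<le> L/2" by (auto simp: mem_I0)
  with * inv_branch_map[of x] show "x \<in> inv_branch k ` branch_domain k J"
    unfolding branch_domain_def by (intro image_eqI[of _ _ "T x"]) auto
qed

lemma inv_branch_deriv: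
  assumes "y \<in> I0" "k \<noteq> 0"
  shows "(inv_branch k has_field_derivative - sgn (real_of_int k) / (L * \<bar>real_of_int k\<bar> + y)\<^sup>2) (at
      y within S)"
  unfolding inv_branch_def[abs_def] using denom_pos'[OF assms]
  by (auto intro!: derivative_eq_intros simp: power2_eq_square)

lemma continuous_on_inv_branch: "k \<noteq> 0 \<Longrightarrow> S \<subseteq> I0 \<Longrightarrow> continuous_on S (inv_branch k)"
  by (meson DERIV_atLeastAtMost_imp_continuous_on inv_branch_deriv continuous_on_eq_continuous_within
      has_field_derivative_imp_has_derivative has_derivative_continuous subsetD)

lemma signed_digit_measurable [measurable]: "signed_digit \<in> borel \<rightarrow>\<^sub>M count_space UNIV"
  unfolding signed_digit_def[abs_def] rosen_digit_def[abs_def] by measurable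

lemma T_measurable [measurable]: "T \<in> borel_measurable borel"
  unfolding rosen_map_def[abs_def] rosen_digit_def[abs_def] by measurable

lemma branch_domain_subset: "branch_domain k J \<subseteq> I0"
  by (auto simp: branch_domain_def)

lemma open_I0: "open I0" by (simp add: I0_def)

lemma open_branch_domain:
  assumes "open J" shows "open (branch_domain k J)"
proof (cases "k = 0")
  case False
  then have "branch_domain k J = I0 \<inter> inv_branch k -` J" by (auto simp: branch_domain_def)
  then show ?thesis
    using continuous_open_preimage[OF continuous_on_inv_branch[OF False order_refl] open_I0 assms]
        by simp
qed (simp add: branch_domain_def)

text \<open>The value \<open>T x\<close> and the digit of x determine 1/|x|, and the digit is an
  integer.\<close>

lemma countable_fibre: "countable {x. T x = y}"
proof -
  have "{x. T x = y} \<subseteq> {0} \<union> (\<Union>r::int. {1 / (L * r + y), - (1 / (L * r + y))})"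
  proof
    fix x assume "x \<in> {x. T x = y}"
    then have "x \<noteq> 0 \<Longrightarrow> 1 / \<bar>x\<bar> = L * rosen_digit m x + y"
      using digit_map_eq[of x] by auto
    then have "x \<noteq> 0 \<Longrightarrow> \<bar>x\<bar> = 1 / (L * rosen_digit m x + y)"
      by (metis div_by_1 divide_divide_eq_right mult_1)
    then show "x \<in> {0} \<union> (\<Union>r::int. {1 / (L * r + y), - (1 / (L * r + y))})"
      by (cases "x \<ge> 0") (auto simp: abs_if minus_equation_iff[of x], metis)
  qed
  then show ?thesis by (rule countable_subset) auto
qed

lemma countable_negligible:
  assumes "countable S" shows "negligible (S :: real set)"
proof -
  have "negligible (\<Union>x\<in>S. {x})"
    using assms by (intro negligible_countable_Union) auto
  then show ?thesis by simp
qed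

lemma branch_integral:
  assumes "open J" "J \<subseteq> I0" "F absolutely_integrable_on J"
  shows "transfer k F absolutely_integrable_on branch_domain k J"
    and "integral (inv_branch k ` branch_domain k J) F = integral (branch_domain k J) (transfer k F)"
    and "F absolutely_integrable_on (inv_branch k ` branch_domain k J)"
    and "inv_branch k ` branch_domain k J \<in> sets lebesgue"
proof -
  have "{x. x \<noteq> 0 \<and> signed_digit x = k \<and> T x \<in> I0} \<in> sets borel"
  proof -
    have [measurable]: "I0 \<in> sets borel" using open_I0 by simp
    have "{x \<in> space borel. x \<noteq> 0 \<and> signed_digit x = k \<and> T x \<in> I0} \<in> sets borel" by measurable
    then show ?thesis by simp
  qed
  moreover have "inv_branch k ` branch_domain k J = J \<inter> {x. x \<noteq> 0 \<and> signed_digit x = k \<and> T x \<in> I0}"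
    using inv_branch_image_branch_domain[OF assms(2)] by auto
  ultimately show m: "inv_branch k ` branch_domain k J \<in> sets lebesgue"
    using assms(1) by (auto intro!: sets.Int)
  have sub: "inv_branch k ` branch_domain k J \<subseteq> J" by (auto simp: branch_domain_def)
  show ai: "F absolutely_integrable_on (inv_branch k ` branch_domain k J)"
    using set_integrable_subset[OF assms(3) m sub] .
  let ?g' = "\<lambda>y. - sgn (real_of_int k) / (L * \<bar>real_of_int k\<bar> + y)\<^sup>2"
  have eq: "\<bar>?g' y\<bar> * F (inv_branch k y) = transfer k F y" if "y \<in> branch_domain k J" for y
    using that by (auto simp: transfer_def branch_domain_def abs_sgn_eq)
  have "(\<lambda>y. \<bar>?g' y\<bar> * F (inv_branch k y)) absolutely_integrable_on branch_domain k J \<and>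
    integral (branch_domain k J) (\<lambda>y. \<bar>?g' y\<bar> * F (inv_branch k y)) = integral (inv_branch k `
        branch_domain k J) F"
  proof (subst has_absolute_integral_change_of_variables_1'[OF _ _ inj_inv_branch])
    show "branch_domain k J \<in> sets lebesgue" using open_branch_domain[OF assms(1), of k] by simp
    show "(inv_branch k has_real_derivative ?g' y) (at y within branch_domain k J)" if "y \<in>
        branch_domain k J" for y
      using that inv_branch_deriv unfolding branch_domain_def by blast
  qed (use ai in simp)
  then have ai': "(\<lambda>y. \<bar>?g' y\<bar> * F (inv_branch k y)) absolutely_integrable_on branch_domain k J"
    and int: "integral (branch_domain k J) (\<lambda>y. \<bar>?g' y\<bar> * F (inv_branch k y)) = integral (inv_branch
        k ` branch_domain k J) F" by blast+
  show "transfer k F absolutely_integrable_on branch_domain k J"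
    by (rule iffD1[OF set_integrable_cong[OF refl refl eq] ai'])
  show "integral (inv_branch k ` branch_domain k J) F = integral (branch_domain k J) (transfer k F)"
    unfolding int[symmetric] by (rule Henstock_Kurzweil_Integration.integral_cong[OF eq])
qed

text \<open>The images of the branches are disjoint and cover J up to a countable set. Testing signs
  branch by branch is the form in which the infinite sum over the digits is used later.\<close>

lemma branch_nonneg:
  assumes "open J" "J \<subseteq> I0" "F absolutely_integrable_on J"
    and nonneg: "\<And>k. k \<noteq> 0 \<Longrightarrow> 0 \<le> integral (branch_domain k J) (transfer k F)"
  shows "0 \<le> integral J F"
proof -
  \<comment> \<open>The enumeration of the integers also meets the digit 0, whose piece is
    empty.\<close>
  define A where "A n = inv_branch (int_decode n) ` branch_domain (int_decode n) J" for n
  have A_meas: "A n \<in> sets lebesgue" for n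
    unfolding A_def using branch_integral(4)[OF assms(1-3)] .
  have A_sub: "(\<Union>n. A n) \<subseteq> J" by (auto simp: A_def branch_domain_def)
  have int_U: "set_integrable lebesgue (\<Union>n. A n) F"
    using set_integrable_subset[OF assms(3) _ A_sub] A_meas by blast
  have "int_decode i \<noteq> int_decode j \<Longrightarrow> A i \<inter> A j = {}" for i j
    unfolding A_def by (rule inv_branch_image_disjoint)
  then have disj: "i \<noteq> j \<Longrightarrow> A i \<inter> A j = {}" for i j
    by (metis int_decode_eq)
  have pos: "0 \<le> set_lebesgue_integral lebesgue (A n) F" for n
  proof (cases "int_decode n = 0")
    case False
    then show ?thesis
      using branch_integral[OF assms(1-3), of "int_decode n"] nonneg
      by (simp add: A_def set_lebesgue_integral_eq_integral)
  qed (simp add: A_def branch_domain_def set_lebesgue_integral_def)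
  let ?U = "\<lambda>n. \<Union>i\<in>{..n}. A i"
  have U: "(\<Union>n. ?U n) = (\<Union>n. A n)" by auto
  have "incseq ?U" by (auto simp: incseq_def; force)
  then have "(\<lambda>n. set_lebesgue_integral lebesgue (?U n) F) \<longlonglongrightarrow>
      set_lebesgue_integral lebesgue (\<Union>n. A n) F"
    using set_integral_cont_up[of ?U lebesgue F] A_meas int_U unfolding U by blast
  moreover have "0 \<le> set_lebesgue_integral lebesgue (?U n) F" for n
  proof -
    have "set_integrable lebesgue (A i) F" for i
      using int_U A_meas by (rule set_integrable_subset) blast
    then have "set_lebesgue_integral lebesgue (?U n) F =
        (\<Sum>i\<in>{..n}. set_lebesgue_integral lebesgue (A i) F)"
      using A_meas disj by (intro set_integral_finite_Union) (auto simp: disjoint_family_on_def)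
    then show ?thesis using pos by (simp add: sum_nonneg)
  qed
  ultimately have "0 \<le> set_lebesgue_integral lebesgue (\<Union>n. A n) F"
    by (intro LIMSEQ_le_const) auto
  also have "\<dots> = integral (\<Union>n. A n) F"
    using int_U by (simp add: set_lebesgue_integral_eq_integral)
  also have "\<dots> = integral J F"
  proof (rule integral_subset_negligible[OF A_sub])
    \<comment> \<open>A point outside all pieces is 0 or is sent to the left end, the only value of
      \<open>T\<close> outside \<open>I0\<close>.\<close>
    have "J - (\<Union>n. A n) \<subseteq> {0} \<union> {x. T x = - (L/2)}"
    proof
      fix x assume x: "x \<in> J - (\<Union>n. A n)"
      then have "x \<notin> A (int_encode (signed_digit x))" by blast
      then have "x = 0 \<or> T x \<notin> I0"
        using inv_branch_image_branch_domain[OF assms(2)] x by (auto simp: A_def)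
      then show "x \<in> {0} \<union> {x. T x = - (L/2)}"
        using map_range[of x] by (auto simp: mem_I0)
    qed
    then show "negligible (J - (\<Union>n. A n))"
      using countable_fibre[of "- (L/2)"]
      by (intro negligible_subset[OF countable_negligible]) auto
  qed
  finally show ?thesis .
qed

end

section \<open>The Markov partition\<close>

context rosen_expansion begin

definition left_orbit :: "nat \<Rightarrow> real" where "left_orbit j = (T ^^ j) (- (L/2))"
text \<open>The orbit of the left end is made symmetric because \<open>T\<close> is even and both
  ends of the interval have to occur.\<close>

definition markov_ends :: "real set" where "markov_ends = {e. \<exists>j. \<bar>e\<bar> = \<bar>left_orbit j\<bar>}"
definition markov_intervals :: "real set set" where "markov_intervals = {{a<..<b} | a b. a \<in>
    markov_ends \<and> b \<in> markov_ends \<and> a < b}"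

text \<open>In the parameter of phi, the branch of the digit -1 is the rotation by -theta; this
  makes the orbit of -L/2 explicit.\<close>

definition theta :: real where "theta = pi / real m"
definition phi :: "real \<Rightarrow> real" where "phi a = - sin a / sin (a + theta)"

lemma theta_props: "0 < theta" "theta \<le> pi/3" "L = 2 * cos theta"
proof -
  have "pi / real m \<le> pi / 3" using m3 by (intro divide_left_mono) auto
  then show "0 < theta" "theta \<le> pi/3" "L = 2 * cos theta"
    using m3 by (auto simp: theta_def hecke_lambda_def)
qed

text \<open>The gap \<open>cos theta - sin b / sin (b + theta)\<close> has numerator
  \<open>sin theta * cos (b + theta)\<close>, which stays nonnegative up to
  \<open>b = pi/2 - theta\<close>.\<close>

lemma phi_bounds:
  assumes "0 \<le> b" "b \<le> pi/2 - theta"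
  shows "- (L/2) \<le> phi b" "phi b \<le> 0"
proof -
  have s: "sin (b + theta) > 0" "sin theta > 0" "cos (b + theta) \<ge> 0" "sin b \<ge> 0"
    using assms theta_props pi_gt_zero by (auto intro!: sin_gt_zero cos_ge_zero sin_ge_zero)
  have "cos theta * sin (b + theta) - sin b = sin theta * cos (b + theta)"
  proof -
    have "sin b = sin ((b + theta) - theta)" by simp
    then show ?thesis unfolding sin_diff by (simp add: algebra_simps)
  qed
  then have "sin b \<le> cos theta * sin (b + theta)"
    using s by (metis diff_ge_0_iff_ge less_eq_real_def mult_nonneg_nonneg)
  then have "sin b / sin (b + theta) \<le> cos theta"
    using s by (simp add: divide_le_eq)
  then show "- (L/2) \<le> phi b" by (simp add: phi_def theta_props(3))
  show "phi b \<le> 0" using s by (simp add: phi_def)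
qed

text \<open>By the identity \<open>sin (a + theta) + sin (a - theta) = L * sin a\<close>, the
  reciprocal of |phi a| is \<open>L + phi (a - theta)\<close>, so the digit is -1.\<close>

lemma phi_step:
  assumes "theta \<le> a" "a \<le> pi/2 - theta"
  shows "T (phi a) = phi (a - theta)"
proof (rule rosen_map_eqI(2))
  have s: "sin (a + theta) > 0" "sin a > 0"
    using assms theta_props pi_gt_zero by (auto intro!: sin_gt_zero)
  then show "phi a \<noteq> 0" by (simp add: phi_def)
  have "sin (a + theta) = L * sin a - sin (a - theta)"
    by (simp add: sin_add sin_diff theta_props(3))
  then show "\<bar>1 / phi a\<bar> = L * real_of_int 1 + phi (a - theta)"
    using s by (simp add: phi_def field_simps)
  show "- L \<le> 2 * phi (a - theta)" "2 * phi (a - theta) < L"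
    using phi_bounds[of "a - theta"] assms theta_props(1) L_pos by (auto simp del: L_pos)
qed

lemma phi_iterate:
  assumes "0 \<le> b" "b + real j * theta \<le> pi/2 - theta"
  shows "(T ^^ j) (phi (b + real j * theta)) = phi b"
  using assms(2)
proof (induction j)
  case (Suc j)
  have t: "0 \<le> real j * theta" using theta_props by simp
  have "(T ^^ Suc j) (phi (b + real (Suc j) * theta)) = (T ^^ j) (T (phi (b + real (Suc j) * theta)))"
    by (simp add: funpow_swap1)
  also have "T (phi (b + real (Suc j) * theta)) = phi (b + real j * theta)"
    using Suc.prems assms(1) t by (subst phi_step) (auto simp: algebra_simps)
  also have "(T ^^ j) \<dots> = phi b"
    using Suc theta_props by (simp add: algebra_simps)
  finally show ?case .
qed simp

lemma phi_start: "phi (pi/2 - theta) = - (L/2)"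
  by (simp add: phi_def sin_diff theta_props(3))

lemma phi_0: "phi 0 = 0" by (simp add: phi_def)

text \<open>For odd m the rotation arrives at \<open>theta/2\<close>, from where another rotation
  would leave the range. There \<open>sin (3 * theta/2) = (1 + L) * sin (theta/2)\<close>, so the
  reciprocal of |phi| is \<open>2 * L + (1 - L)\<close> and the digit is -2.\<close>

lemma phi_half: "T (phi (theta/2)) = 1 - L"
proof (rule rosen_map_eqI(2))
  have s: "sin (theta/2) > 0" "sin (theta/2 + theta) > 0"
    using theta_props pi_gt_zero by (auto intro!: sin_gt_zero)
  then show "phi (theta/2) \<noteq> 0" by (simp add: phi_def)
  have c: "cos theta = 1 - 2 * sin (theta/2) ^ 2"
    using cos_double_sin[of "theta/2"] by simp
  have "sin (theta/2 + theta) = sin (theta/2) * cos theta + cos (theta/2) * (2 * sin (theta/2) * cos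
      (theta/2))"
    using sin_double[of "theta/2"] by (simp only: sin_add) simp
  also have "\<dots> = sin (theta/2) * (cos theta + 2 * (cos (theta/2)) ^ 2)"
    by (simp add: power2_eq_square algebra_simps)
  also have "\<dots> = sin (theta/2) * (1 + L)"
  proof -
    have "cos theta + 2 * (cos (theta/2))\<^sup>2 = 1 + L"
      using c sin_cos_squared_add[of "theta/2"] theta_props(3) by linarith
    then show ?thesis by simp
  qed
  finally show "\<bar>1 / phi (theta/2)\<bar> = L * real_of_int 2 + (1 - L)"
    using s L_ge_1 by (simp add: phi_def abs_if)
  show "- L \<le> 2 * (1 - L)" "2 * (1 - L) < L" using L_ge_1 L_less_2 by auto
qed

text \<open>Locates the image under the digit -2 in the trigonometric parameter, so that the
  rotation can resume.\<close>

lemma phi_one_minus: "phi (pi/2 - 3 * theta / 2) = 1 - L"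
proof -
  have s: "cos (theta/2) > 0"
    using theta_props pi_gt_zero by (auto intro!: cos_gt_zero)
  have "3 * theta / 2 = theta/2 + theta" by simp
  have c: "cos theta = 2 * cos (theta/2) ^ 2 - 1"
    using cos_double_cos[of "theta/2"] by simp
  have "cos (theta/2 + theta) = cos (theta/2) * cos theta - sin (theta/2) * (2 * sin (theta/2) * cos
      (theta/2))"
    using sin_double[of "theta/2"] by (simp only: cos_add) simp
  also have "\<dots> = cos (theta/2) * (cos theta - 2 * (sin (theta/2)) ^ 2)"
    by (simp add: power2_eq_square algebra_simps)
  also have "\<dots> = cos (theta/2) * (L - 1)"
  proof -
    have "cos theta - 2 * (sin (theta/2))\<^sup>2 = L - 1"
      using c sin_cos_squared_add[of "theta/2"] theta_props(3) by linarith
    then show ?thesis by simp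
  qed
  finally have "cos (3 * theta / 2) = cos (theta/2) * (L - 1)" by (simp add: field_simps)
  moreover have "sin (pi/2 - 3 * theta / 2) = cos (3 * theta / 2)" by (simp add: sin_diff)
  moreover have "sin (pi/2 - 3 * theta / 2 + theta) = cos (theta/2)"
  proof -
    have "pi/2 - 3 * theta / 2 + theta = pi/2 - theta/2" by simp
    then show ?thesis by (simp only: sin_diff) simp
  qed
  ultimately show ?thesis using s by (simp add: phi_def)
qed

text \<open>For m = 2p the start \<open>pi/2 - theta\<close> is p - 1 rotations away from 0. For m =
  2h + 3 it is h rotations away from \<open>theta/2\<close>; the digit -2 then leads to
  \<open>h * theta\<close>, and h more rotations end at 0.\<close>

lemma orbit_reaches_0: "\<exists>n. left_orbit n = 0"
proof (cases "even m")
  case True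
  then obtain p where p: "m = 2 * p" by blast
  have "0 + real (p - 1) * theta = pi/2 - theta"
  proof -
    have "real m * theta = pi" using m3 by (simp add: theta_def)
    then have "2 * (real p * theta) = pi" using p by simp
    moreover have "real (p - 1) * theta = real p * theta - theta"
      using p m3 by (simp add: of_nat_diff algebra_simps)
    ultimately show ?thesis by simp
  qed
  then have "left_orbit (p - 1) = 0"
    using phi_iterate[of 0 "p - 1"] by (simp add: left_orbit_def phi_start phi_0)
  then show ?thesis ..
next
  case False
  define h where "h = (m - 3) div 2"
  have h: "m = 2 * h + 3" using False m3 unfolding h_def by presburger
  have e1: "theta/2 + real h * theta = pi/2 - theta"
  proof -
    have "real m * theta = pi" using m3 by (simp add: theta_def)
    then show ?thesis unfolding h by (simp add: field_simps)
  qed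
  then have "left_orbit h = phi (theta/2)"
    using phi_iterate[of "theta/2" h] theta_props(1) by (simp add: left_orbit_def phi_start)
  then have "left_orbit (Suc h) = phi (pi/2 - 3 * theta/2)"
    using phi_half phi_one_minus by (simp add: left_orbit_def)
  moreover have e2: "pi/2 - 3 * theta/2 = 0 + real h * theta" using e1 by simp
  ultimately have "(T ^^ h) (left_orbit (Suc h)) = 0"
    using phi_iterate[of 0 h] theta_props(1) by (simp add: phi_0)
  then have "left_orbit (h + Suc h) = 0" unfolding left_orbit_def funpow_add by simp
  then show ?thesis ..
qed

section \<open>Finiteness of the set of ends\<close>

lemma T_0: "(T ^^ n) 0 = 0"
  by (induction n) (auto simp: rosen_map_def)

lemma left_orbit_add: "(T ^^ i) (left_orbit j) = left_orbit (i + j)"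
  by (simp add: left_orbit_def funpow_add)

lemma left_orbit_eventually_0: "\<exists>n. \<forall>j\<ge>n. left_orbit j = 0"
proof -
  obtain n where "left_orbit n = 0" using orbit_reaches_0 by blast
  then have "left_orbit (i + n) = 0" for i using left_orbit_add[of i n] T_0 by simp
  then show ?thesis by (metis le_add_diff_inverse2)
qed

lemma finite_ends: "finite markov_ends"
proof -
  obtain n where n: "\<forall>j\<ge>n. left_orbit j = 0" using left_orbit_eventually_0 by blast
  have "markov_ends \<subseteq> (\<Union>j\<in>{..n}. {left_orbit j, - left_orbit j})"
  proof
    fix e assume "e \<in> markov_ends"
    then obtain j where j: "\<bar>e\<bar> = \<bar>left_orbit j\<bar>" by (auto simp: markov_ends_def)
    have "\<bar>e\<bar> = \<bar>left_orbit (min j n)\<bar>" using j n by (cases "j \<le> n") auto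
    then show "e \<in> (\<Union>j\<in>{..n}. {left_orbit j, - left_orbit j})" by (force simp: abs_eq_iff)
  qed
  then show ?thesis by (rule finite_subset) auto
qed

lemma finite_markov: "finite markov_intervals"
proof -
  have "markov_intervals \<subseteq> (\<lambda>(a,b). {a<..<b}) ` (markov_ends \<times> markov_ends)" by (auto simp:
      markov_intervals_def)
  then show ?thesis using finite_ends by (meson finite_SigmaI finite_imageI finite_subset)
qed

lemma half_L_ends: "L/2 \<in> markov_ends" "- (L/2) \<in> markov_ends"
  unfolding markov_ends_def by (auto intro!: exI[of _ 0] simp: left_orbit_def)

lemma minus_ends: "e \<in> markov_ends \<Longrightarrow> - e \<in> markov_ends"
  by (auto simp: markov_ends_def)

lemma ends_bound:
  assumes "e \<in> markov_ends" shows "\<bar>e\<bar> \<le> L/2"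
proof -
  obtain j where "\<bar>e\<bar> = \<bar>left_orbit j\<bar>" using assms by (auto simp: markov_ends_def)
  moreover have "\<bar>left_orbit j\<bar> \<le> L/2"
  proof (cases j)
    case (Suc i)
    then have "left_orbit j = T (left_orbit i)" by (simp add: left_orbit_def)
    then show ?thesis using map_range[of "left_orbit i"] by (simp add: abs_le_iff)
  qed (simp add: left_orbit_def)
  ultimately show ?thesis by simp
qed

lemma T_ends_left_orbit: "e \<in> markov_ends \<Longrightarrow> \<exists>j. T e = left_orbit (Suc j)"
proof -
  assume "e \<in> markov_ends"
  then obtain j where "e = left_orbit j \<or> e = - left_orbit j" by (auto simp: markov_ends_def abs_eq_iff)
  then show ?thesis using map_minus by (auto simp: left_orbit_def intro!: exI[of _ j])
qed

lemma T_ends: "e \<in> markov_ends \<Longrightarrow> T e \<in> markov_ends"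
  using T_ends_left_orbit[of e] by (auto simp: markov_ends_def)

lemma T_ends_iterate: "e \<in> markov_ends \<Longrightarrow> \<exists>n. (T ^^ n) e = 0"
proof -
  assume "e \<in> markov_ends"
  then obtain j where "T e = left_orbit (Suc j)" using T_ends_left_orbit by blast
  moreover obtain n where "left_orbit (n + Suc j) = 0" using left_orbit_eventually_0 le_add1 by blast
  ultimately have "(T ^^ Suc n) e = 0" by (simp add: funpow_swap1 left_orbit_add)
  then show ?thesis by blast
qed

text \<open>A return of the orbit to -L/2 would make it periodic there, whereas it is eventually
  0.\<close>

lemma T_ends_interior:
  assumes "e \<in> markov_ends" shows "T e \<in> I0"
proof -
  have ne: "left_orbit (Suc j) \<noteq> - (L/2)" for j
  proof
    assume *: "left_orbit (Suc j) = - (L/2)"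
    have "left_orbit (i * Suc j) = - (L/2)" for i
    proof (induction i)
      case (Suc i)
      have "left_orbit (Suc i * Suc j) = (T ^^ (i * Suc j)) (left_orbit (Suc j))"
        by (simp only: left_orbit_add) (simp add: algebra_simps)
      then show ?case using * Suc by (simp add: left_orbit_def)
    qed (simp add: left_orbit_def)
    moreover obtain n where "\<forall>j\<ge>n. left_orbit j = 0" using left_orbit_eventually_0 by blast
    then have "left_orbit (n * Suc j) = 0" by simp
    ultimately show False by (metis L_neq_0 divide_eq_0_iff neg_equal_0_iff_equal zero_neq_numeral)
  qed
  then have "T e \<noteq> - (L/2)" using T_ends_left_orbit[OF assms] by metis
  then show ?thesis using map_range[of e] by (auto simp: mem_I0)
qed

text \<open>The bounds are those that characterise \<open>T e\<close>, so k is forced to be the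
  digit of e.\<close>

lemma cut_ends:
  assumes "e \<in> markov_ends" "e > 0" "- L \<le> 2 * (1/e - L * real_of_int k)" "2 * (1/e - L *
      real_of_int k) < L"
  shows "1/e - L * real_of_int k \<in> markov_ends"
  using rosen_map_eqI(2)[of e k "1/e - L * real_of_int k"] T_ends[OF assms(1)] assms by simp

text \<open>For k > 0 the branch is positive and decreasing: b produces the lower bound, and an end
  a \<le> 0 imposes no condition.\<close>

lemma branch_domain_pos:
  assumes "k > 0" "b > 0"
  shows "branch_domain k {a<..<b} =
    {max (- (L/2)) (1/b - L*k) <..< (if a \<le> 0 then L/2 else min (L/2) (1/a - L*k))}"
proof -
  have "inv_branch k y < b \<longleftrightarrow> 1/b - L*k < y" "a < inv_branch k y \<longleftrightarrow> a \<le> 0 \<or> y < 1/a - L*k" if "y \<in> I0"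
      for y
  proof -
    define D where "D = L*k + y"
    have D: "D > 0" "inv_branch k y = 1/D"
      using denom_pos'[OF that, of k] assms by (auto simp: inv_branch_def D_def)
    show "inv_branch k y < b \<longleftrightarrow> 1/b - L*k < y"
      using D assms unfolding D(2) by (simp add: divide_less_eq mult.commute) (simp add: D_def
          field_simps)
    show "a < inv_branch k y \<longleftrightarrow> a \<le> 0 \<or> y < 1/a - L*k"
    proof (cases "a \<le> 0")
      case True
      then show ?thesis using D by (simp add: le_less_trans[of a 0])
    next
      case False
      then have "a < 1/D \<longleftrightarrow> D < 1/a" using D by (simp add: less_divide_eq mult.commute)
      then show ?thesis using False D by (auto simp: D_def)
    qed
  qed
  then show ?thesis using assms unfolding branch_domain_def by (auto simp: mem_I0)
qed

section \<open>The Markov property\<close>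

lemma inv_branch_minus: "inv_branch (- k) y = - inv_branch k y"
  by (simp add: inv_branch_def)

lemma branch_domain_minus: "branch_domain (- k) J = branch_domain k (uminus ` J)"
  by (auto simp: branch_domain_def inv_branch_minus image_iff minus_equation_iff) (metis minus_minus)

lemma markov_minus: "J \<in> markov_intervals \<Longrightarrow> uminus ` J \<in> markov_intervals"
  by (auto simp: markov_intervals_def) (metis minus_ends neg_less_iff_less)

text \<open>Each end of the domain is an end of \<open>I0\<close> or the image \<open>T e\<close> of
  an end e of J.\<close>

lemma markov_branch_domain_pos:
  assumes "J \<in> markov_intervals" "k > 0" "branch_domain k J \<noteq> {}"
  shows "branch_domain k J \<in> markov_intervals"
proof -
  obtain a b where J: "J = {a<..<b}" "a \<in> markov_ends" "b \<in> markov_ends" "a < b" using assms by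
      (auto simp: markov_intervals_def)
  obtain y where "y \<in> branch_domain k J" using assms by blast
  then have "0 < b" using J denom_pos'[of y k] assms by (auto simp: branch_domain_def inv_branch_def
      elim: less_trans[rotated])
  define a' where "a' = max (- (L/2)) (1/b - L*k)"
  define b' where "b' = (if a \<le> 0 then L/2 else min (L/2) (1/a - L*k))"
  have eq: "branch_domain k J = {a'<..<b'}"
    unfolding a'_def b'_def J(1) by (rule branch_domain_pos) fact+
  then have ab: "a' < b'" using assms(3) by auto
  have "a' \<in> markov_ends"
    using cut_ends[of b k] J \<open>0 < b\<close> half_L_ends ab by (auto simp: a'_def b'_def max_def split:
        if_splits)
  moreover have "b' \<in> markov_ends"
    using cut_ends[of a k] J half_L_ends ab by (auto simp: a'_def b'_def min_def split: if_splits)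
  ultimately show ?thesis using ab eq by (auto simp: markov_intervals_def)
qed

lemma markov_branch_domain:
  assumes "J \<in> markov_intervals" "branch_domain k J \<noteq> {}"
  shows "branch_domain k J \<in> markov_intervals"
proof (cases "k > 0")
  case False
  have "k \<noteq> 0" using assms by (auto simp: branch_domain_def)
  with False have "- k > 0" by simp
  moreover have "branch_domain k J = branch_domain (- k) (uminus ` J)" using branch_domain_minus[of
      "- k" J] by simp
  ultimately show ?thesis using assms markov_minus markov_branch_domain_pos by metis
qed (use assms markov_branch_domain_pos in blast)

lemma I0_markov: "I0 \<in> markov_intervals"
  unfolding markov_intervals_def I0_def mem_Collect_eq
  using half_L_ends by (intro exI[of _ "-(L/2)"] exI[of _ "L/2"]) simp

lemma markov_props:
  assumes "J \<in> markov_intervals" shows "open J" "J \<subseteq> I0" "J \<noteq> {}"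
  using assms ends_bound by (force simp: markov_intervals_def I0_def abs_le_iff)+

text \<open>The threshold 3 serves all m at once, since \<open>L * 3 + y\<close> exceeds 5L/2 > 2.
  For m = 3, where L = 1, the branch of the digit 2 stays in \<open>I0\<close> only for y >
  0.\<close>

lemma full_digit:
  assumes "\<bar>k\<bar> \<ge> 3" shows "branch_domain k I0 = I0"
proof -
  have "inv_branch k y \<in> I0" if "y \<in> I0" for y
  proof -
    have k0: "k \<noteq> 0" using assms by auto
    have "3 \<le> \<bar>real_of_int k\<bar>" using assms by linarith
    then have "L * 3 \<le> L * \<bar>real_of_int k\<bar>" by (intro mult_left_mono) auto
    then have "2 < L * \<bar>real_of_int k\<bar> + y" using that L_ge_1 unfolding mem_I0 by argo
    then have "\<bar>inv_branch k y\<bar> < 1/2" using abs_inv_branch[OF that k0] by (simp add: divide_less_eq)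
    then show ?thesis using L_ge_1 unfolding mem_I0 by argo
  qed
  then show ?thesis using assms by (auto simp: branch_domain_def)
qed

text \<open>Words are read along the forward orbit: the first letter is the digit of the point in J
  itself, and the resulting set consists of the points at which the orbits end.\<close>

fun word_domain :: "int list \<Rightarrow> real set \<Rightarrow> real set" where
  "word_domain [] J = J"
| "word_domain (k # w) J = word_domain w (branch_domain k J)"

text \<open>One endpoint of a Markov interval is followed until it arrives at 0, where the branches of
  large digits are full.\<close>

definition endpoint :: "real \<Rightarrow> real set \<Rightarrow> bool" where
  "endpoint e J \<longleftrightarrow> (\<exists>c. c \<noteq> e \<and> J = {min e c<..<max e c})"

lemma endpoint_minus: "endpoint e J \<Longrightarrow> endpoint (- e) (uminus ` J)"
proof -
  assume "endpoint e J"
  then obtain c where c: "c \<noteq> e" "J = {min e c<..<max e c}" by (auto simp: endpoint_def)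
  then have "- c \<noteq> - e" "uminus ` J = {min (- e) (- c)<..<max (- e) (- c)}"
    by (auto simp: min_def max_def)
  then show ?thesis unfolding endpoint_def by blast
qed

text \<open>The branch that belongs to the digit of e keeps \<open>T e\<close> as an end of its
  domain. Since \<open>T e\<close> is interior to \<open>I0\<close>, room remains on the required
  side, whether J lies to the right or to the left of e.\<close>

lemma endpoint_step_pos:
  assumes "e \<in> markov_ends" "e > 0" "endpoint e J" "J \<in> markov_intervals"
  shows "\<exists>k. branch_domain k J \<noteq> {} \<and> endpoint (T e) (branch_domain k J)"
proof -
  define k where "k = rosen_digit m e"
  have k: "k > 0" using digit_pos[of e] ends_bound[OF assms(1)] assms(2) by (simp add: k_def)
  have Te: "1/e - L*k = T e" using digit_map_eq[of e] assms(2) by (simp add: k_def)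
  have TI: "- L < 2 * T e" "2 * T e < L" using T_ends_interior[OF assms(1)] by (auto simp: mem_I0)
  obtain c where c: "c \<noteq> e" "J = {min e c<..<max e c}" using assms(3) by (auto simp: endpoint_def)
  show ?thesis
  proof (cases "e < c")
    case True
    then have J: "J = {e<..<c}" using c by (simp add: min_def max_def)
    have lt: "1/c < 1/e" using True assms(2) by (simp add: frac_less2)
    have "branch_domain k J = {max (- (L/2)) (1/c - L*k) <..< T e}"
      using branch_domain_pos[OF k, of c e] True assms(2) Te TI unfolding J by (simp add: min_def)
    moreover have "max (- (L/2)) (1/c - L*k) < T e" using lt Te TI by auto
    ultimately show ?thesis
      unfolding endpoint_def by (intro exI[of _ k] conjI exI[of _ "max (- (L/2)) (1/c - L*k)"]) auto
  next
    case False
    then have ce: "c < e" and J: "J = {c<..<e}" using c by (auto simp: min_def max_def)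
    define d where "d = (if c \<le> 0 then L/2 else min (L/2) (1/c - L*k))"
    have "branch_domain k J = {T e <..< d}"
      using branch_domain_pos[OF k assms(2), of c] Te TI unfolding J d_def by (simp add: max_def)
    moreover have "T e < d"
    proof (cases "c \<le> 0")
      case False
      then have "1/e < 1/c" using ce by (simp add: frac_less2)
      then show ?thesis using Te TI False by (auto simp: d_def)
    qed (use TI d_def in auto)
    ultimately show ?thesis
      unfolding endpoint_def by (intro exI[of _ k] conjI exI[of _ d]) auto
  qed
qed

lemma endpoint_step:
  assumes "e \<in> markov_ends" "e \<noteq> 0" "endpoint e J" "J \<in> markov_intervals"
  shows "\<exists>k. branch_domain k J \<noteq> {} \<and> endpoint (T e) (branch_domain k J)"
proof (cases "e > 0")
  case False
  then have "- e > 0" using assms(2) by simp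
  then obtain k where "branch_domain k (uminus ` J) \<noteq> {}" "endpoint (T (- e)) (branch_domain k
      (uminus ` J))"
    using endpoint_step_pos[OF minus_ends[OF assms(1)] _ endpoint_minus[OF assms(3)] markov_minus[OF
        assms(4)]]
    by blast
  then show ?thesis unfolding map_minus branch_domain_minus[symmetric] by blast
qed (use assms endpoint_step_pos in blast)

lemma full_near_0:
  assumes "b > 0" "a \<le> 0"
  shows "\<exists>k. branch_domain k {a<..<b} = I0"
proof -
  \<comment> \<open>This puts the cut \<open>1/b - L*n\<close> below \<open>- (L/2)\<close>, so the
    whole branch of n lies between 0 and b.\<close>
  obtain n :: nat where "1/b + L < real n * L" using ex_less_of_nat_mult[OF L_pos] by blast
  then have n: "1/b + L < L * n" by (simp only: mult.commute)
  moreover have "0 < 1/b + L" using assms by (simp add: add_pos_pos)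
  ultimately have "0 < L * n" by linarith
  then have "int n > 0" by (simp add: zero_less_mult_iff)
  then have "branch_domain (int n) {a<..<b} = {max (- (L/2)) (1/b - L*int n) <..< L/2}"
    using branch_domain_pos[of "int n" b a] assms by simp
  also have "\<dots> = I0"
  proof -
    have "1/b - L * n \<le> - (L/2)" using n L_pos by (simp del: L_pos)
    then show ?thesis by (simp add: I0_def max_def)
  qed
  finally show ?thesis by blast
qed

lemma reach_full_aux:
  assumes "(T ^^ n) e = 0" "e \<in> markov_ends" "endpoint e J" "J \<in> markov_intervals"
  shows "\<exists>w. word_domain w J = I0"
  using assms
proof (induction n arbitrary: e J)
  case 0
  then obtain c where c: "c \<noteq> 0" "J = {min 0 c<..<max 0 c}" by (auto simp: endpoint_def)
  have "\<exists>k. branch_domain k J = I0"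
  proof (cases "c > 0")
    case False
    then have "uminus ` J = {0<..<-c}" using c by (auto simp: min_def max_def)
    then obtain k where "branch_domain k (uminus ` J) = I0" using full_near_0[of "-c" 0] False c by auto
    then show ?thesis using branch_domain_minus by metis
  qed (use full_near_0[of c 0] c in simp)
  then obtain k where "word_domain [k] J = I0" by auto
  then show ?case by blast
next
  case (Suc n)
  show ?case
  proof (cases "e = 0")
    \<comment> \<open>0 is fixed by \<open>T\<close>, so the count n drops without a digit being
      consumed.\<close>
    case True
    then show ?thesis using Suc.IH[of e J] Suc.prems T_0 by auto
  next
    case False
    then obtain k where k: "branch_domain k J \<noteq> {}" "endpoint (T e) (branch_domain k J)"
      using endpoint_step Suc.prems by blast
    then obtain w where "word_domain w (branch_domain k J) = I0"
      using Suc.IH[of "T e" "branch_domain k J"] Suc.prems T_ends markov_branch_domain by (auto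
          simp: funpow_swap1)
    then have "word_domain (k # w) J = I0" by simp
    then show ?thesis by blast
  qed
qed

lemma reach_full:
  assumes "J \<in> markov_intervals" shows "\<exists>w. word_domain w J = I0"
proof -
  obtain a b where J: "J = {a<..<b}" "a \<in> markov_ends" "a < b" using assms by (auto simp:
      markov_intervals_def)
  then have "endpoint a J" by (auto simp: endpoint_def intro!: exI[of _ b])
  then show ?thesis using reach_full_aux T_ends_iterate J assms by blast
qed

end

section \<open>Regular densities\<close>

context rosen_expansion begin

text \<open>A Lipschitz bound with constant B on the logarithm of h, two-sided because x and y range
  over both orders. The exponential form also admits h = 0.\<close>

definition regular_density :: "real set \<Rightarrow> real \<Rightarrow> (real \<Rightarrow> real) \<Rightarrow> bool" where
  "regular_density J B h \<longleftrightarrow> continuous_on J h \<and> (\<forall>x\<in>J. 0 \<le> h x) \<and>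
     (\<forall>x\<in>J. \<forall>y\<in>J. h x \<le> exp (B * \<bar>x - y\<bar>) * h y)"

lemma regular_nonneg: "regular_density J B h \<Longrightarrow> x \<in> J \<Longrightarrow> 0 \<le> h x"
  by (simp add: regular_density_def)

lemma regular_continuous: "regular_density J B h \<Longrightarrow> continuous_on J h"
  by (simp add: regular_density_def)

lemma regular_mono: "regular_density J B h \<Longrightarrow> B \<le> B' \<Longrightarrow> regular_density J B' h"
  unfolding regular_density_def by (meson exp_le_cancel_iff mult_right_mono abs_ge_zero order.trans)

lemma regular_const: "0 \<le> B \<Longrightarrow> 0 \<le> c \<Longrightarrow> regular_density J B (\<lambda>x. c)"
  by (auto simp: regular_density_def intro!: mult_right_mono[of 1 _ c, simplified])

text \<open>On the domain 1/D < L/2, so the branch contracts by L^2/4 and B is scaled by this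
  factor. The logarithm of 1/D^2 has slope of modulus 2/D < L < 2, which adds the constant
  2.\<close>

lemma transfer_regular:
  assumes "J \<subseteq> I0" "regular_density J B h" "0 \<le> B"
  shows "regular_density (branch_domain k J) (B * (L\<^sup>2/4) + 2) (transfer k h)"
proof (cases "k = 0")
  case False
  define D where "D x = L * \<bar>real_of_int k\<bar> + x" for x
  have D: "0 < D x" "1 / D x < L/2" "\<bar>inv_branch k x\<bar> = 1 / D x" if "x \<in> branch_domain k J" for x
  proof -
    have x: "x \<in> I0" "inv_branch k x \<in> I0" using that assms(1) by (auto simp: branch_domain_def)
    then show "0 < D x" "\<bar>inv_branch k x\<bar> = 1 / D x"
      using denom_pos'[OF x(1) False] abs_inv_branch[OF x(1) False] by (auto simp: D_def)
    then show "1 / D x < L/2" using x(2) unfolding mem_I0 by argo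
  qed
  have ineq: "transfer k h x \<le> exp ((B * (L\<^sup>2/4) + 2) * \<bar>x - y\<bar>) * transfer k h y"
    if x: "x \<in> branch_domain k J" and y: "y \<in> branch_domain k J" for x y
  proof -
    have "inv_branch k x - inv_branch k y = sgn (real_of_int k) * ((y - x) * ((1 / D x) * (1 / D y)))"
    proof -
      have 1: "y - x = D y - D x" by (simp add: D_def)
      have 2: "inv_branch k x = sgn (real_of_int k) / D x" "inv_branch k y = sgn (real_of_int k) / D y"
        by (simp_all add: inv_branch_def D_def)
      have "c / p - c / q = c * ((q - p) * ((1 / p) * (1 / q)))" if "0 < p" "0 < q" for c p q :: real
        using that by (simp add: field_simps)
      then show ?thesis unfolding 1 2 using D(1)[OF x] D(1)[OF y] .
    qed
    then have "\<bar>inv_branch k x - inv_branch k y\<bar> = \<bar>x - y\<bar> * ((1 / D x) * (1 / D y))"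
      using False D(1)[OF x] D(1)[OF y] by (simp add: abs_mult abs_sgn_eq abs_minus_commute)
    also have "\<dots> \<le> \<bar>x - y\<bar> * ((L/2) * (L/2))"
      using D[OF x] D[OF y] by (intro mult_left_mono mult_mono) auto
    finally have inv_branch_le: "\<bar>inv_branch k x - inv_branch k y\<bar> \<le> L\<^sup>2/4 * \<bar>x - y\<bar>" by (simp add:
        power2_eq_square mult_ac)
    have "h (inv_branch k x) \<le> exp (B * \<bar>inv_branch k x - inv_branch k y\<bar>) * h (inv_branch k y)"
      using assms(2) x y by (auto simp: regular_density_def branch_domain_def)
    also have "\<dots> \<le> exp (B * (L\<^sup>2/4 * \<bar>x - y\<bar>)) * h (inv_branch k y)"
    proof (rule mult_right_mono)
      have "B * \<bar>inv_branch k x - inv_branch k y\<bar> \<le> B * (L\<^sup>2/4 * \<bar>x - y\<bar>)"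
        using inv_branch_le assms(3) by (rule mult_left_mono)
      then show "exp (B * \<bar>inv_branch k x - inv_branch k y\<bar>) \<le> exp (B * (L\<^sup>2/4 * \<bar>x - y\<bar>))" by simp
      show "0 \<le> h (inv_branch k y)" using regular_nonneg[OF assms(2), of "inv_branch k y"] y by
          (simp add: branch_domain_def)
    qed
    finally have 1: "h (inv_branch k x) \<le> exp (B * (L\<^sup>2/4 * \<bar>x - y\<bar>)) * h (inv_branch k y)" .
    \<comment> \<open>As 1/D x \<le> 1, the bracket is at most 1 + |x - y| \<le> exp |x - y|;
      squaring produces the summand 2.\<close>
    have "1 / D x = (1 + (y - x) * (1 / D x)) * (1 / D y)"
    proof -
      have 1: "y - x = D y - D x" by (simp add: D_def)
      show ?thesis unfolding 1 using D(1)[OF x] D(1)[OF y] by (simp add: field_simps)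
    qed
    also have "\<dots> \<le> (1 + \<bar>x - y\<bar>) * (1 / D y)"
    proof -
      have "(y - x) * (1 / D x) \<le> \<bar>x - y\<bar> * 1"
      proof (rule mult_mono)
        show "1 / D x \<le> 1" using D(2)[OF x] L_less_2 by argo
      qed (use D(1)[OF x] in auto)
      then show ?thesis using D(1)[OF y] by (intro mult_right_mono) auto
    qed
    also have "\<dots> \<le> exp \<bar>x - y\<bar> * (1 / D y)"
      using D(1)[OF y] by (intro mult_right_mono) auto
    finally have "(1 / D x)\<^sup>2 \<le> (exp \<bar>x - y\<bar> * (1 / D y))\<^sup>2"
      using D(1)[OF x] by (intro power_mono) auto
    then have 2: "(1 / D x)\<^sup>2 \<le> exp (2 * \<bar>x - y\<bar>) * (1 / D y)\<^sup>2"
      by (simp only: power_mult_distrib exp_double)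
    have "h (inv_branch k x) * (1 / D x)\<^sup>2 \<le>
        (exp (B * (L\<^sup>2/4 * \<bar>x - y\<bar>)) * h (inv_branch k y)) * (exp (2 * \<bar>x - y\<bar>) * (1 / D y)\<^sup>2)"
      using 1 2 regular_nonneg[OF assms(2), of "inv_branch k y"] y by (intro mult_mono) (simp_all
          add: branch_domain_def)
    also have "\<dots> = exp ((B * (L\<^sup>2/4) + 2) * \<bar>x - y\<bar>) * (h (inv_branch k y) * (1 / D y)\<^sup>2)"
    proof -
      have "(B * (L\<^sup>2/4) + 2) * \<bar>x - y\<bar> = B * (L\<^sup>2/4 * \<bar>x - y\<bar>) + 2 * \<bar>x - y\<bar>"
        by (simp only: distrib_right mult.assoc)
      then show ?thesis by (simp only: exp_add mult_ac)
    qed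
    finally show ?thesis by (simp add: transfer_def D_def power_divide)
  qed
  have "continuous_on (branch_domain k J) (\<lambda>y. h (inv_branch k y))"
  proof (rule continuous_on_compose2[OF regular_continuous[OF assms(2)]])
    show "continuous_on (branch_domain k J) (inv_branch k)" by (rule continuous_on_inv_branch[OF
        False branch_domain_subset])
    show "inv_branch k ` branch_domain k J \<subseteq> J" by (auto simp: branch_domain_def)
  qed
  then have "continuous_on (branch_domain k J) (transfer k h)"
    unfolding transfer_def[abs_def] using D(1)
    by (intro continuous_intros) (auto simp: D_def less_imp_neq[symmetric])
  moreover have "0 \<le> transfer k h x" if "x \<in> branch_domain k J" for x
  proof -
    have "0 \<le> h (inv_branch k x)" using regular_nonneg[OF assms(2), of "inv_branch k x"] that by
        (simp add: branch_domain_def)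
    then show ?thesis by (simp add: transfer_def)
  qed
  ultimately show ?thesis using ineq unfolding regular_density_def by blast
qed (simp add: regular_density_def branch_domain_def)

text \<open>With d = |x - y|, convexity of exp gives (1 - B'/B)(exp (B d) - 1) \<le> exp (B d) - exp
  (B' d). This gain from B' to B pays for removing a constant of at most the fraction 1 - B'/B of
  g.\<close>

lemma regular_diff_const:
  assumes "regular_density J B' g" "0 \<le> B'" "B' \<le> B" "0 < B" "0 \<le> c"
    and c: "\<And>y. y \<in> J \<Longrightarrow> c \<le> (1 - B' / B) * g y"
  shows "regular_density J B (\<lambda>y. g y - c)"
  unfolding regular_density_def
proof (intro conjI ballI)
  show "continuous_on J (\<lambda>y. g y - c)" using regular_continuous[OF assms(1)] by (intro
      continuous_intros)
  fix x assume x: "x \<in> J"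
  have "(1 - B' / B) * g x \<le> 1 * g x" using regular_nonneg[OF assms(1) x] assms by (intro
      mult_right_mono) auto
  then show "0 \<le> g x - c" using c[OF x] by simp
  fix y assume y: "y \<in> J"
  define d where "d = \<bar>x - y\<bar>"
  have "convex_on UNIV (exp :: real \<Rightarrow> real)" by (rule exp_convex)
  then have "exp ((1 - B'/B) *\<^sub>R 0 + (B'/B) *\<^sub>R (B * d)) \<le> (1 - B'/B) * exp 0 + (B'/B) * exp (B * d)"
    using assms by (intro convex_onD) auto
  then have conv: "exp (B' * d) \<le> (1 - B'/B) + (B'/B) * exp (B * d)" using assms by simp
  have e1: "1 \<le> exp (B * d)" using assms by (simp add: d_def)
  have "c * (exp (B * d) - 1) \<le> ((1 - B'/B) * g y) * (exp (B * d) - 1)"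
    using c[OF y] e1 by (intro mult_right_mono) auto
  also have "\<dots> = ((1 - B'/B) * (exp (B * d) - 1)) * g y" by simp
  also have "\<dots> \<le> (exp (B * d) - exp (B' * d)) * g y"
    using conv regular_nonneg[OF assms(1) y] by (intro mult_right_mono) (auto simp: algebra_simps)
  finally have "exp (B' * d) * g y - c \<le> exp (B * d) * (g y - c)" by (simp add: algebra_simps)
  moreover have "g x \<le> exp (B' * d) * g y" using assms(1) x y by (simp add: regular_density_def d_def)
  ultimately show "g x - c \<le> exp (B * \<bar>x - y\<bar>) * (g y - c)" unfolding d_def by linarith
qed

lemma markov_diameter: "J \<in> markov_intervals \<Longrightarrow> x \<in> J \<Longrightarrow> y \<in> J \<Longrightarrow> \<bar>x - y\<bar> \<le> L"
proof -
  assume "J \<in> markov_intervals" "x \<in> J" "y \<in> J"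
  then have "x \<in> I0" "y \<in> I0" using markov_props(2) by auto
  then show ?thesis unfolding mem_I0 by argo
qed

lemma regular_le:
  assumes "J \<in> markov_intervals" "regular_density J B h" "0 \<le> B" "x \<in> J" "y \<in> J"
  shows "h x \<le> exp (B * L) * h y"
proof -
  have "h x \<le> exp (B * \<bar>x - y\<bar>) * h y" using assms by (simp add: regular_density_def)
  also have "\<dots> \<le> exp (B * L) * h y"
    using assms markov_diameter[OF assms(1,4,5)] regular_nonneg
    by (intro mult_right_mono) (auto intro: mult_left_mono)
  finally show ?thesis .
qed

lemma markov_measure: "J \<in> markov_intervals \<Longrightarrow> J \<in> lmeasurable \<and> measure lebesgue J \<le> L"
proof -
  assume "J \<in> markov_intervals"
  then obtain a b where "J = {a<..<b}" "a \<in> markov_ends" "b \<in> markov_ends" "a < b" by (auto simp: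
      markov_intervals_def)
  then show ?thesis using ends_bound[of a] ends_bound[of b] by auto
qed

lemma regular_integrable:
  assumes "J \<in> markov_intervals" "regular_density J B h" "0 \<le> B" "u \<in> borel_measurable borel" "\<And>x.
      \<bar>u x\<bar> \<le> M"
  shows "(\<lambda>x. h x * u x) absolutely_integrable_on J"
proof -
  obtain y where y: "y \<in> J" using markov_props(3)[OF assms(1)] by blast
  have J: "J \<in> sets lebesgue" "J \<in> lmeasurable" using markov_measure[OF assms(1)] by auto
  show ?thesis
  proof (rule measurable_bounded_by_integrable_imp_absolutely_integrable)
    have "h \<in> borel_measurable (lebesgue_on J)"
      using regular_continuous[OF assms(2)] J by (intro continuous_imp_measurable_on_sets_lebesgue)
    moreover have "u \<in> borel_measurable (lebesgue_on J)"
      using assms(4) by (intro measurable_restrict_space1 measurable_completion) simp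
    ultimately show "(\<lambda>x. h x * u x) \<in> borel_measurable (lebesgue_on J)" by measurable
    show "(\<lambda>x. (exp (B * L) * h y) * M) integrable_on J"
      using J(2) by (rule integrable_on_const)
    show "norm (h x * u x) \<le> (exp (B * L) * h y) * M" if "x \<in> J" for x
    proof -
      have "\<bar>h x\<bar> \<le> exp (B * L) * h y"
        using regular_le[OF assms(1-3) that y] regular_nonneg[OF assms(2) that] by simp
      then show ?thesis
        unfolding real_norm_def abs_mult using assms(5) by (intro mult_mono) (auto intro: order.trans)
    qed
  qed (use J in auto)
qed

lemma regular_integrable1:
  assumes "J \<in> markov_intervals" "regular_density J B h" "0 \<le> B" shows "h absolutely_integrable_on J"
  using regular_integrable[OF assms, of "\<lambda>_. 1" 1] by simp

text \<open>Later read as a lower bound: at every point, h is at least a fixed multiple of its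
  mass.\<close>

lemma regular_integral_le:
  assumes "J \<in> markov_intervals" "regular_density J B h" "0 \<le> B" "y \<in> J"
  shows "integral J h \<le> L * exp (B * L) * h y"
proof -
  have J: "J \<in> lmeasurable" "measure lebesgue J \<le> L" using markov_measure[OF assms(1)] by auto
  have "integral J h \<le> integral J (\<lambda>x. exp (B * L) * h y)"
    using regular_integrable1[OF assms(1-3)] J regular_le[OF assms(1-3) _ assms(4)]
    by (intro integral_le set_lebesgue_integral_eq_integral(1) integrable_on_const) auto
  also have "\<dots> = measure lebesgue J * (exp (B * L) * h y)"
    using J integral_mult_left[of J "\<lambda>_. 1" "exp (B * L) * h y"] by (simp add: lmeasure_integral)
  also have "\<dots> \<le> L * (exp (B * L) * h y)"
    using J regular_nonneg[OF assms(2,4)] by (intro mult_right_mono) auto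
  finally show ?thesis by simp
qed

lemma regular_integral_nonneg:
  assumes "J \<in> markov_intervals" "regular_density J B h" "0 \<le> B"
  shows "0 \<le> integral J h"
  using regular_integrable1[OF assms] regular_nonneg[OF assms(2)]
  by (intro integral_nonneg set_lebesgue_integral_eq_integral(1)) auto

text \<open>The difference is the integral of F with the image of branch k cut out. The other
  branches do not meet that image, so \<open>branch_nonneg\<close> applies to what remains.\<close>

lemma branch_le:
  assumes J: "open J" "J \<subseteq> I0" "F absolutely_integrable_on J"
    and nonneg: "\<And>k'. k' \<noteq> 0 \<Longrightarrow> k' \<noteq> k \<Longrightarrow> 0 \<le> integral (branch_domain k' J) (transfer k' F)"
  shows "integral (branch_domain k J) (transfer k F) \<le> integral J F"
proof -
  define A where "A = inv_branch k ` branch_domain k J"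
  have A: "A \<subseteq> J" by (auto simp: A_def branch_domain_def)
  note b = branch_integral[OF J, of k, folded A_def]
  define G where "G x = indicator (J - A) x * F x" for x
  have int_JA: "F absolutely_integrable_on (J - A)"
    by (rule set_integrable_subset[OF J(3)]) (use b(4) J(1) in auto)
  have G_eq: "G x = (if x \<in> J - A then F x else 0)" for x by (simp add: G_def)
  have "(\<lambda>x. indicator J x *\<^sub>R G x) = (\<lambda>x. indicator (J - A) x *\<^sub>R F x)"
    by (auto simp: G_def indicator_def)
  then have "G absolutely_integrable_on J"
    using int_JA by (simp add: set_integrable_def)
  then have "0 \<le> integral J G"
  proof (rule branch_nonneg[OF J(1,2)])
    fix k' :: int assume k': "k' \<noteq> 0"
    show "0 \<le> integral (branch_domain k' J) (transfer k' G)"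
    proof (cases "k' = k")
      case True
      have "integral (branch_domain k' J) (transfer k' G) = integral (branch_domain k' J) (\<lambda>x. 0)"
        using True by (intro Henstock_Kurzweil_Integration.integral_cong) (auto simp: transfer_def
            G_def A_def)
      then show ?thesis by simp
    next
      case False
      have "integral (branch_domain k' J) (transfer k' G) = integral (branch_domain k' J) (transfer
          k' F)"
      proof (rule Henstock_Kurzweil_Integration.integral_cong)
        fix x assume x: "x \<in> branch_domain k' J"
        then have "inv_branch k' x \<in> J - A"
          using inv_branch_image_disjoint[OF False, of J J] unfolding A_def by (auto simp:
              branch_domain_def)
        then show "transfer k' G x = transfer k' F x" by (simp add: transfer_def G_def)
      qed
      then show ?thesis using nonneg[OF k' False] by simp
    qed
  qed
  also have "integral J G = integral (J - A) F"
  proof -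
    have "(J - A) \<inter> J = J - A" by auto
    then show ?thesis unfolding G_eq[abs_def] integral_restrict_Int by simp
  qed
  also have "\<dots> = integral J F - integral A F"
    using A J(3) b(3) by (intro integral_setdiff set_lebesgue_integral_eq_integral(1)) auto
  finally show ?thesis using b(2) by simp
qed

section \<open>Transfer of a density along a word\<close>

fun word_transfer :: "int list \<Rightarrow> (real \<Rightarrow> real) \<Rightarrow> real \<Rightarrow> real" where
  "word_transfer [] h = h"
| "word_transfer (k # w) h = word_transfer w (transfer k h)"

text \<open>The value lies above the fixed point of B to B L^2/4 + 2, so one transfer strictly
  improves the constant, which leaves room to subtract a constant density.\<close>

definition reg_const :: real where "reg_const = 4 / (1 - L\<^sup>2/4)"
definition contracted_const :: real where "contracted_const = reg_const * (L\<^sup>2/4) + 2"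

lemma reg_const_props: "0 < contracted_const" "contracted_const < reg_const" "0 < reg_const" "L\<^sup>2 < 4"
proof -
  show L: "L\<^sup>2 < 4" using L_less_2 power_strict_mono[of L 2 2] by simp
  then show "0 < reg_const" by (simp add: reg_const_def)
  then show "0 < contracted_const" by (simp add: contracted_const_def add_nonneg_pos)
  have "reg_const * (1 - L\<^sup>2/4) = 4" using L unfolding reg_const_def
    by (subst times_divide_eq_left, subst nonzero_mult_div_cancel_right) auto
  then show "contracted_const < reg_const" by (simp add: contracted_const_def algebra_simps)
qed

lemma transfer_regular_contracted: "J \<in> markov_intervals \<Longrightarrow> regular_density J reg_const h \<Longrightarrow>
    regular_density (branch_domain k J) contracted_const (transfer k h)"
  unfolding contracted_const_def using transfer_regular markov_props reg_const_props by (meson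
      less_imp_le)

lemma transfer_regular_const: "J \<in> markov_intervals \<Longrightarrow> regular_density J reg_const h \<Longrightarrow>
    regular_density (branch_domain k J) reg_const (transfer k h)"
  using transfer_regular_contracted regular_mono reg_const_props by (meson less_imp_le)

lemma word_domain_empty: "word_domain w {} = {}"
  by (induction w) (auto simp: branch_domain_def)

lemma word_transfer_regular:
  assumes "J \<in> markov_intervals" "regular_density J reg_const h" "w \<noteq> []" "word_domain w J \<noteq> {}"
  shows "regular_density (word_domain w J) contracted_const (word_transfer w h)"
  using assms
proof (induction w arbitrary: J h)
  case (Cons k w)
  have ne: "branch_domain k J \<noteq> {}" using Cons.prems(4) word_domain_empty by auto
  show ?case
  proof (cases "w = []")
    case False
    then show ?thesis
      using Cons.IH[of "branch_domain k J" "transfer k h"] markov_branch_domain[OF Cons.prems(1) ne]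
          Cons.prems transfer_regular_const by simp
  qed (use Cons.prems transfer_regular_contracted in simp)
qed simp

text \<open>A lower bound, uniform over \<open>I0\<close>, for the product of the Jacobians along
  the word: L replaces y in each factor.\<close>

definition weight :: "int list \<Rightarrow> real" where
  "weight w = prod_list (map (\<lambda>k. 1 / (L * \<bar>real_of_int k\<bar> + L)\<^sup>2) w)"

lemma weight_pos: "0 < weight w"
proof -
  have "0 < L * \<bar>real_of_int k\<bar> + L" for k by (simp add: add_nonneg_pos)
  then show ?thesis unfolding weight_def by (induction w) (auto simp: less_imp_neq[symmetric])
qed

lemma word_transfer_ge:
  assumes "\<And>x. x \<in> J \<Longrightarrow> c \<le> h x" "0 \<le> c" "y \<in> word_domain w J"
  shows "c * weight w \<le> word_transfer w h y"
  using assms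
proof (induction w arbitrary: J h c)
  case Nil
  then show ?case by (simp add: weight_def)
next
  case (Cons k w)
  have "c * (1 / (L * \<bar>real_of_int k\<bar> + L)\<^sup>2) * weight w \<le> word_transfer w (transfer k h) y"
  proof (rule Cons.IH[of "branch_domain k J"])
    show "c * (1 / (L * \<bar>real_of_int k\<bar> + L)\<^sup>2) \<le> transfer k h x" if "x \<in> branch_domain k J" for x
    proof -
      have x: "x \<in> I0" "k \<noteq> 0" "inv_branch k x \<in> J" using that by (auto simp: branch_domain_def)
      have "x \<le> L" using x(1) L_pos unfolding mem_I0 by argo
      then have "1 / (L * \<bar>real_of_int k\<bar> + L)\<^sup>2 \<le> 1 / (L * \<bar>real_of_int k\<bar> + x)\<^sup>2"
        using denom_pos'[OF x(1,2)]
        by (intro divide_left_mono power_mono zero_less_power mult_pos_pos) (auto simp: add_nonneg_pos)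
      then have "c * (1 / (L * \<bar>real_of_int k\<bar> + L)\<^sup>2) \<le> h (inv_branch k x) * (1 / (L * \<bar>real_of_int
          k\<bar> + x)\<^sup>2)"
        using Cons.prems(1)[OF x(3)] Cons.prems(2) by (intro mult_mono) auto
      then show ?thesis by (simp add: transfer_def)
    qed
  qed (use Cons.prems in auto)
  then show ?case by (simp add: weight_def mult.assoc)
qed

end

section \<open>Sums over a finite extension\<close>

text \<open>The steering words use only digits with full branches, so moving the state does not
  shrink the interval. They are nonempty so that at least one transfer has improved the regularity
  constant.\<close>

locale rosen_skew = rosen_expansion m for m +
  fixes S :: "'s set" and step :: "'s \<Rightarrow> int \<Rightarrow> 's"
  assumes finite_S: "finite S" and S_ne: "S \<noteq> {}"
    and step_bij: "bij_betw (\<lambda>s. step s k) S S"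
    and step_reach: "s \<in> S \<Longrightarrow> t \<in> S \<Longrightarrow>
      \<exists>w. w \<noteq> [] \<and> (\<forall>k\<in>set w. 3 \<le> \<bar>k\<bar>) \<and> foldl step s w = t"
begin

lemma step_in: "s \<in> S \<Longrightarrow> step s k \<in> S"
  using step_bij[of k] by (auto simp: bij_betw_def)

lemma foldl_step_in: "s \<in> S \<Longrightarrow> foldl step s w \<in> S"
  by (induction w arbitrary: s) (auto simp: step_in)

lemma word_domain_append: "word_domain (v @ w) J = word_domain w (word_domain v J)"
  by (induction v arbitrary: J) auto

lemma word_domain_full: "\<forall>k\<in>set w. 3 \<le> \<bar>k\<bar> \<Longrightarrow> word_domain w I0 = I0"
  by (induction w) (auto simp: full_digit)

text \<open>J is first opened up to \<open>I0\<close>, with whatever effect on the state; full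
  digits then steer the state to t.\<close>

lemma full_word:
  assumes "J \<in> markov_intervals" "s \<in> S" "t \<in> S"
  shows "\<exists>w. w \<noteq> [] \<and> word_domain w J = I0 \<and> foldl step s w = t"
proof -
  obtain v where v: "word_domain v J = I0" using reach_full[OF assms(1)] by blast
  obtain w where w: "w \<noteq> []" "\<forall>k\<in>set w. 3 \<le> \<bar>k\<bar>" "foldl step (foldl step s v) w = t"
    using step_reach[OF foldl_step_in[OF assms(2)] assms(3)] by blast
  then have "v @ w \<noteq> [] \<and> word_domain (v @ w) J = I0 \<and> foldl step s (v @ w) = t"
    using v word_domain_full by (simp add: word_domain_append)
  then show ?thesis by blast
qed

text \<open>There are only finitely many triples of an interval and two states, so one word is fixed
  for each and the extremes are taken.\<close>

lemma uniform_full_word: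
  "\<exists>l c. 0 < c \<and> (\<forall>J\<in>markov_intervals. \<forall>s\<in>S. \<forall>t\<in>S. \<exists>w. w \<noteq> [] \<and> word_domain w J = I0 \<and> foldl step s
      w = t
     \<and> length w \<le> l \<and> c \<le> weight w)"
proof -
  define W where "W J s t = (SOME w. w \<noteq> [] \<and> word_domain w J = I0 \<and> foldl step s w = t)" for J s t
  have W: "W J s t \<noteq> [] \<and> word_domain (W J s t) J = I0 \<and> foldl step s (W J s t) = t"
    if "J \<in> markov_intervals" "s \<in> S" "t \<in> S" for J s t
    unfolding W_def by (rule someI_ex[OF full_word[OF that]])
  define X where "X = (\<lambda>(J, s, t). W J s t) ` (markov_intervals \<times> S \<times> S)"
  have X: "W J s t \<in> X" if "J \<in> markov_intervals" "s \<in> S" "t \<in> S" for J s t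
    unfolding X_def by (rule image_eqI[of _ _ "(J, s, t)"]) (simp_all add: that)
  have fX: "finite X" unfolding X_def using finite_markov finite_S by auto
  have "X \<noteq> {}" unfolding X_def using I0_markov S_ne by auto
  then have pos: "0 < Min (weight ` X)" using fX weight_pos by (subst Min_gr_iff) auto
  have bounds: "Min (weight ` X) \<le> weight (W J s t)" "length (W J s t) \<le> Max (length ` X)"
    if "J \<in> markov_intervals" "s \<in> S" "t \<in> S" for J s t
    using fX X[OF that] by auto
  show ?thesis
  proof (intro exI conjI ballI)
    fix J s t assume *: "J \<in> markov_intervals" "s \<in> S" "t \<in> S"
    show "W J s t \<noteq> []" "word_domain (W J s t) J = I0" "foldl step s (W J s t) = t" using W[OF *] by
        blast+
    show "length (W J s t) \<le> Max (length ` X)" "Min (weight ` X) \<le> weight (W J s t)"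
      by (fact bounds[OF *])+
  qed (fact pos)
qed

end

locale rosen_observable = rosen_skew m S step for m and S :: "'s set" and step +
  fixes f :: "'s \<Rightarrow> real" and F0 :: real
  assumes f_bound: "\<bar>f s\<bar> \<le> F0" and f_sum: "sum f S = 0"
begin

section \<open>Sums of an observable of mean zero\<close>

lemma integral_I0_const: "integral I0 (\<lambda>x. c) = L * c" for c :: real
  unfolding I0_def integral_open_interval_real[symmetric] by simp

lemma F0_nonneg: "0 \<le> F0"
  using f_bound[of undefined] by linarith

primrec orbit_sum :: "nat \<Rightarrow> real \<Rightarrow> 's \<Rightarrow> real" where
  "orbit_sum 0 x s = 0"
| "orbit_sum (Suc N) x s = f s + orbit_sum N (T x) (step s (signed_digit x))"

lemma orbit_sum_bound: "\<bar>orbit_sum N x s\<bar> \<le> N * F0"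
proof (induction N arbitrary: x s)
  case (Suc N)
  have "\<bar>orbit_sum (Suc N) x s\<bar> \<le> \<bar>f s\<bar> + \<bar>orbit_sum N (T x) (step s (signed_digit x))\<bar>" by simp
  also have "\<dots> \<le> F0 + N * F0" using f_bound Suc by (intro add_mono) auto
  finally show ?case by (simp add: algebra_simps)
qed simp

lemma orbit_sum_Suc_diff: "\<bar>orbit_sum (Suc N) x s - orbit_sum N x s\<bar> \<le> F0"
proof (induction N arbitrary: x s)
  case (Suc N)
  then show ?case using Suc.IH[of "T x" "step s (signed_digit x)"] by simp
qed (use f_bound in simp)

text \<open>In the second estimate \<open>f s\<close> at the front is exchanged for one term at the
  end, hence the constant \<open>2 * F0\<close>.\<close>

lemma orbit_sum_inv_branch:
  assumes "y \<in> I0" "k \<noteq> 0"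
  shows "orbit_sum (Suc N) (inv_branch k y) s = f s + orbit_sum N y (step s k)"
    and "\<bar>orbit_sum N (inv_branch k y) s - orbit_sum N y (step s k)\<bar> \<le> 2 * F0"
proof -
  show *: "orbit_sum (Suc N) (inv_branch k y) s = f s + orbit_sum N y (step s k)" for N using
      map_inv_branch[OF assms] by simp
  show "\<bar>orbit_sum N (inv_branch k y) s - orbit_sum N y (step s k)\<bar> \<le> 2 * F0"
  proof (cases N)
    case (Suc M)
    then show ?thesis using *[of M] orbit_sum_Suc_diff[of M y "step s k"] f_bound[of s]
      by (simp del: orbit_sum.simps)
  qed (use F0_nonneg in simp)
qed

lemma orbit_sum_measurable [measurable]: "(\<lambda>x. orbit_sum N x s) \<in> borel_measurable borel"
proof (induction N arbitrary: s)
  case (Suc N)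
  have "(\<lambda>x. orbit_sum N (T x) (step s k)) \<in> borel_measurable borel" for k
    using measurable_compose[OF T_measurable Suc[of "step s k"]] by simp
  then have "(\<lambda>x. (\<lambda>k x. orbit_sum N (T x) (step s k)) (signed_digit x) x) \<in> borel_measurable borel"
    by (rule measurable_compose_countable) (rule signed_digit_measurable)
  then show ?case by simp
qed simp

text \<open>For each x every digit permutes S, so the cancellation holds pointwise in x and not only
  after integration.\<close>

lemma sum_orbit_sum: "(\<Sum>s\<in>S. orbit_sum N x s) = 0"
proof (induction N arbitrary: x)
  case (Suc N)
  have "(\<Sum>s\<in>S. orbit_sum N (T x) (step s (signed_digit x))) = (\<Sum>s\<in>S. orbit_sum N (T x) s)"
    by (rule sum.reindex_bij_betw[OF step_bij])
  then show ?case using Suc f_sum by (simp add: sum.distrib)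
qed simp

text \<open>The two signs express a bound on the absolute value of the integral of h times the N-th sum by
    D times the
  mass of h linearly in the integrand.\<close>

definition mean_bounded :: "nat \<Rightarrow> real \<Rightarrow> bool" where
  "mean_bounded N D \<longleftrightarrow> (\<forall>J\<in>markov_intervals. \<forall>h. \<forall>s\<in>S. \<forall>\<sigma>\<in>{1,-1}. regular_density J reg_const h \<longrightarrow> 0 \<le>
      integral J (\<lambda>x. h x * (D - \<sigma> * orbit_sum N x s)))"

lemma mean_boundedD: "mean_bounded N D \<Longrightarrow> J \<in> markov_intervals \<Longrightarrow> regular_density J reg_const h \<Longrightarrow> s \<in>
    S \<Longrightarrow> \<sigma> \<in> {1,-1} \<Longrightarrow>
    0 \<le> integral J (\<lambda>x. h x * (D - \<sigma> * orbit_sum N x s))"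
  unfolding mean_bounded_def by blast

section \<open>A bound on the mean that is uniform in N\<close>

lemma mean_bounded_branch:
  assumes "mean_bounded N D" "J \<in> markov_intervals" "regular_density J reg_const h" "s \<in> S" "\<sigma> \<in> {1,-1}"
  shows "0 \<le> integral (branch_domain k J) (\<lambda>x. transfer k h x * (D - \<sigma> * orbit_sum N x s))"
proof (cases "branch_domain k J = {}")
  case False
  then show ?thesis using mean_boundedD[OF assms(1) markov_branch_domain transfer_regular_const]
      assms by simp
qed simp

lemma weighted_sum_integrable:
  assumes "J \<in> markov_intervals" "regular_density J reg_const h" "\<sigma> \<in> {1,-1}"
  shows "(\<lambda>x. h x * (D - \<sigma> * orbit_sum N x s)) absolutely_integrable_on J"
proof (rule regular_integrable[OF assms(1,2) less_imp_le[OF reg_const_props(3)]])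
  show "\<bar>D - \<sigma> * orbit_sum N x s\<bar> \<le> \<bar>D\<bar> + N * F0" for x using orbit_sum_bound[of N x s] assms(3) by auto
qed measurable

lemma weighted_sum_integrable_branch:
  assumes "J \<in> markov_intervals" "regular_density J reg_const h" "\<sigma> \<in> {1,-1}"
  shows "(\<lambda>x. transfer k h x * (D - \<sigma> * orbit_sum N x s)) absolutely_integrable_on branch_domain k J"
  using assms weighted_sum_integrable[OF markov_branch_domain transfer_regular_const] by (cases
      "branch_domain k J = {}") auto

lemma transfer_weighted_sum_le:
  assumes "J \<in> markov_intervals" "regular_density J reg_const h" "\<sigma> \<in> {1,-1}"
  shows "integral (branch_domain k J) (\<lambda>x. transfer k h x * (D - \<sigma> * orbit_sum N x (step s k)))
     \<le> integral (branch_domain k J) (transfer k (\<lambda>x. h x * (D + 2 * F0 - \<sigma> * orbit_sum N x s)))"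
proof (intro integral_le set_lebesgue_integral_eq_integral(1))
  show "(\<lambda>x. transfer k h x * (D - \<sigma> * orbit_sum N x (step s k))) absolutely_integrable_on
      branch_domain k J"
    by (rule weighted_sum_integrable_branch) fact+
  show "transfer k (\<lambda>x. h x * (D + 2 * F0 - \<sigma> * orbit_sum N x s)) absolutely_integrable_on
      branch_domain k J"
    using branch_integral(1)[OF _ _ weighted_sum_integrable] markov_props assms by blast
  fix y assume y: "y \<in> branch_domain k J"
  then have "y \<in> I0" "k \<noteq> 0" "inv_branch k y \<in> J" by (auto simp: branch_domain_def)
  then have "0 \<le> h (inv_branch k y)" "\<bar>orbit_sum N (inv_branch k y) s - orbit_sum N y (step s k)\<bar> \<le>
      2 * F0"
    using regular_nonneg[OF assms(2)] orbit_sum_inv_branch(2) by auto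
  then have "0 \<le> transfer k h y" "\<bar>orbit_sum N (inv_branch k y) s - orbit_sum N y (step s k)\<bar> \<le> 2 * F0"
    by (simp_all add: transfer_def)
  then have "transfer k h y * (D - \<sigma> * orbit_sum N y (step s k)) \<le> transfer k h y * (D + 2 * F0 - \<sigma>
      * orbit_sum N (inv_branch k y) s)"
    using assms(3) by (intro mult_left_mono) auto
  then show "transfer k h y * (D - \<sigma> * orbit_sum N y (step s k)) \<le> transfer k (\<lambda>x. h x * (D + 2 * F0
      - \<sigma> * orbit_sum N x s)) y"
    by (simp add: transfer_def)
qed

lemma follow_branch:
  assumes mean_bounded: "mean_bounded N D" and J: "J \<in> markov_intervals" "regular_density J
      reg_const h" and s: "s \<in> S" "\<sigma> \<in> {1,-1}"
  shows "integral (branch_domain k J) (\<lambda>x. transfer k h x * (D - \<sigma> * orbit_sum N x (step s k)))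
     \<le> integral J (\<lambda>x. h x * (D + 2 * F0 - \<sigma> * orbit_sum N x s))"
proof -
  have "integral (branch_domain k J) (transfer k (\<lambda>x. h x * (D + 2 * F0 - \<sigma> * orbit_sum N x s)))
      \<le> integral J (\<lambda>x. h x * (D + 2 * F0 - \<sigma> * orbit_sum N x s))"
  proof (rule branch_le)
    fix k' :: int
    show "0 \<le> integral (branch_domain k' J) (transfer k' (\<lambda>x. h x * (D + 2 * F0 - \<sigma> * orbit_sum N x
        s)))"
      using mean_bounded_branch[OF mean_bounded J step_in[OF s(1)] s(2)] transfer_weighted_sum_le[OF
          J s(2)] order.trans by blast
  qed (use markov_props J weighted_sum_integrable[OF J s(2)] in auto)
  then show ?thesis using transfer_weighted_sum_le[OF J s(2)] order.trans by blast
qed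

lemma transfer_mass_le:
  assumes "J \<in> markov_intervals" "regular_density J reg_const h"
  shows "integral (branch_domain k J) (transfer k h) \<le> integral J h"
proof (rule branch_le)
  fix k' show "0 \<le> integral (branch_domain k' J) (transfer k' h)"
    using regular_integral_nonneg[OF markov_branch_domain[OF assms(1)] transfer_regular_const[OF
        assms]] reg_const_props(3)
    by (cases "branch_domain k' J = {}") auto
qed (use markov_props assms regular_integrable1[OF assms] reg_const_props in auto)

lemma integral_weighted_sum_add:
  assumes "J \<in> markov_intervals" "regular_density J reg_const h" "\<sigma> \<in> {1,-1}"
  shows "integral J (\<lambda>x. h x * (D + c - \<sigma> * orbit_sum N x s)) =
    integral J (\<lambda>x. h x * (D - \<sigma> * orbit_sum N x s)) + c * integral J h"
proof -
  have "integral J (\<lambda>x. h x * (D + c - \<sigma> * orbit_sum N x s)) =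
      integral J (\<lambda>x. h x * (D - \<sigma> * orbit_sum N x s) + c * h x)"
    by (simp add: algebra_simps)
  also have "\<dots> = integral J (\<lambda>x. h x * (D - \<sigma> * orbit_sum N x s)) + integral J (\<lambda>x. c * h x)"
    using weighted_sum_integrable[OF assms] regular_integrable1[OF assms(1,2)] reg_const_props(3)
    by (intro Henstock_Kurzweil_Integration.integral_add integrable_on_cmult_left
        set_lebesgue_integral_eq_integral(1)) auto
  finally show ?thesis by simp
qed

text \<open>Each letter raises D by \<open>2 * F0\<close>. What the tail of the word has accumulated
  is a multiple of the transferred mass, which never exceeds the original mass.\<close>

lemma follow_word:
  assumes mean_bounded: "mean_bounded N D" and "J \<in> markov_intervals" "regular_density J reg_const
      h" "s \<in> S" and \<sigma>: "\<sigma> \<in> {1,-1}" and "word_domain w J \<noteq> {}"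
  shows "integral (word_domain w J) (\<lambda>x. word_transfer w h x * (D - \<sigma> * orbit_sum N x (foldl step s w)))
     \<le> integral J (\<lambda>x. h x * (D + 2 * F0 * length w - \<sigma> * orbit_sum N x s))"
  using assms(2-4,6)
proof (induction w arbitrary: J h s)
  case (Cons k w)
  have ne: "branch_domain k J \<noteq> {}" using Cons.prems word_domain_empty by auto
  note J' = markov_branch_domain[OF Cons.prems(1) ne] transfer_regular_const[OF Cons.prems(1,2), of k]
  have "integral (word_domain w (branch_domain k J)) (\<lambda>x. word_transfer w (transfer k h) x * (D - \<sigma>
      * orbit_sum N x (foldl step (step s k) w)))
     \<le> integral (branch_domain k J) (\<lambda>x. transfer k h x * (D + 2 * F0 * length w - \<sigma> * orbit_sum N x
         (step s k)))"
    using Cons.IH[OF J' step_in[OF Cons.prems(3)]] Cons.prems(4) by simp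
  also have "\<dots> = integral (branch_domain k J) (\<lambda>x. transfer k h x * (D - \<sigma> * orbit_sum N x (step s k)))
      + 2 * F0 * length w * integral (branch_domain k J) (transfer k h)"
    by (rule integral_weighted_sum_add[OF J' \<sigma>])
  also have "\<dots> \<le> integral J (\<lambda>x. h x * (D + 2 * F0 - \<sigma> * orbit_sum N x s)) + 2 * F0 * length w *
      integral J h"
    using follow_branch[OF mean_bounded Cons.prems(1-3) \<sigma>] transfer_mass_le[OF Cons.prems(1,2)]
        F0_nonneg
    by (intro add_mono mult_left_mono) auto
  also have "\<dots> = integral J (\<lambda>x. h x * (D + 2 * F0 + 2 * F0 * length w - \<sigma> * orbit_sum N x s))"
    by (rule integral_weighted_sum_add[OF Cons.prems(1,2) \<sigma>, symmetric])
  finally show ?case by (simp add: algebra_simps)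
qed simp

lemma mean_bounded_initial: "mean_bounded N (N * F0)"
  unfolding mean_bounded_def
proof (intro ballI allI impI)
  fix J h s \<sigma> assume *: "J \<in> markov_intervals" "s \<in> S" "\<sigma> \<in> {1,-1::real}" "regular_density J
      reg_const h"
  show "0 \<le> integral J (\<lambda>x. h x * (N * F0 - \<sigma> * orbit_sum N x s))"
  proof (intro integral_nonneg set_lebesgue_integral_eq_integral(1) weighted_sum_integrable)
    fix x assume "x \<in> J"
    then show "0 \<le> h x * (N * F0 - \<sigma> * orbit_sum N x s)"
      using orbit_sum_bound[of N x s] *(3) regular_nonneg[OF *(4)] by (intro mult_nonneg_nonneg) auto
  qed (use * in auto)
qed

text \<open>Averaging the full-branch words over their targets leaves a constant density that is
  uniform in the state; on it the sums cancel because every digit permutes the states.\<close>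

lemma mean_bounded_contraction:
  "\<exists>\<rho> K. 0 \<le> \<rho> \<and> \<rho> < 1 \<and> 0 \<le> K \<and> (\<forall>N D. mean_bounded N D \<longrightarrow> mean_bounded N (\<rho> * D + K))"
proof -
  obtain l c where c: "0 < c" and W: "\<And>J s t. J \<in> markov_intervals \<Longrightarrow> s \<in> S \<Longrightarrow> t \<in> S \<Longrightarrow>
      \<exists>w. w \<noteq> [] \<and> word_domain w J = I0 \<and> foldl step s w = t \<and> length w \<le> l \<and> c \<le> weight w"
    using uniform_full_word by meson
  \<comment> \<open>Chosen so that a density of mass M is at least M/q everywhere on its
    interval.\<close>
  define q where "q = L * exp (reg_const * L)"
  have q: "0 < q" by (simp add: q_def)
  \<comment> \<open>The first entry allows the constant \<open>\<eta> * M\<close> to be split off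
    every transferred density; the second keeps \<open>1 - \<eta> * L\<close> nonnegative.\<close>
  define \<eta> where "\<eta> = min ((1 - contracted_const / reg_const) * (c / q)) (1 / (2 * L))"
  have "0 < 1 - contracted_const / reg_const" using reg_const_props by simp
  then have \<eta>: "0 < \<eta>" using c q by (simp add: \<eta>_def)
  have "\<eta> * L \<le> 1 / (2 * L) * L" by (intro mult_right_mono) (auto simp: \<eta>_def)
  then have \<eta>L: "\<eta> * L \<le> 1/2" by simp
  have main: "mean_bounded N ((1 - \<eta> * L) * D + 2 * F0 * l)" if mean_bounded: "mean_bounded N D" for N D
    unfolding mean_bounded_def
  proof (intro ballI allI impI)
    fix J h s \<sigma> assume *: "J \<in> markov_intervals" "s \<in> S" "\<sigma> \<in> {1,-1::real}" "regular_density J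
        reg_const h"
    define M where "M = integral J h"
    have M: "0 \<le> M" unfolding M_def using regular_integral_nonneg[OF *(1,4)] reg_const_props by simp
    have h_ge: "M / q \<le> h x" if "x \<in> J" for x
      using regular_integral_le[OF *(1,4) _ that] reg_const_props q by (simp add: M_def q_def
          divide_le_eq mult.commute)
    have I0_regular: "regular_density I0 reg_const (\<lambda>x. \<eta> * M)" using \<eta> M reg_const_props by (intro
        regular_const) auto
    have key: "integral I0 (\<lambda>x. \<eta> * M * (D - \<sigma> * orbit_sum N x t)) \<le>
        integral J (\<lambda>x. h x * (D + 2 * F0 * l - \<sigma> * orbit_sum N x s))" if t: "t \<in> S" for t
    proof -
      obtain w where w: "w \<noteq> []" "word_domain w J = I0" "foldl step s w = t" "length w \<le> l" "c \<le>
          weight w"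
        using W[OF *(1,2) t] by blast
      have ne: "word_domain w J \<noteq> {}" using w(2) markov_props(3)[OF I0_markov] by simp
      have g: "regular_density I0 contracted_const (word_transfer w h)" using
          word_transfer_regular[OF *(1,4) w(1) ne] w(2) by simp
      \<comment> \<open>The remainder is again admissible, so the assumed bound makes its integral
        nonnegative and it can be discarded.\<close>
      have "regular_density I0 reg_const (\<lambda>x. word_transfer w h x - \<eta> * M)"
      proof (rule regular_diff_const[OF g])
        fix y assume y: "y \<in> I0"
        have "M / q * weight w \<le> word_transfer w h y"
          using word_transfer_ge[of J "M / q" h y w] h_ge M q w(2) y by auto
        moreover have "M / q * c \<le> M / q * weight w" using w(5) M q by (intro mult_left_mono) auto
        ultimately have "(1 - contracted_const / reg_const) * (M / q * c) \<le> (1 - contracted_const /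
            reg_const) * word_transfer w h y"
          using \<open>0 < 1 - contracted_const / reg_const\<close> by (intro mult_left_mono) auto
        moreover have "\<eta> * M \<le> (1 - contracted_const / reg_const) * (c / q) * M"
          using M by (intro mult_right_mono) (auto simp: \<eta>_def)
        ultimately show "\<eta> * M \<le> (1 - contracted_const / reg_const) * word_transfer w h y" by (simp
            add: mult_ac)
      qed (use reg_const_props \<eta> M in auto)
      note d = mean_boundedD[OF mean_bounded I0_markov this t *(3)] weighted_sum_integrable[OF
          I0_markov this *(3)]
      have "integral I0 (\<lambda>x. word_transfer w h x * (D - \<sigma> * orbit_sum N x t)) =
          integral I0 (\<lambda>x. (word_transfer w h x - \<eta> * M) * (D - \<sigma> * orbit_sum N x t) + \<eta> * M * (D -
              \<sigma> * orbit_sum N x t))"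
        by (simp add: algebra_simps)
      also have "\<dots> = integral I0 (\<lambda>x. (word_transfer w h x - \<eta> * M) * (D - \<sigma> * orbit_sum N x t)) +
          integral I0 (\<lambda>x. \<eta> * M * (D - \<sigma> * orbit_sum N x t))"
        using d(2) weighted_sum_integrable[OF I0_markov I0_regular *(3)]
        by (intro Henstock_Kurzweil_Integration.integral_add set_lebesgue_integral_eq_integral(1))
      finally have "integral I0 (\<lambda>x. \<eta> * M * (D - \<sigma> * orbit_sum N x t)) \<le>
          integral I0 (\<lambda>x. word_transfer w h x * (D - \<sigma> * orbit_sum N x t))"
        using d(1) by simp
      also have "\<dots> \<le> integral J (\<lambda>x. h x * (D + 2 * F0 * length w - \<sigma> * orbit_sum N x s))"
        using follow_word[OF mean_bounded *(1,4,2,3) ne] w(2,3) by simp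
      also have "\<dots> \<le> integral J (\<lambda>x. h x * (D + 2 * F0 * l - \<sigma> * orbit_sum N x s))"
        unfolding integral_weighted_sum_add[OF *(1,4,3)] using w(4) F0_nonneg M unfolding
            M_def[symmetric]
        by (intro add_left_mono mult_right_mono mult_left_mono) auto
      finally show ?thesis .
    qed
    \<comment> \<open>In the total over all targets t the orbit sums cancel and only D
      survives.\<close>
    have "card S * (\<eta> * M * D * L) = integral I0 (\<lambda>x. card S * (\<eta> * M * D))"
      by (simp only: integral_I0_const) simp
    also have "\<dots> = integral I0 (\<lambda>x. \<Sum>t\<in>S. \<eta> * M * (D - \<sigma> * orbit_sum N x t))"
      by (simp add: right_diff_distrib sum_subtractf sum_distrib_left[symmetric] sum_orbit_sum)
    also have "\<dots> = (\<Sum>t\<in>S. integral I0 (\<lambda>x. \<eta> * M * (D - \<sigma> * orbit_sum N x t)))"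
      using weighted_sum_integrable[OF I0_markov I0_regular *(3)] finite_S
      by (intro Henstock_Kurzweil_Integration.integral_sum set_lebesgue_integral_eq_integral(1)) auto
    also have "\<dots> \<le> (\<Sum>t\<in>S. integral J (\<lambda>x. h x * (D + 2 * F0 * l - \<sigma> * orbit_sum N x s)))"
      by (intro sum_mono key)
    also have "\<dots> = card S * integral J (\<lambda>x. h x * (D + 2 * F0 * l - \<sigma> * orbit_sum N x s))" by simp
    finally have "\<eta> * M * D * L \<le> integral J (\<lambda>x. h x * (D + 2 * F0 * l - \<sigma> * orbit_sum N x s))"
      using finite_S S_ne by (simp add: card_gt_0_iff)
    also have "\<dots> = integral J (\<lambda>x. h x * (((1 - \<eta> * L) * D + 2 * F0 * l) + \<eta> * L * D - \<sigma> * orbit_sum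
        N x s))"
      by (simp add: algebra_simps)
    also have "\<dots> = integral J (\<lambda>x. h x * (((1 - \<eta> * L) * D + 2 * F0 * l) - \<sigma> * orbit_sum N x s)) + \<eta>
        * L * D * M"
      unfolding M_def by (rule integral_weighted_sum_add[OF *(1,4,3)])
    finally show "0 \<le> integral J (\<lambda>x. h x * (((1 - \<eta> * L) * D + 2 * F0 * l) - \<sigma> * orbit_sum N x s))"
      by (simp add: mult_ac)
  qed
  show ?thesis
    using main \<eta> \<eta>L F0_nonneg by (intro exI[of _ "1 - \<eta> * L"] exI[of _ "2 * F0 * l"]) auto
qed

text \<open>The fixed point of the improvement is K / (1 - \<rho>). From the trivial bound
  \<open>N * F0\<close> the j-th improvement is off by a multiple of \<open>\<rho> ^ j\<close>; as
  the integral is affine in the bound, nonnegativity passes to the limit.\<close>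

lemma mean_bounded_uniform: "\<exists>D\<ge>0. \<forall>N. mean_bounded N D"
proof -
  obtain \<rho> K where \<rho>: "0 \<le> \<rho>" "\<rho> < 1" "0 \<le> K" and step: "\<And>N D. mean_bounded N D \<Longrightarrow> mean_bounded N (\<rho>
      * D + K)"
    using mean_bounded_contraction by blast
  define D where "D = K / (1 - \<rho>)"
  have D: "0 \<le> D" "\<rho> * D + K = D" using \<rho> by (auto simp: D_def field_simps)
  have "mean_bounded N D" for N
    unfolding mean_bounded_def
  proof (intro ballI allI impI)
    fix J h s \<sigma> assume *: "J \<in> markov_intervals" "s \<in> S" "\<sigma> \<in> {1,-1::real}" "regular_density J
        reg_const h"
    define E where "E = N * F0 - D"
    have okj: "mean_bounded N (D + \<rho> ^ j * E)" for j
    proof (induction j)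
      case 0
      then show ?case using mean_bounded_initial by (simp add: E_def)
    next
      case (Suc j)
      have "\<rho> * (D + \<rho> ^ j * E) + K = (\<rho> * D + K) + \<rho> ^ Suc j * E" by (simp add: algebra_simps)
      then show ?case using step[OF Suc] D(2) by simp
    qed
    have "0 \<le> integral J (\<lambda>x. h x * (D - \<sigma> * orbit_sum N x s)) + \<rho> ^ j * E * integral J h" for j
      using mean_boundedD[OF okj[of j] *(1,4,2,3)] unfolding integral_weighted_sum_add[OF *(1,4,3)] .
    moreover have "(\<lambda>j. integral J (\<lambda>x. h x * (D - \<sigma> * orbit_sum N x s)) + \<rho> ^ j * E * integral J h)
        \<longlonglongrightarrow> integral J (\<lambda>x. h x * (D - \<sigma> * orbit_sum N x s)) + 0 * E * integral J h"
      using \<rho> by (intro tendsto_intros LIMSEQ_realpow_zero)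
    ultimately show "0 \<le> integral J (\<lambda>x. h x * (D - \<sigma> * orbit_sum N x s))"
      by (intro LIMSEQ_le_const[where X = "\<lambda>j. integral J (\<lambda>x. h x * (D - \<sigma> * orbit_sum N x s)) + \<rho>
          ^ j * E * integral J h"]) auto
  qed
  then show ?thesis using D(1) by blast
qed

text \<open>After the first digit the square becomes (f s)^2 + 2 (f s) u + u^2, where u is the sum
  of N terms from the next state. The mean bound limits the middle term by \<open>2 * F0 * D\<close>
  times the mass, which explains the increment per step.\<close>

lemma second_moment_aux:
  assumes D: "0 \<le> D" "\<And>N. mean_bounded N D" and "J \<in> markov_intervals" "regular_density J reg_const
      h" "s \<in> S"
  shows "0 \<le> integral J (\<lambda>x. h x * (N * (F0\<^sup>2 + 2 * F0 * D) - (orbit_sum N x s)\<^sup>2))"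
  using assms(3-5)
proof (induction N arbitrary: J h s)
  case (Suc N)
  define K where "K = F0\<^sup>2 + 2 * F0 * D"
  have int: "(\<lambda>x. h x * (c + d * orbit_sum N x s - (orbit_sum N x s)\<^sup>2)) absolutely_integrable_on J"
    if "J \<in> markov_intervals" "regular_density J reg_const h" for J h s c d N
  proof (rule regular_integrable[OF that less_imp_le[OF reg_const_props(3)]])
    fix x
    have "(orbit_sum N x s)\<^sup>2 \<le> (N * F0)\<^sup>2"
      using orbit_sum_bound[of N x s] by (metis abs_ge_zero abs_le_square_iff abs_of_nonneg order.trans)
    moreover have "\<bar>d * orbit_sum N x s\<bar> \<le> \<bar>d\<bar> * (N * F0)"
      using orbit_sum_bound[of N x s] by (simp add: abs_mult mult_left_mono)
    ultimately show "\<bar>c + d * orbit_sum N x s - (orbit_sum N x s)\<^sup>2\<bar> \<le> \<bar>c\<bar> + \<bar>d\<bar> * (N * F0) + (N *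
        F0)\<^sup>2"
      using abs_triangle_ineq[of c "d * orbit_sum N x s"] abs_triangle_ineq4[of "c + d * orbit_sum N
          x s" "(orbit_sum N x s)\<^sup>2"] by simp
  qed measurable
  \<comment> \<open>The summand with factor 0 brings the integrand into the shape covered by
    \<open>int\<close>.\<close>
  have "0 \<le> integral J (\<lambda>x. h x * (Suc N * K + 0 * orbit_sum (Suc N) x s - (orbit_sum (Suc N) x s)\<^sup>2))"
  proof (rule branch_nonneg)
    fix k :: int assume "k \<noteq> 0"
    show "0 \<le> integral (branch_domain k J) (transfer k (\<lambda>x. h x * (Suc N * K + 0 * orbit_sum (Suc N)
        x s - (orbit_sum (Suc N) x s)\<^sup>2)))"
    proof (cases "branch_domain k J = {}")
      case False
      note J' = markov_branch_domain[OF Suc.prems(1) False] transfer_regular_const[OF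
          Suc.prems(1,2), of k]
      define s' where "s' = step s k"
      have s': "s' \<in> S" using Suc.prems step_in by (simp add: s'_def)
      \<comment> \<open>The sign of \<open>f s\<close>, so that the mean bound multiplied by 2 |f s|
        contains exactly the cross term.\<close>
      define \<sigma> :: real where "\<sigma> = (if 0 \<le> f s then 1 else -1)"
      have \<sigma>: "\<sigma> \<in> {1,-1}" "\<sigma> * \<bar>f s\<bar> = f s" by (auto simp: \<sigma>_def)
      define g1 where "g1 x = transfer k h x * (N * K - (orbit_sum N x s')\<^sup>2)" for x
      define g2 where "g2 x = transfer k h x * (D - \<sigma> * orbit_sum N x s')" for x
      have g1: "g1 absolutely_integrable_on branch_domain k J" "0 \<le> integral (branch_domain k J) g1"
        using int[OF J', of "N * K" 0 N s'] Suc.IH[OF J' s'] unfolding g1_def[abs_def] K_def by auto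
      have g2: "g2 absolutely_integrable_on branch_domain k J" "0 \<le> integral (branch_domain k J) g2"
        using weighted_sum_integrable[OF J' \<sigma>(1)] mean_boundedD[OF D(2) J' s' \<sigma>(1)] unfolding
            g2_def[abs_def] by auto
      have "0 \<le> integral (branch_domain k J) g1 + 2 * \<bar>f s\<bar> * integral (branch_domain k J) g2"
        using g1 g2 by simp
      also have "\<dots> = integral (branch_domain k J) (\<lambda>x. g1 x + 2 * \<bar>f s\<bar> * g2 x)"
        using g1 g2 by (subst Henstock_Kurzweil_Integration.integral_add)
          (auto intro!: integrable_on_mult_right set_lebesgue_integral_eq_integral(1))
      also have "\<dots> \<le> integral (branch_domain k J) (transfer k (\<lambda>x. h x * (Suc N * K + 0 * orbit_sum
          (Suc N) x s - (orbit_sum (Suc N) x s)\<^sup>2)))"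
      proof (rule integral_le)
        show "(\<lambda>x. g1 x + 2 * \<bar>f s\<bar> * g2 x) integrable_on branch_domain k J"
          using g1 g2 by (intro integrable_add integrable_on_mult_right
              set_lebesgue_integral_eq_integral(1))
        show "transfer k (\<lambda>x. h x * (Suc N * K + 0 * orbit_sum (Suc N) x s - (orbit_sum (Suc N) x
            s)\<^sup>2)) integrable_on branch_domain k J"
          using markov_props[OF Suc.prems(1)] int[OF Suc.prems(1,2)]
          by (intro set_lebesgue_integral_eq_integral(1) branch_integral(1))
        fix y assume y: "y \<in> branch_domain k J"
        then have y': "y \<in> I0" "k \<noteq> 0" "inv_branch k y \<in> J" by (auto simp: branch_domain_def)
        have th: "0 \<le> transfer k h y" using regular_nonneg[OF J'(2) y] .
        have eq: "orbit_sum (Suc N) (inv_branch k y) s = f s + orbit_sum N y s'" using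
            orbit_sum_inv_branch(1)[OF y'(1,2)] by (simp add: s'_def)
        have ff: "(f s)\<^sup>2 \<le> F0\<^sup>2" using f_bound[of s] by (metis abs_ge_zero power2_abs power_mono)
        have fD: "\<bar>f s\<bar> * D \<le> F0 * D" using f_bound D by (intro mult_right_mono)
        have fu: "\<bar>f s\<bar> * (\<sigma> * orbit_sum N y s') = f s * orbit_sum N y s'"
          using \<sigma>(2) by (metis mult.assoc mult.commute)
        have "(N * K - (orbit_sum N y s')\<^sup>2) + 2 * \<bar>f s\<bar> * (D - \<sigma> * orbit_sum N y s') \<le> Suc N * K -
            (f s + orbit_sum N y s')\<^sup>2"
        proof -
          have "2 * \<bar>f s\<bar> * (D - \<sigma> * orbit_sum N y s') = 2 * (\<bar>f s\<bar> * D) - 2 * (\<bar>f s\<bar> * (\<sigma> *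
              orbit_sum N y s'))"
            by (simp add: algebra_simps)
          moreover have "(f s + orbit_sum N y s')\<^sup>2 = (f s)\<^sup>2 + 2 * (f s * orbit_sum N y s') +
              (orbit_sum N y s')\<^sup>2"
            by (simp add: power2_sum)
          moreover have "Suc N * K = N * K + K" "K = F0\<^sup>2 + 2 * (F0 * D)"
            by (simp_all add: K_def algebra_simps)
          ultimately show ?thesis using ff fD fu by linarith
        qed
        then have "transfer k h y * ((N * K - (orbit_sum N y s')\<^sup>2) + 2 * \<bar>f s\<bar> * (D - \<sigma> * orbit_sum
            N y s')) \<le>
            transfer k h y * (Suc N * K - (f s + orbit_sum N y s')\<^sup>2)"
          using th by (rule mult_left_mono)
        moreover have "g1 y + 2 * \<bar>f s\<bar> * g2 y =
            transfer k h y * ((N * K - (orbit_sum N y s')\<^sup>2) + 2 * \<bar>f s\<bar> * (D - \<sigma> * orbit_sum N y s'))"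
          by (simp add: g1_def g2_def algebra_simps)
        moreover have "transfer k (\<lambda>x. h x * G x) y = transfer k h y * G (inv_branch k y)" for G
          by (simp add: transfer_def)
        ultimately show "g1 y + 2 * \<bar>f s\<bar> * g2 y \<le>
            transfer k (\<lambda>x. h x * (Suc N * K + 0 * orbit_sum (Suc N) x s - (orbit_sum (Suc N) x
                s)\<^sup>2)) y"
          unfolding eq[symmetric] by simp
      qed
      finally show ?thesis .
    qed simp
  qed (fact markov_props(1)[OF Suc.prems(1)] markov_props(2)[OF Suc.prems(1)] int[OF Suc.prems(1,2)])+
  then show ?case by (simp add: K_def)
qed simp

lemma second_moment:
  obtains C :: real where "0 \<le> C" "\<And>N s. s \<in> S \<Longrightarrow> integral I0 (\<lambda>x. (orbit_sum N x s)\<^sup>2) \<le> C * N"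
    "\<And>N s. (\<lambda>x. (orbit_sum N x s)\<^sup>2) integrable_on I0"
proof -
  obtain D where D: "0 \<le> D" "\<And>N. mean_bounded N D" using mean_bounded_uniform by blast
  define K where "K = F0\<^sup>2 + 2 * F0 * D"
  have ad: "regular_density I0 reg_const (\<lambda>x. 1)" using reg_const_props by (intro regular_const) auto
  have int: "(\<lambda>x. (orbit_sum N x s)\<^sup>2) integrable_on I0" for N s
  proof -
    have "(\<lambda>x. 1 * (orbit_sum N x s)\<^sup>2) absolutely_integrable_on I0"
    proof (rule regular_integrable[OF I0_markov ad less_imp_le[OF reg_const_props(3)]])
      show "\<bar>(orbit_sum N x s)\<^sup>2\<bar> \<le> (N * F0)\<^sup>2" for x
        using orbit_sum_bound[of N x s] by (metis abs_ge_zero abs_power2 power2_abs power_mono)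
    qed measurable
    then show ?thesis by (simp add: set_lebesgue_integral_eq_integral(1))
  qed
  have "integral I0 (\<lambda>x. (orbit_sum N x s)\<^sup>2) \<le> (L * K) * N" if "s \<in> S" for N s
  proof -
    have "0 \<le> integral I0 (\<lambda>x. N * K - (orbit_sum N x s)\<^sup>2)"
      using second_moment_aux[OF D I0_markov ad that, of N] by (simp add: K_def)
    also have "\<dots> = integral I0 (\<lambda>x. N * K) - integral I0 (\<lambda>x. (orbit_sum N x s)\<^sup>2)"
      using int markov_measure[OF I0_markov]
      by (intro Henstock_Kurzweil_Integration.integral_diff integrable_on_const) auto
    also have "integral I0 (\<lambda>x. N * K) = L * (N * K)" by (rule integral_I0_const)
    finally show ?thesis by (simp add: mult_ac)
  qed
  moreover have "0 \<le> L * K" using D F0_nonneg by (simp add: K_def)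
  ultimately show ?thesis using int that by blast
qed

end

section \<open>Equidistribution of the states\<close>

context rosen_observable begin

lemma orbit_sum_add_diff: "\<bar>orbit_sum (N + j) x s - orbit_sum N x s\<bar> \<le> j * F0"
proof (induction j)
  case (Suc j)
  then show ?case using orbit_sum_Suc_diff[of "N + j" x s] by (simp add: algebra_simps abs_le_iff)
qed simp

text \<open>The average at time n^2 has second moment at most C/n^2, which is summable, so almost
  everywhere its squares are summable as well. The index \<open>Suc n\<close> avoids time 0.\<close>

lemma AE_squares:
  assumes "s \<in> S"
  shows "AE x in lebesgue_on I0. (\<lambda>n. orbit_sum ((Suc n)\<^sup>2) x s / (Suc n)\<^sup>2) \<longlonglongrightarrow> 0"
proof -
  obtain C :: real where "0 \<le> C" and *: "\<And>N s. s \<in> S \<Longrightarrow> integral I0 (\<lambda>x. (orbit_sum N x s)\<^sup>2) \<le> C * N"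
    "\<And>N s. (\<lambda>x. (orbit_sum N x s)\<^sup>2) integrable_on I0"
    by (rule second_moment) blast
  note C = this(1) *(1)[OF assms] *(2)[of _ s]
  define v where "v n x = (orbit_sum ((Suc n)\<^sup>2) x s / (Suc n)\<^sup>2)\<^sup>2" for n x
  have v_eq: "v n = (\<lambda>x. (orbit_sum ((Suc n)\<^sup>2) x s)\<^sup>2 * (1 / (real ((Suc n)\<^sup>2))\<^sup>2))" for n
    by (auto simp: v_def power_divide)
  have I0: "I0 \<in> sets lebesgue" using markov_measure[OF I0_markov] by auto
  have v_int: "v n absolutely_integrable_on I0" for n
    using C(3) by (intro nonnegative_absolutely_integrable_1) (auto simp: v_eq intro!:
        integrable_on_mult_left)
  have v_meas: "(\<lambda>x. ennreal (v n x)) \<in> borel_measurable (lebesgue_on I0)" for n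
  proof -
    have "v n \<in> borel_measurable borel" unfolding v_def by measurable
    then have "v n \<in> borel_measurable (lebesgue_on I0)"
      by (intro measurable_restrict_space1 measurable_completion) simp
    then show ?thesis by measurable
  qed
  have v_le: "(\<integral>\<^sup>+x. ennreal (v n x) \<partial>lebesgue_on I0) \<le> ennreal (C * (1 / real (Suc n) ^ 2))" for n
  proof -
    have i: "integrable (lebesgue_on I0) (v n)"
      using v_int[of n] I0 by (simp add: set_integrable_def integrable_restrict_space)
    then have "(\<integral>\<^sup>+x. ennreal (v n x) \<partial>lebesgue_on I0) = ennreal (integral I0 (v n))"
      using I0 by (subst nn_integral_eq_integral) (auto simp: v_def lebesgue_integral_eq_integral)
    also have "integral I0 (v n) = integral I0 (\<lambda>x. (orbit_sum ((Suc n)\<^sup>2) x s)\<^sup>2) * (1 / (real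
        ((Suc n)\<^sup>2))\<^sup>2)"
      unfolding v_eq by (rule integral_mult_left)
    also have "\<dots> \<le> (C * real ((Suc n)\<^sup>2)) * (1 / (real ((Suc n)\<^sup>2))\<^sup>2)"
      by (intro mult_right_mono C(2)) auto
    also have "\<dots> = C * (1 / real (Suc n) ^ 2)"
      by (simp only: of_nat_power) (simp add: power2_eq_square)
    finally show ?thesis by (simp add: ennreal_leI)
  qed
  have "(\<integral>\<^sup>+x. (\<Sum>n. ennreal (v n x)) \<partial>lebesgue_on I0) = (\<Sum>n. \<integral>\<^sup>+x. ennreal (v n x) \<partial>lebesgue_on I0)"
    by (rule nn_integral_suminf[OF v_meas])
  also have "\<dots> \<le> (\<Sum>n. ennreal (C * (1 / real (Suc n) ^ 2)))"
    by (intro suminf_le v_le) auto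
  also have "\<dots> < \<infinity>"
  proof -
    have "summable (\<lambda>n. 1 / real (Suc n) ^ 2)"
      using inverse_power_summable[of 2, where ?'a = real] summable_Suc_iff[of "\<lambda>n. inverse (real n
          ^ 2)"]
      by (simp add: inverse_eq_divide)
    then have "summable (\<lambda>n. C * (1 / real (Suc n) ^ 2))" by (rule summable_mult)
    then show ?thesis using C(1) by (subst suminf_ennreal2) auto
  qed
  finally have "AE x in lebesgue_on I0. (\<Sum>n. ennreal (v n x)) \<noteq> \<infinity>"
    using v_meas by (intro nn_integral_PInf_AE borel_measurable_suminf_order) auto
  then show ?thesis
  proof (rule AE_mp, intro AE_I2 impI)
    fix x assume "(\<Sum>n. ennreal (v n x)) \<noteq> \<infinity>"
    then have "summable (\<lambda>n. v n x)" by (intro summable_suminf_not_top) (auto simp: v_def)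
    then have "(\<lambda>n. v n x) \<longlonglongrightarrow> 0" by (rule summable_LIMSEQ_zero)
    then have "(\<lambda>n. sqrt (v n x)) \<longlonglongrightarrow> sqrt 0" by (intro tendsto_intros)
    then have "(\<lambda>n. \<bar>orbit_sum ((Suc n)\<^sup>2) x s / (Suc n)\<^sup>2\<bar>) \<longlonglongrightarrow> 0"
      unfolding v_def real_sqrt_abs real_sqrt_zero .
    then show "(\<lambda>n. orbit_sum ((Suc n)\<^sup>2) x s / (Suc n)\<^sup>2) \<longlonglongrightarrow> 0"
      by (rule tendsto_rabs_zero_cancel)
  qed
qed

text \<open>From k^2 to any N < (k+1)^2 at most 3k terms are added, each at most \<open>F0\<close>
  in modulus; divided by N \<ge> k^2 they amount to at most 3 F0 / k.\<close>

lemma orbit_sum_tendsto_from_squares: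
  assumes "(\<lambda>n. orbit_sum ((Suc n)\<^sup>2) x s / (Suc n)\<^sup>2) \<longlonglongrightarrow> 0"
  shows "(\<lambda>N. orbit_sum N x s / N) \<longlonglongrightarrow> 0"
proof (rule Lim_null_comparison)
  define g where "g k = \<bar>orbit_sum (k\<^sup>2) x s / k\<^sup>2\<bar> + 3 * F0 / k" for k :: nat
  have "(\<lambda>k. orbit_sum (k\<^sup>2) x s / k\<^sup>2) \<longlonglongrightarrow> 0"
    using assms filterlim_sequentially_Suc[of "\<lambda>k. orbit_sum (k\<^sup>2) x s / k\<^sup>2"] by simp
  then have g: "g \<longlonglongrightarrow> 0"
    unfolding g_def using tendsto_add[OF tendsto_rabs_zero lim_const_over_n[of "3 * F0"]] by fastforce
  have "filterlim floor_sqrt at_top sequentially"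
    unfolding filterlim_at_top eventually_sequentially
  proof (intro allI)
    fix Z :: nat
    show "\<exists>N. \<forall>n\<ge>N. Z \<le> floor_sqrt n"
      by (intro exI[of _ "Z\<^sup>2"] allI impI) (metis mono_floor_sqrt' floor_sqrt_inverse_power2)
  qed
  then show "(\<lambda>N. g (floor_sqrt N)) \<longlonglongrightarrow> 0" by (rule filterlim_compose[OF g])
  show "\<forall>\<^sub>F N in sequentially. norm (orbit_sum N x s / N) \<le> g (floor_sqrt N)"
    using eventually_gt_at_top[of 0]
  proof eventually_elim
    case (elim N)
    define k where "k = floor_sqrt N"
    have k: "k > 0" "k\<^sup>2 \<le> N" "N < (Suc k)\<^sup>2"
      using elim Suc_floor_sqrt_power2_gt[of N] by (auto simp: k_def)
    define j where "j = N - k\<^sup>2"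
    have j: "N = k\<^sup>2 + j" "j \<le> 3 * k" using k by (auto simp: j_def power2_eq_square)
    have kN: "real (k\<^sup>2) \<le> real N" using k(2) of_nat_le_iff by blast
    have "\<bar>orbit_sum N x s\<bar> \<le> \<bar>orbit_sum (k\<^sup>2) x s\<bar> + j * F0"
      using orbit_sum_add_diff[of "k\<^sup>2" j x s] unfolding j(1)[symmetric] by linarith
    also have "\<dots> \<le> \<bar>orbit_sum (k\<^sup>2) x s\<bar> + (3 * real k) * F0"
      using j(2) F0_nonneg by (intro add_left_mono mult_right_mono) auto
    finally have "\<bar>orbit_sum N x s\<bar> / N \<le> (\<bar>orbit_sum (k\<^sup>2) x s\<bar> + (3 * real k) * F0) / N"
      by (intro divide_right_mono) auto
    also have "\<dots> \<le> (\<bar>orbit_sum (k\<^sup>2) x s\<bar> + (3 * real k) * F0) / real (k\<^sup>2)"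
      using kN k F0_nonneg elim by (intro divide_left_mono) auto
    also have "\<dots> = g k" using k(1) by (simp add: g_def add_divide_distrib power2_eq_square)
    finally show ?case by (simp add: k_def)
  qed
qed

lemma AE_average:
  assumes "s \<in> S"
  shows "AE x in lebesgue. x \<in> I0 \<longrightarrow> (\<lambda>N. orbit_sum N x s / N) \<longlonglongrightarrow> 0"
proof -
  have I0: "I0 \<inter> space lebesgue \<in> sets lebesgue" using markov_measure[OF I0_markov] by auto
  show ?thesis
    using AE_squares[OF assms] unfolding AE_restrict_space_iff[OF I0]
    by (rule AE_mp) (auto intro!: AE_I2 orbit_sum_tendsto_from_squares)
qed

end

context rosen_skew begin

section \<open>Frequency of visits to a set of states\<close>

primrec state :: "nat \<Rightarrow> real \<Rightarrow> 's \<Rightarrow> 's" where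
  "state 0 x s = s"
| "state (Suc n) x s = state n (T x) (step s (signed_digit x))"

lemma state_in: "s \<in> S \<Longrightarrow> state n x s \<in> S"
  by (induction n arbitrary: x s) (auto simp: step_in)

text \<open>Digits are appended at the end here, which matches the recursion of the
  approximants.\<close>

lemma state_Suc: "state (Suc n) x s = step (state n x s) (signed_digit ((T ^^ n) x))"
proof (induction n arbitrary: x s)
  case (Suc n)
  have "state (Suc (Suc n)) x s = step (state n (T x) (step s (signed_digit x))) (signed_digit ((T
      ^^ n) (T x)))"
    unfolding state.simps(2)[of "Suc n"] Suc.IH ..
  then show ?case by (simp add: funpow_swap1)
qed simp

lemma AE_frequency:
  assumes "C \<subseteq> S" "s \<in> S"
  shows "AE x in lebesgue. x \<in> I0 \<longrightarrow>
    (\<lambda>N. card {n \<in> {1..N}. state n x s \<in> C} / N) \<longlonglongrightarrow> card C / card S"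
proof -
  define p :: real where "p = card C / card S"
  define f where "f t = (if t \<in> S then indicator C t - p else 0)" for t
  have card: "card S > 0" "card C \<le> card S" using finite_S S_ne assms(1) by (auto simp:
      card_gt_0_iff card_mono)
  then have p: "0 \<le> p" "p \<le> 1" by (auto simp: p_def)
  interpret rosen_observable m S step f 1
  proof
    show "\<bar>f t\<bar> \<le> 1" for t using p by (auto simp: f_def indicator_def)
    have "sum f S = (\<Sum>t\<in>S. indicator C t) - card S * p" by (simp add: f_def sum_subtractf)
    also have "(\<Sum>t\<in>S. indicator C t) = (card C :: real)"
      using finite_S assms(1) by (simp add: indicator_def sum.If_cases Int_absorb1)
    finally show "sum f S = 0" using card by (simp add: p_def)
  qed
  have orbit_sum_state: "orbit_sum N x t = (\<Sum>n<N. f (state n x t))" for N x t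
    by (induction N arbitrary: x t) (simp_all add: sum.lessThan_Suc_shift del: sum.lessThan_Suc)
  \<comment> \<open>Visits are counted at times 1 to N, whereas \<open>orbit_sum\<close> runs over
    times 0 to N - 1; this leaves two boundary terms.\<close>
  have count: "card {n \<in> {1..N}. state n x s \<in> C} = orbit_sum N x s + f (state N x s) - f s + N * p"
      for N x
  proof -
    have "real (card {n \<in> {1..N}. state n x s \<in> C}) = (\<Sum>n\<in>{1..N}. indicator C (state n x s))"
      by (simp add: sum.If_cases indicator_def Int_def if_distrib[of real] cong: if_cong)
    also have "\<dots> = (\<Sum>n\<in>{1..N}. f (state n x s) + p)"
      using state_in[OF assms(2)] by (simp add: f_def)
    also have "\<dots> = (\<Sum>n\<in>{1..N}. f (state n x s)) + N * p" by (simp add: sum.distrib)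
    also have "(\<Sum>n\<in>{1..N}. f (state n x s)) = orbit_sum N x s + f (state N x s) - f s"
      unfolding orbit_sum_state by (induction N) auto
    finally show ?thesis .
  qed
  show ?thesis
    using AE_average[OF assms(2)]
  proof (rule AE_mp, intro AE_I2 impI)
    fix x assume "x \<in> I0 \<longrightarrow> (\<lambda>N. orbit_sum N x s / N) \<longlonglongrightarrow> 0" "x \<in> I0"
    then have lim: "(\<lambda>N. orbit_sum N x s / N) \<longlonglongrightarrow> 0" by blast
    have lim2: "(\<lambda>N. (f (state N x s) - f s) / N) \<longlonglongrightarrow> 0"
    proof (rule Lim_null_comparison[OF _ lim_const_over_n[of 2]], intro always_eventually allI)
      fix N
      have "\<bar>f (state N x s) - f s\<bar> \<le> 2" using f_bound[of "state N x s"] f_bound[of s] by linarith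
      then show "norm ((f (state N x s) - f s) / real N) \<le> 2 / real N" by (simp add: divide_right_mono)
    qed
    have "(\<lambda>N. orbit_sum N x s / N + (f (state N x s) - f s) / N + p) \<longlonglongrightarrow> 0 + 0 + p"
      by (intro tendsto_intros lim lim2)
    moreover have "\<forall>\<^sub>F N in sequentially. orbit_sum N x s / N + (f (state N x s) - f s) / N + p =
        card {n \<in> {1..N}. state n x s \<in> C} / N"
      using eventually_gt_at_top[of 0]
      by eventually_elim (subst count, simp add: add_divide_distrib diff_divide_distrib)
    ultimately show "(\<lambda>N. card {n \<in> {1..N}. state n x s \<in> C} / N) \<longlonglongrightarrow> card C / card S"
      unfolding p_def by (simp add: tendsto_cong)
  qed
qed

end

section \<open>The Hecke group and its cosets\<close>

definition mat2 :: "real \<Rightarrow> real \<Rightarrow> real \<Rightarrow> real \<Rightarrow> real^2^2" where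
  "mat2 a b c d = vector [vector [a, b], vector [c, d]]"

lemma mat2_nth [simp]:
  "mat2 a b c d $ 1 $ 1 = a" "mat2 a b c d $ 1 $ 2 = b"
  "mat2 a b c d $ 2 $ 1 = c" "mat2 a b c d $ 2 $ 2 = d"
  by (simp_all add: mat2_def)

lemma mat2_eqI:
  assumes "A $ 1 $ 1 = B $ 1 $ 1" "A $ 1 $ 2 = B $ 1 $ 2" "A $ 2 $ 1 = B $ 2 $ 1" "A $ 2 $ 2 = B $ 2
      $ 2"
  shows "(A :: real^2^2) = B"
  using assms by (simp add: vec_eq_iff forall_2)

lemma mult2_nth:
  "((A :: real^2^2) ** B) $ i $ j = A $ i $ 1 * B $ 1 $ j + A $ i $ 2 * B $ 2 $ j"
  by (simp add: matrix_matrix_mult_def sum_2)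

lemma mat2_mult:
  "mat2 a b c d ** mat2 a' b' c' d' = mat2 (a*a' + b*c') (a*b' + b*d') (c*a' + d*c') (c*b' + d*d')"
  by (rule mat2_eqI) (simp_all add: mult2_nth)

lemma mat_1_mat2: "mat 1 = mat2 1 0 0 1"
  by (rule mat2_eqI) (simp_all add: mat_def)

lemma minus_mat2: "- mat2 a b c d = mat2 (-a) (-b) (-c) (-d)"
  by (rule mat2_eqI) simp_all

lemma det_mat2 [simp]: "det (mat2 a b c d) = a * d - b * c"
  by (simp add: det_2)

lemma det_minus2: "det (- A :: real^2^2) = det A"
  by (simp add: det_2)

lemma minus_mult2:
  fixes A B :: "real^2^2"
  shows "(- A) ** B = - (A ** B)" "A ** (- B) = - (A ** B)"
proof -
  show "(- A) ** B = - (A ** B)" by (rule mat2_eqI) (simp_all add: mult2_nth)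
  show "A ** (- B) = - (A ** B)" by (rule mat2_eqI) (simp_all add: mult2_nth)
qed

section \<open>The groups SL(2,R) and PSL(2,R)\<close>

lemma SL2R_simps [simp]:
  "carrier SL2R = {A. det A = 1}" "A \<otimes>\<^bsub>SL2R\<^esub> B = A ** B" "\<one>\<^bsub>SL2R\<^esub> = mat 1"
  by (simp_all add: SL2R_def)

lemma group_SL2R: "group SL2R"
proof (rule groupI)
  fix A assume A: "A \<in> carrier SL2R"
  then have "invertible A" by (simp add: invertible_det_nz)
  then obtain B where B: "A ** B = mat 1" "B ** A = mat 1" by (auto simp: invertible_def)
  then have "det B * det A = 1" using det_mul[of B A] det_I by metis
  then show "\<exists>B\<in>carrier SL2R. B \<otimes>\<^bsub>SL2R\<^esub> A = \<one>\<^bsub>SL2R\<^esub>" using A B by auto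
qed (auto simp: det_mul matrix_mul_assoc)

lemma proj_class_eq: "proj_class A = {A, - A}"
  by (auto simp: proj_class_def r_coset_def minus_mult2)

lemma center_normal: "{mat 1, - mat 1} \<lhd> SL2R"
proof -
  interpret group SL2R by (rule group_SL2R)
  have inv_minus: "inv\<^bsub>SL2R\<^esub> (- mat 1 :: real^2^2) = - mat 1"
    by (rule inv_equality) (simp_all add: minus_mult2 det_minus2)
  have "subgroup {mat 1, - mat 1} SL2R"
    using inv_one by unfold_locales (auto simp: minus_mult2 det_minus2 inv_minus)
  then show ?thesis
    by (rule normalI) (auto simp: r_coset_def l_coset_def minus_mult2)
qed

lemma group_PSL2R: "group PSL2R"
  unfolding PSL2R_def by (rule normal.factorgroup_is_group[OF center_normal])

lemma carrier_PSL2R: "carrier PSL2R = proj_class ` {A. det A = 1}"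
  by (auto simp: PSL2R_def FactGroup_def RCOSETS_def proj_class_def)

lemma one_PSL2R: "\<one>\<^bsub>PSL2R\<^esub> = proj_class (mat 1)"
  by (simp add: PSL2R_def FactGroup_def proj_class_eq)

lemma proj_class_mult:
  assumes "det A = 1" "det B = 1"
  shows "proj_class A \<otimes>\<^bsub>PSL2R\<^esub> proj_class B = proj_class (A ** B)"
  using normal.rcos_sum[OF center_normal, of A B] assms
  by (simp add: PSL2R_def FactGroup_def proj_class_def)

section \<open>The Moebius action in homogeneous coordinates\<close>

lemma ratio_scale: "c \<noteq> 0 \<Longrightarrow> ratio (c * p) (c * q) = ratio p q"
  by (auto simp: ratio_def)

lemma moebius_ratio:
  assumes "p \<noteq> 0 \<or> q \<noteq> 0"
  shows "moebius_act A (ratio p q) = ratio (A$1$1 * p + A$1$2 * q) (A$2$1 * p + A$2$2 * q)"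
proof (cases "q = 0")
  case True
  then show ?thesis
    using assms ratio_scale[of p "A$1$1" "A$2$1"] by (simp add: ratio_def mult.commute)
next
  case False
  have "A$1$1 * p + A$1$2 * q = q * (A$1$1 * (p / q) + A$1$2)"
    "A$2$1 * p + A$2$2 * q = q * (A$2$1 * (p / q) + A$2$2)"
    using False by (simp_all add: field_simps)
  then show ?thesis using ratio_scale[OF False] False by (simp add: ratio_def[of p q])
qed

lemma moebius_mult:
  assumes "det B \<noteq> 0"
  shows "moebius_act (A ** B) z = moebius_act A (moebius_act B z)"
proof -
  obtain p q where z: "z = ratio p q" "p \<noteq> 0 \<or> q \<noteq> 0"
  proof (cases z)
    case None
    then show ?thesis using that[of 1 0] by (simp add: ratio_def)
  next
    case (Some x)
    then show ?thesis using that[of x 1] by (simp add: ratio_def)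
  qed
  define p' q' where "p' = B$1$1 * p + B$1$2 * q" and "q' = B$2$1 * p + B$2$2 * q"
  \<comment> \<open>Cramer's rule: if both new coordinates vanished, so would both old ones.\<close>
  have "det B * p = B$2$2 * p' - B$1$2 * q'" "det B * q = B$1$1 * q' - B$2$1 * p'"
    by (simp_all add: det_2 p'_def q'_def algebra_simps)
  then have "p' \<noteq> 0 \<or> q' \<noteq> 0" using assms z(2) by auto
  then show ?thesis
    using moebius_ratio[OF z(2), of "A ** B"] moebius_ratio[OF z(2), of B] moebius_ratio[of p' q' A]
    unfolding z(1) by (simp add: mult2_nth p'_def q'_def algebra_simps)
qed

lemma moebius_one: "moebius_act (mat 1) z = z"
  by (cases z) (simp_all add: mat_1_mat2 ratio_def)

lemma moebius_minus: "moebius_act (- A) z = moebius_act A z"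
proof -
  have "ratio (- p) (- q) = ratio p q" for p q by (simp add: ratio_def)
  then have *: "ratio (- p - q) (- p' - q') = ratio (p + q) (p' + q')" "ratio (- p) (- q) = ratio p
      q" for p q p' q'
    by (metis add.inverse_distrib_swap diff_conv_add_uminus add.commute)+
  show ?thesis by (cases z) (simp_all add: *)
qed

lemma proj_action_class: "proj_action (proj_class A) z = moebius_act A z"
  by (simp add: proj_action_def proj_class_eq moebius_minus)

lemma proj_action_mult:
  assumes "g \<in> carrier PSL2R" "h \<in> carrier PSL2R"
  shows "proj_action (g \<otimes>\<^bsub>PSL2R\<^esub> h) z = proj_action g (proj_action h z)"
  using assms by (auto simp: carrier_PSL2R proj_class_mult proj_action_class moebius_mult)

lemma proj_action_one: "proj_action \<one>\<^bsub>PSL2R\<^esub> z = z"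
  by (simp add: one_PSL2R proj_action_class moebius_one)

lemma proj_class_minus: "proj_class (- A) = proj_class A"
  by (auto simp: proj_class_eq)

definition trans_class :: "nat \<Rightarrow> int \<Rightarrow> (real^2^2) set" where
  "trans_class m n = proj_class (mat2 1 (real_of_int n * hecke_lambda m) 0 1)"

definition inversion_class :: "(real^2^2) set" where
  "inversion_class = proj_class (mat2 0 (-1) 1 0)"

lemma trans_class_carrier: "trans_class m n \<in> carrier PSL2R"
  by (auto simp: trans_class_def carrier_PSL2R)

lemma inversion_class_carrier: "inversion_class \<in> carrier PSL2R"
  by (auto simp: inversion_class_def carrier_PSL2R)

lemma trans_class_add: "trans_class m a \<otimes>\<^bsub>PSL2R\<^esub> trans_class m b = trans_class m (a + b)"
  by (simp add: trans_class_def proj_class_mult mat2_mult algebra_simps)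

lemma trans_class_0: "trans_class m 0 = \<one>\<^bsub>PSL2R\<^esub>"
  by (simp add: trans_class_def one_PSL2R mat_1_mat2)

lemma inversion_class_square: "inversion_class \<otimes>\<^bsub>PSL2R\<^esub> inversion_class = \<one>\<^bsub>PSL2R\<^esub>"
  using proj_class_minus[of "mat2 1 0 0 1"]
  by (simp add: inversion_class_def one_PSL2R mat_1_mat2 proj_class_mult mat2_mult minus_mat2)

lemma Hecke_group_eq: "Hecke_group m = subgroup_generated PSL2R {inversion_class, trans_class m 1}"
  by (simp add: Hecke_group_def inversion_class_def trans_class_def mat2_def)

lemma group_Hecke: "group (Hecke_group m)"
  unfolding Hecke_group_eq by (rule group.group_subgroup_generated[OF group_PSL2R])

lemma carrier_Hecke: "carrier (Hecke_group m) = generate PSL2R {inversion_class, trans_class m 1}"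
  using trans_class_carrier inversion_class_carrier
  by (simp add: Hecke_group_eq carrier_subgroup_generated Int_absorb1)

lemma Hecke_simps [simp]:
  "g \<otimes>\<^bsub>Hecke_group m\<^esub> h = g \<otimes>\<^bsub>PSL2R\<^esub> h" "\<one>\<^bsub>Hecke_group m\<^esub> = \<one>\<^bsub>PSL2R\<^esub>"
  by (simp_all add: Hecke_group_eq subgroup_generated_def)

lemma Hecke_subset: "carrier (Hecke_group m) \<subseteq> carrier PSL2R"
  unfolding carrier_Hecke
  by (rule group.generate_incl[OF group_PSL2R]) (simp add: trans_class_carrier inversion_class_carrier)

lemma inversion_class_Hecke: "inversion_class \<in> carrier (Hecke_group m)"
  unfolding carrier_Hecke by (rule generate.incl) simp

lemma trans_class_Hecke: "trans_class m n \<in> carrier (Hecke_group m)"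
proof (induction n rule: int_induct[where k = 0])
  interpret group "Hecke_group m" by (rule group_Hecke)
  case base
  then show ?case using one_closed by (simp add: trans_class_0)
next
  interpret group "Hecke_group m" by (rule group_Hecke)
  case (step1 n)
  have "trans_class m 1 \<in> carrier (Hecke_group m)" unfolding carrier_Hecke by (rule generate.incl) simp
  with step1(2) have "trans_class m n \<otimes>\<^bsub>Hecke_group m\<^esub> trans_class m 1 \<in> carrier (Hecke_group m)"
    by (rule m_closed)
  then show ?case by (simp add: trans_class_add)
next
  interpret group "Hecke_group m" by (rule group_Hecke)
  case (step2 n)
  have "inv\<^bsub>PSL2R\<^esub> (trans_class m 1) = trans_class m (-1)"
    by (rule group.inv_equality[OF group_PSL2R])
      (simp_all add: trans_class_carrier trans_class_add trans_class_0)
  moreover have "inv\<^bsub>PSL2R\<^esub> (trans_class m 1) \<in> carrier (Hecke_group m)"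
    unfolding carrier_Hecke by (rule generate.inv) simp
  ultimately have "trans_class m (-1) \<in> carrier (Hecke_group m)" by simp
  with step2(2) have "trans_class m n \<otimes>\<^bsub>Hecke_group m\<^esub> trans_class m (-1) \<in> carrier (Hecke_group m)"
    by (rule m_closed)
  then show ?case by (simp add: trans_class_add)
qed

lemma proj_action_Hecke_mult:
  assumes "g \<in> carrier (Hecke_group m)" "h \<in> carrier (Hecke_group m)"
  shows "proj_action (g \<otimes>\<^bsub>Hecke_group m\<^esub> h) z = proj_action g (proj_action h z)"
  using assms proj_action_mult Hecke_subset by (simp add: subset_iff)

text \<open>Both images correspond to the common fibres. It serves to count two kinds of cosets that
  are indexed by the same stabilizer.\<close>

lemma card_image_eq_if_same_kernel:
  assumes "\<And>x y. x \<in> K \<Longrightarrow> y \<in> K \<Longrightarrow> F x = F y \<longleftrightarrow> G x = G y"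
  shows "card (F ` K) = card (G ` K)"
proof -
  define \<phi> where "\<phi> y = G (SOME x. x \<in> K \<and> F x = y)" for y
  have \<phi>: "\<phi> (F x) = G x" if "x \<in> K" for x
  proof -
    have "(SOME x'. x' \<in> K \<and> F x' = F x) \<in> K \<and> F (SOME x'. x' \<in> K \<and> F x' = F x) = F x"
      using that by (intro someI_ex[where P = "\<lambda>x'. x' \<in> K \<and> F x' = F x"]) blast
    then show ?thesis unfolding \<phi>_def using assms that by blast
  qed
  have "bij_betw \<phi> (F ` K) (G ` K)"
    unfolding bij_betw_def inj_on_def image_image using \<phi> assms by (auto simp: image_iff)
  then show ?thesis by (rule bij_betw_same_card)
qed

section \<open>Cosets and cusps\<close>

locale hecke_subgroup =
  fixes m :: nat and H :: "(real^2^2) set set"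
  assumes H: "subgroup H (Hecke_group m)"
    and finite_index: "finite (rcosets\<^bsub>Hecke_group m\<^esub> H)"
begin

abbreviation G where "G \<equiv> Hecke_group m"
abbreviation act where "act \<equiv> proj_action"
abbreviation cosets where "cosets \<equiv> rcosets\<^bsub>G\<^esub> H"

sublocale G: group G by (rule group_Hecke)

lemma H_subset: "H \<subseteq> carrier G" using H by (rule subgroup.subset)

lemma act_mult: "g \<in> carrier G \<Longrightarrow> h \<in> carrier G \<Longrightarrow> act (g \<otimes>\<^bsub>G\<^esub> h) z = act g (act h z)"
  by (rule proj_action_Hecke_mult)

lemma act_one: "act \<one>\<^bsub>G\<^esub> z = z"
  by (simp add: proj_action_one)

lemma act_inv: "g \<in> carrier G \<Longrightarrow> act g z = w \<Longrightarrow> act (inv\<^bsub>G\<^esub> g) w = z"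
  using act_mult[of "inv\<^bsub>G\<^esub> g" g z] G.l_inv[of g] act_one by (metis G.inv_closed)

lemma cosets_iff: "c \<in> cosets \<longleftrightarrow> (\<exists>g\<in>carrier G. c = H #>\<^bsub>G\<^esub> g)"
  by (auto simp: RCOSETS_def)

lemma coset_mult_assoc': "a \<in> carrier G \<Longrightarrow> b \<in> carrier G \<Longrightarrow>
    (H #>\<^bsub>G\<^esub> a) #>\<^bsub>G\<^esub> b = H #>\<^bsub>G\<^esub> (a \<otimes>\<^bsub>G\<^esub> b)"
  by (rule G.coset_mult_assoc[OF H_subset])

lemma coset_translate_mem: "c \<in> cosets \<Longrightarrow> b \<in> carrier G \<Longrightarrow> c #>\<^bsub>G\<^esub> b \<in> cosets"
  unfolding cosets_iff using coset_mult_assoc' G.m_closed by metis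

lemma coset_subset: "c \<in> cosets \<Longrightarrow> c \<subseteq> carrier G"
  by (rule subgroup.rcosets_carrier[OF H G.group_axioms])

lemma coset_translate_mult:
  "c \<in> cosets \<Longrightarrow> a \<in> carrier G \<Longrightarrow> b \<in> carrier G \<Longrightarrow>
    (c #>\<^bsub>G\<^esub> a) #>\<^bsub>G\<^esub> b = c #>\<^bsub>G\<^esub> (a \<otimes>\<^bsub>G\<^esub> b)"
  by (metis G.coset_mult_assoc coset_subset)

lemma coset_translate_one: "c \<in> cosets \<Longrightarrow> c #>\<^bsub>G\<^esub> \<one>\<^bsub>G\<^esub> = c"
  by (metis G.coset_mult_one coset_subset)

lemma coset_translate_inj:
  assumes "c \<in> cosets" "c' \<in> cosets" "g \<in> carrier G" "c #>\<^bsub>G\<^esub> g = c' #>\<^bsub>G\<^esub> g"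
  shows "c = c'"
proof -
  have "(c #>\<^bsub>G\<^esub> g) #>\<^bsub>G\<^esub> inv\<^bsub>G\<^esub> g = (c' #>\<^bsub>G\<^esub> g) #>\<^bsub>G\<^esub> inv\<^bsub>G\<^esub> g"
    using assms(4) by simp
  then show ?thesis
    using assms coset_translate_mult coset_translate_one by (metis G.inv_closed G.r_inv)
qed

lemma coset_eq_iff:
  assumes "subgroup K G" "a \<in> carrier G" "b \<in> carrier G"
  shows "K #>\<^bsub>G\<^esub> a = K #>\<^bsub>G\<^esub> b \<longleftrightarrow> a \<otimes>\<^bsub>G\<^esub> inv\<^bsub>G\<^esub> b \<in> K"
  using assms G.rcos_self[OF assms(2,1)] G.repr_independence[OF _ assms(3,1), of a]
    subgroup.rcos_module[OF assms(1) G.group_axioms assms(3,2)] by auto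

text \<open>A cusp is invariant under H, so the condition depends only on the coset of g.\<close>

lemma cusp_hit_iff:
  assumes \<kappa>: "\<kappa> \<in> cusps m H" and g: "g \<in> carrier G"
  shows "(\<exists>g'\<in>H #>\<^bsub>G\<^esub> g. act g' z \<in> \<kappa>) \<longleftrightarrow> act g z \<in> \<kappa>"
proof -
  obtain z0 where z0: "\<kappa> = {act h z0 | h. h \<in> H}"
    using \<kappa> by (auto simp: cusps_def orbits_def orbit_def)
  have inv: "act h w \<in> \<kappa>" if hw: "h \<in> H" "w \<in> \<kappa>" for h w
  proof -
    obtain h' where h': "h' \<in> H" "w = act h' z0" using hw(2) unfolding z0 by blast
    then have "act h w = act (h \<otimes>\<^bsub>G\<^esub> h') z0" using act_mult hw H_subset by (simp add: subset_eq)
    moreover have "h \<otimes>\<^bsub>G\<^esub> h' \<in> H" by (rule subgroup.m_closed[OF H hw(1) h'(1)])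
    ultimately show ?thesis using z0 by blast
  qed
  show ?thesis
  proof
    assume "\<exists>g'\<in>H #>\<^bsub>G\<^esub> g. act g' z \<in> \<kappa>"
    then obtain h where h: "h \<in> H" "act (h \<otimes>\<^bsub>G\<^esub> g) z \<in> \<kappa>" by (auto simp: r_coset_def)
    have hG: "h \<in> carrier G" using h H_subset by auto
    have "act (inv\<^bsub>G\<^esub> h) (act (h \<otimes>\<^bsub>G\<^esub> g) z) \<in> \<kappa>"
      using inv h(2) subgroup.m_inv_closed[OF H h(1)] by blast
    moreover have "act (inv\<^bsub>G\<^esub> h) (act (h \<otimes>\<^bsub>G\<^esub> g) z) = act g z"
      using act_inv[OF hG] act_mult[OF hG g] by metis
    ultimately show "act g z \<in> \<kappa>" by simp
  next
    assume "act g z \<in> \<kappa>"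
    then show "\<exists>g'\<in>H #>\<^bsub>G\<^esub> g. act g' z \<in> \<kappa>" using G.rcos_self[OF g H] by blast
  qed
qed

text \<open>Fix z in the cusp and g1 with g1(0) = z. The cosets in question are H k g1 with k in the
  stabilizer K of z, and two of them agree exactly when k and k' lie in the same coset of the
  stabilizer of z in H. Their number is thus the index that defines the width.\<close>

lemma card_cusp_cosets:
  assumes \<kappa>: "\<kappa> \<in> cusps m H"
  shows "card {c \<in> cosets. \<exists>g\<in>c. act g (Some 0) \<in> \<kappa>} = cusp_width m H \<kappa>"
proof -
  obtain z0 where z0: "z0 \<in> orbit G act None" "\<kappa> = {act h z0 | h. h \<in> H}"
    using \<kappa> by (auto simp: cusps_def orbits_def orbit_def)
  have "z0 \<in> \<kappa>" unfolding z0 using subgroup.one_closed[OF H] act_one by (metis (mono_tags, lifting)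
      mem_Collect_eq)
  \<comment> \<open>The same choice of a point as in \<open>cusp_width\<close>.\<close>
  define z where "z = (SOME z. z \<in> \<kappa>)"
  have z: "z \<in> \<kappa>" unfolding z_def using \<open>z0 \<in> \<kappa>\<close> by (rule someI)
  then obtain h0 where h0: "h0 \<in> H" "z = act h0 z0" unfolding z0 by blast
  have h0G: "h0 \<in> carrier G" using h0 H_subset by auto
  obtain g0 where g0: "g0 \<in> carrier G" "z0 = act g0 None" using z0(1) by (auto simp: orbit_def)
  have None_eq: "None = act inversion_class (Some 0)"
    by (simp add: inversion_class_def proj_action_class ratio_def)
  define g1 where "g1 = h0 \<otimes>\<^bsub>G\<^esub> (g0 \<otimes>\<^bsub>G\<^esub> inversion_class)"
  have g1: "g1 \<in> carrier G" "act g1 (Some 0) = z"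
  proof -
    have i: "inversion_class \<in> carrier G" by (rule inversion_class_Hecke)
    show "g1 \<in> carrier G" unfolding g1_def using h0G g0(1) i by (intro G.m_closed)
    show "act g1 (Some 0) = z"
      unfolding g1_def using act_mult[OF h0G G.m_closed[OF g0(1) i]] act_mult[OF g0(1) i] None_eq h0 g0
      by metis
  qed
  have \<kappa>_z: "\<exists>h\<in>H. y = act h z" if "y \<in> \<kappa>" for y
  proof -
    obtain h where h: "h \<in> H" "y = act h z0" using \<open>y \<in> \<kappa>\<close> z0 by blast
    have "z0 = act (inv\<^bsub>G\<^esub> h0) z" using act_inv[OF h0G] h0(2) by metis
    then have "y = act (h \<otimes>\<^bsub>G\<^esub> inv\<^bsub>G\<^esub> h0) z"
      using h act_mult[of h "inv\<^bsub>G\<^esub> h0"] h0G H_subset by (simp add: subset_eq del: Hecke_simps)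
    moreover have "h \<otimes>\<^bsub>G\<^esub> inv\<^bsub>G\<^esub> h0 \<in> H"
      using subgroup.m_closed[OF H h(1) subgroup.m_inv_closed[OF H h0(1)]] .
    ultimately show ?thesis by blast
  qed
  define K where "K = {g \<in> carrier G. act g z = z}"
  define KH where "KH = {g \<in> H. act g z = z}"
  have K_sub: "subgroup K G"
  proof
    show "K \<subseteq> carrier G" by (auto simp: K_def)
    show "x \<otimes>\<^bsub>G\<^esub> y \<in> K" if "x \<in> K" "y \<in> K" for x y
      using that act_mult by (auto simp: K_def simp del: Hecke_simps)
    show "\<one>\<^bsub>G\<^esub> \<in> K" using act_one by (auto simp: K_def simp del: Hecke_simps)
    show "inv\<^bsub>G\<^esub> x \<in> K" if "x \<in> K" for x
      using that act_inv[of x z z] by (auto simp: K_def)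
  qed
  have KH_sub: "subgroup KH G"
  proof -
    have "KH = K \<inter> H" using H_subset by (auto simp: K_def KH_def)
    then show ?thesis using G.subgroups_Inter_pair[OF K_sub H] by simp
  qed
  have "{c \<in> cosets. \<exists>g\<in>c. act g (Some 0) \<in> \<kappa>} = (\<lambda>k. H #>\<^bsub>G\<^esub> (k \<otimes>\<^bsub>G\<^esub> g1)) ` K"
  proof (intro equalityI subsetI)
    fix c assume c: "c \<in> {c \<in> cosets. \<exists>g\<in>c. act g (Some 0) \<in> \<kappa>}"
    then obtain g where g: "g \<in> carrier G" "c = H #>\<^bsub>G\<^esub> g" by (auto simp: cosets_iff)
    then have "act g (Some 0) \<in> \<kappa>" using c cusp_hit_iff[OF \<kappa> g(1)] by blast
    then obtain h where h: "h \<in> H" "act g (Some 0) = act h z" using \<kappa>_z by blast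
    have hG: "h \<in> carrier G" using h H_subset by auto
    \<comment> \<open>This k fixes z, since g(0) = h(z), and k g1 differs from g only by an element
      of H on the left.\<close>
    define k where "k = inv\<^bsub>G\<^esub> h \<otimes>\<^bsub>G\<^esub> (g \<otimes>\<^bsub>G\<^esub> inv\<^bsub>G\<^esub> g1)"
    have kG: "k \<in> carrier G" unfolding k_def using hG g g1 by (intro G.m_closed G.inv_closed)
    have "act (inv\<^bsub>G\<^esub> g1) z = Some 0" using act_inv[OF g1] .
    moreover have "act (inv\<^bsub>G\<^esub> h) (act g (Some 0)) = z" using act_inv[OF hG] h(2) by metis
    ultimately have "act k z = z"
      unfolding k_def using act_mult hG g g1 by (simp add: G.m_closed del: Hecke_simps)
    then have kK: "k \<in> K" using kG by (simp add: K_def)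
    have "k \<otimes>\<^bsub>G\<^esub> g1 = inv\<^bsub>G\<^esub> h \<otimes>\<^bsub>G\<^esub> g"
      unfolding k_def using hG g g1 by (simp add: G.m_assoc del: Hecke_simps)
    moreover have "H #>\<^bsub>G\<^esub> (inv\<^bsub>G\<^esub> h \<otimes>\<^bsub>G\<^esub> g) = H #>\<^bsub>G\<^esub> g"
      using coset_eq_iff[OF H, of "inv\<^bsub>G\<^esub> h \<otimes>\<^bsub>G\<^esub> g" g] hG g subgroup.m_inv_closed[OF H h(1)]
      by (simp add: G.m_assoc del: Hecke_simps)
    ultimately show "c \<in> (\<lambda>k. H #>\<^bsub>G\<^esub> (k \<otimes>\<^bsub>G\<^esub> g1)) ` K" using kK g(2) by (metis image_eqI)
  next
    fix c assume "c \<in> (\<lambda>k. H #>\<^bsub>G\<^esub> (k \<otimes>\<^bsub>G\<^esub> g1)) ` K"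
    then obtain k where k: "k \<in> carrier G" "act k z = z" "c = H #>\<^bsub>G\<^esub> (k \<otimes>\<^bsub>G\<^esub> g1)" by (auto simp: K_def)
    have kg: "k \<otimes>\<^bsub>G\<^esub> g1 \<in> carrier G" using k(1) g1(1) by (rule G.m_closed)
    have "act (k \<otimes>\<^bsub>G\<^esub> g1) (Some 0) \<in> \<kappa>" using act_mult[OF k(1) g1(1)] g1(2) k(2) z by metis
    then show "c \<in> {c \<in> cosets. \<exists>g\<in>c. act g (Some 0) \<in> \<kappa>}"
      using cusp_hit_iff[OF \<kappa> kg] k(3) kg unfolding cosets_iff by blast
  qed
  also have "card \<dots> = card ((\<lambda>k. KH #>\<^bsub>G\<^esub> k) ` K)"
  proof (rule card_image_eq_if_same_kernel)
    fix k k' assume k: "k \<in> K" "k' \<in> K"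
    then have kG: "k \<in> carrier G" "k' \<in> carrier G" by (auto simp: K_def)
    have "(k \<otimes>\<^bsub>G\<^esub> g1) \<otimes>\<^bsub>G\<^esub> inv\<^bsub>G\<^esub> (k' \<otimes>\<^bsub>G\<^esub> g1) = k \<otimes>\<^bsub>G\<^esub> inv\<^bsub>G\<^esub> k'"
    proof -
      have "(k \<otimes>\<^bsub>G\<^esub> g1) \<otimes>\<^bsub>G\<^esub> (inv\<^bsub>G\<^esub> g1 \<otimes>\<^bsub>G\<^esub> inv\<^bsub>G\<^esub> k') = k \<otimes>\<^bsub>G\<^esub> ((g1 \<otimes>\<^bsub>G\<^esub> inv\<^bsub>G\<^esub> g1) \<otimes>\<^bsub>G\<^esub> inv\<^bsub>G\<^esub> k')"
        using kG g1(1) by (simp only: G.m_assoc G.m_closed G.inv_closed)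
      then show ?thesis using kG g1(1) by (simp add: G.inv_mult_group del: Hecke_simps)
    qed
    moreover have "k \<otimes>\<^bsub>G\<^esub> inv\<^bsub>G\<^esub> k' \<in> K"
      using subgroup.m_closed[OF K_sub k(1) subgroup.m_inv_closed[OF K_sub k(2)]] .
    then have "k \<otimes>\<^bsub>G\<^esub> inv\<^bsub>G\<^esub> k' \<in> KH \<longleftrightarrow> k \<otimes>\<^bsub>G\<^esub> inv\<^bsub>G\<^esub> k' \<in> H"
      by (auto simp: K_def KH_def)
    ultimately show "H #>\<^bsub>G\<^esub> (k \<otimes>\<^bsub>G\<^esub> g1) = H #>\<^bsub>G\<^esub> (k' \<otimes>\<^bsub>G\<^esub> g1) \<longleftrightarrow> KH #>\<^bsub>G\<^esub> k = KH #>\<^bsub>G\<^esub> k'"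
      using coset_eq_iff[OF H G.m_closed[OF kG(1) g1(1)] G.m_closed[OF kG(2) g1(1)]]
        coset_eq_iff[OF KH_sub kG] by simp
  qed
  also have "\<dots> = cusp_width m H \<kappa>"
  proof -
    have "(\<lambda>k. KH #>\<^bsub>G\<^esub> k) ` K = rcosets\<^bsub>G\<lparr>carrier := stabilizer G act z\<rparr>\<^esub> (stabilizer (G\<lparr>carrier :=
        H\<rparr>) act z)"
      by (auto simp: RCOSETS_def r_coset_def stabilizer_def K_def KH_def)
    then show ?thesis by (simp add: cusp_width_def group_index_def z_def Let_def)
  qed
  finally show ?thesis .
qed

end

section \<open>The coset walk of the approximants\<close>

locale hecke_rosen = rosen_expansion m + hecke_subgroup m H for m H
begin

definition states :: "((real^2^2) set set \<times> int) set" where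
  "states = cosets \<times> {1, -1}"

text \<open>A state (H g, s) stands for the coset H g J^(if s = 1 then 0 else 1) with J = diag(-1, 1):
  the matrix of a digit with sign 1 has determinant -1, and the sign records the parity of their
  number. Digit 0 is a dummy.\<close>

definition next_state :: "(real^2^2) set set \<times> int \<Rightarrow> int \<Rightarrow> (real^2^2) set set \<times> int" where
  "next_state s k = (if k = 0 then s else
     (fst s #>\<^bsub>G\<^esub> (inversion_class \<otimes>\<^bsub>G\<^esub> trans_class m (- snd s * k)), - sgn k * snd s))"

lemma inv_trans_carrier: "inversion_class \<otimes>\<^bsub>G\<^esub> trans_class m n \<in> carrier G"
  by (rule G.m_closed[OF inversion_class_Hecke trans_class_Hecke])

lemma next_state_in: "s \<in> states \<Longrightarrow> next_state s k \<in> states"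
  using coset_translate_mem[OF _ inv_trans_carrier]
  by (auto simp: states_def next_state_def sgn_if simp del: Hecke_simps)

lemma finite_states: "finite states"
  using finite_index by (simp add: states_def)

text \<open>The digit and the new sign determine the old sign, and with it the group element by
  which the coset was translated. Finiteness turns injectivity into bijectivity.\<close>

lemma next_state_bij: "bij_betw (\<lambda>s. next_state s k) states states"
proof -
  have "inj_on (\<lambda>s. next_state s k) states"
  proof (rule inj_onI)
    fix s s' assume *: "s \<in> states" "s' \<in> states" "next_state s k = next_state s' k"
    show "s = s'"
    proof (cases "k = 0")
      case False
      then have "snd s = snd s'" using *(3) by (simp add: next_state_def sgn_if split: if_splits)
      moreover have "fst s = fst s'"
      proof (rule coset_translate_inj[OF _ _ inv_trans_carrier])
        show "fst s \<in> cosets" "fst s' \<in> cosets" using *(1,2) by (simp_all add: states_def mem_Times_iff)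
        show "fst s #>\<^bsub>G\<^esub> (inversion_class \<otimes>\<^bsub>G\<^esub> trans_class m (- snd s * k)) =
            fst s' #>\<^bsub>G\<^esub> (inversion_class \<otimes>\<^bsub>G\<^esub> trans_class m (- snd s * k))"
          using *(3) False calculation by (simp add: next_state_def del: Hecke_simps)
      qed
      ultimately show ?thesis by (simp add: prod_eq_iff)
    qed (use * in \<open>simp add: next_state_def\<close>)
  qed
  moreover have "(\<lambda>s. next_state s k) ` states \<subseteq> states" using next_state_in by blast
  ultimately show ?thesis
    using finite_states by (simp add: bij_betw_def endo_inj_surj)
qed

section \<open>Transitivity of the walk under full digits\<close>

definition reachable where
  "reachable s t \<longleftrightarrow> (\<exists>w. w \<noteq> [] \<and> (\<forall>k\<in>set w. 3 \<le> \<bar>k\<bar>) \<and> foldl next_state s w = t)"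

lemma reachable_trans: "reachable s t \<Longrightarrow> reachable t v \<Longrightarrow> reachable s v"
  unfolding reachable_def
proof (elim exE conjE)
  fix w w' assume "w \<noteq> []" "\<forall>k\<in>set w. 3 \<le> \<bar>k\<bar>" "foldl next_state s w = t"
    "w' \<noteq> []" "\<forall>k\<in>set w'. 3 \<le> \<bar>k\<bar>" "foldl next_state t w' = v"
  then show "\<exists>w. w \<noteq> [] \<and> (\<forall>k\<in>set w. 3 \<le> \<bar>k\<bar>) \<and> foldl next_state s w = v"
    by (intro exI[of _ "w @ w'"]) auto
qed

text \<open>Translations act on the finite coset space with finite order, so the size of a digit
  can be raised without changing its effect.\<close>

lemma translation_period:
  assumes "c \<in> cosets"
  shows "\<exists>d>0. \<forall>n q. c #>\<^bsub>G\<^esub> trans_class m (n + q * d) = c #>\<^bsub>G\<^esub> trans_class m n"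
proof -
  \<comment> \<open>Pigeonhole: infinitely many translates of c lie among finitely many
    cosets.\<close>
  have "range (\<lambda>j::nat. c #>\<^bsub>G\<^esub> trans_class m (int j)) \<subseteq> cosets"
    using coset_translate_mem[OF assms trans_class_Hecke] by blast
  then have "\<not> inj (\<lambda>j::nat. c #>\<^bsub>G\<^esub> trans_class m (int j))"
    using finite_index finite_subset finite_imageD infinite_UNIV_nat by blast
  then obtain i j :: nat where "i \<noteq> j"
    "c #>\<^bsub>G\<^esub> trans_class m (int i) = c #>\<^bsub>G\<^esub> trans_class m (int j)"
    by (auto simp: inj_def)
  then obtain i j :: nat where ij: "i < j"
    "c #>\<^bsub>G\<^esub> trans_class m (int i) = c #>\<^bsub>G\<^esub> trans_class m (int j)"
    by (metis linorder_neqE_nat)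
  define d where "d = int j - int i"
  have tt: "(c #>\<^bsub>G\<^esub> trans_class m a) #>\<^bsub>G\<^esub> trans_class m b = c #>\<^bsub>G\<^esub> trans_class m (a + b)" for a b
    using coset_translate_mult[OF assms trans_class_Hecke trans_class_Hecke] by (simp add:
        trans_class_add)
  have per: "c #>\<^bsub>G\<^esub> trans_class m (n + d) = c #>\<^bsub>G\<^esub> trans_class m n" for n
    using tt[of "int j" "n - int i"] tt[of "int i" "n - int i"] ij(2) by (simp add: d_def algebra_simps)
  have "c #>\<^bsub>G\<^esub> trans_class m (n + q * d) = c #>\<^bsub>G\<^esub> trans_class m n" for n q
  proof (induction q rule: int_induct[where k = 0])
    case (step1 q)
    then show ?case using per[of "n + q * d"] by (simp add: algebra_simps)
  next
    case (step2 q)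
    then show ?case using per[of "n + (q - 1) * d"] by (simp add: algebra_simps)
  qed simp
  then show ?thesis using ij by (intro exI[of _ d]) (auto simp: d_def)
qed

lemma reachable_step:
  assumes c: "c \<in> cosets" and s: "\<sigma> \<in> {1,-1}" "\<tau> \<in> {1,-1}"
  shows "reachable (c, \<sigma>) (c #>\<^bsub>G\<^esub> (inversion_class \<otimes>\<^bsub>G\<^esub> trans_class m n), \<tau>)"
proof -
  have c': "c #>\<^bsub>G\<^esub> inversion_class \<in> cosets"
    using coset_translate_mem[OF c inversion_class_Hecke] .
  obtain d where d: "d > 0" "\<And>n q. (c #>\<^bsub>G\<^esub> inversion_class) #>\<^bsub>G\<^esub> trans_class m (n + q * d) =
      (c #>\<^bsub>G\<^esub> inversion_class) #>\<^bsub>G\<^esub> trans_class m n"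
    using translation_period[OF c'] by blast
  \<comment> \<open>The multiple of d makes a at least 3 and keeps \<open>\<tau> * a\<close>
    congruent to n modulo the period. The sign of k is then free to produce \<tau>, so a single
    digit controls coset and sign independently.\<close>
  define a where "a = \<tau> * n + (\<bar>n\<bar> + 3) * d"
  have "(\<bar>n\<bar> + 3) * 1 \<le> (\<bar>n\<bar> + 3) * d" using d(1) by (intro mult_left_mono) auto
  then have a: "a \<ge> 3" using s(2) by (auto simp: a_def)
  define k where "k = - \<tau> * \<sigma> * a"
  have k: "\<bar>k\<bar> \<ge> 3" "- \<sigma> * k = \<tau> * a" "- sgn k * \<sigma> = \<tau>" "k \<noteq> 0"
    using a s by (auto simp: k_def)
  have "\<tau> * a = n + (\<tau> * (\<bar>n\<bar> + 3)) * d" using s(2) by (auto simp: a_def algebra_simps)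
  then have "c #>\<^bsub>G\<^esub> (inversion_class \<otimes>\<^bsub>G\<^esub> trans_class m (- \<sigma> * k)) =
      c #>\<^bsub>G\<^esub> (inversion_class \<otimes>\<^bsub>G\<^esub> trans_class m n)"
    using d(2)[of n "\<tau> * (\<bar>n\<bar> + 3)"]
      coset_translate_mult[OF c inversion_class_Hecke trans_class_Hecke] k(2) by metis
  then have "foldl next_state (c, \<sigma>) [k] = (c #>\<^bsub>G\<^esub> (inversion_class \<otimes>\<^bsub>G\<^esub> trans_class m n), \<tau>)"
    using k(3,4) by (simp add: next_state_def del: Hecke_simps)
  then show ?thesis unfolding reachable_def using k(1) by (intro exI[of _ "[k]"]) (simp del:
      Hecke_simps)
qed

lemma reachable_inversion:
  assumes "c \<in> cosets" "\<sigma> \<in> {1,-1}" "\<tau> \<in> {1,-1}"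
  shows "reachable (c, \<sigma>) (c #>\<^bsub>G\<^esub> inversion_class, \<tau>)"
  using reachable_step[OF assms, of 0] inversion_class_Hecke
  by (simp add: trans_class_0 G.r_one[simplified])

text \<open>The inversion squares to the identity, so a translation is the product of two moves that
  begin with an inversion.\<close>

lemma reachable_trans_class:
  assumes "c \<in> cosets" "\<sigma> \<in> {1,-1}" "\<tau> \<in> {1,-1}"
  shows "reachable (c, \<sigma>) (c #>\<^bsub>G\<^esub> trans_class m n, \<tau>)"
proof -
  have "(c #>\<^bsub>G\<^esub> inversion_class) #>\<^bsub>G\<^esub> (inversion_class \<otimes>\<^bsub>G\<^esub> trans_class m n) = c #>\<^bsub>G\<^esub> trans_class
      m n"
  proof -
    have "inversion_class \<otimes>\<^bsub>G\<^esub> (inversion_class \<otimes>\<^bsub>G\<^esub> trans_class m n) = trans_class m n"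
      using G.m_assoc[OF inversion_class_Hecke inversion_class_Hecke trans_class_Hecke, of n]
        inversion_class_square G.l_one[OF trans_class_Hecke, of n] by simp
    then show ?thesis
      using coset_translate_mult[OF assms(1) inversion_class_Hecke inv_trans_carrier] by simp
  qed
  then show ?thesis
    using reachable_trans[OF reachable_inversion[OF assms]
        reachable_step[OF coset_translate_mem[OF assms(1) inversion_class_Hecke] assms(3,3), of n]]
    by simp
qed

text \<open>Induction over the generators: concatenated words correspond to multiplication on the
  right.\<close>

lemma reachable_translate:
  assumes "g \<in> carrier G" "c \<in> cosets" "\<sigma> \<in> {1,-1}" "\<tau> \<in> {1,-1}"
  shows "reachable (c, \<sigma>) (c #>\<^bsub>G\<^esub> g, \<tau>)"
proof -
  have "g \<in> generate PSL2R {inversion_class, trans_class m 1}" using assms(1) carrier_Hecke by simp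
  then show ?thesis using assms(2-4)
  proof (induction g arbitrary: c \<sigma> \<tau> rule: generate.induct)
    case one
    then show ?case using reachable_trans_class[of c \<sigma> \<tau> 0] by (simp add: trans_class_0)
  next
    case (incl g)
    then show ?case using reachable_inversion reachable_trans_class by auto
  next
    case (inv g)
    have "inv\<^bsub>PSL2R\<^esub> inversion_class = inversion_class"
      by (rule group.inv_equality[OF group_PSL2R])
        (simp_all add: inversion_class_carrier inversion_class_square)
    moreover have "inv\<^bsub>PSL2R\<^esub> (trans_class m 1) = trans_class m (-1)"
      by (rule group.inv_equality[OF group_PSL2R])
        (simp_all add: trans_class_carrier trans_class_add trans_class_0)
    ultimately show ?case using inv reachable_inversion reachable_trans_class by auto
  next
    case (eng g h)
    have gh: "g \<in> carrier G" "h \<in> carrier G" using eng(1,2) carrier_Hecke by auto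
    have "reachable (c, \<sigma>) ((c #>\<^bsub>G\<^esub> g) #>\<^bsub>G\<^esub> h, \<tau>)"
      using reachable_trans[OF eng.IH(1)[OF eng.prems] eng.IH(2)[OF coset_translate_mem[OF
          eng.prems(1) gh(1)] eng.prems(3,3)]] .
    then show ?case using coset_translate_mult[OF eng.prems(1) gh] by simp
  qed
qed

lemma reachable_all:
  assumes "s \<in> states" "t \<in> states" shows "reachable s t"
proof -
  obtain a \<sigma> b \<tau> where ab: "a \<in> carrier G" "b \<in> carrier G" "s = (H #>\<^bsub>G\<^esub> a, \<sigma>)" "t = (H #>\<^bsub>G\<^esub> b, \<tau>)"
    and \<sigma>: "\<sigma> \<in> {1,-1}" "\<tau> \<in> {1,-1}"
    using assms unfolding states_def cosets_iff[symmetric] by (auto simp: cosets_iff)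
  have g: "inv\<^bsub>G\<^esub> a \<otimes>\<^bsub>G\<^esub> b \<in> carrier G" using ab by (simp del: Hecke_simps)
  have "a \<otimes>\<^bsub>G\<^esub> (inv\<^bsub>G\<^esub> a \<otimes>\<^bsub>G\<^esub> b) = b"
    using ab by (simp add: G.m_assoc[symmetric] del: Hecke_simps)
  then have "(H #>\<^bsub>G\<^esub> a) #>\<^bsub>G\<^esub> (inv\<^bsub>G\<^esub> a \<otimes>\<^bsub>G\<^esub> b) = H #>\<^bsub>G\<^esub> b"
    using coset_mult_assoc'[OF ab(1) g] by simp
  moreover have "H #>\<^bsub>G\<^esub> a \<in> cosets" using ab(1) cosets_iff by blast
  ultimately show ?thesis using reachable_translate[OF g _ \<sigma>] ab by metis
qed

sublocale rosen_skew m states next_state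
proof
  show "finite states" by (rule finite_states)
  have "H #>\<^bsub>G\<^esub> \<one>\<^bsub>G\<^esub> \<in> cosets" using cosets_iff G.one_closed by blast
  then show "states \<noteq> {}" unfolding states_def by blast
  show "bij_betw (\<lambda>s. next_state s k) states states" for k by (rule next_state_bij)
  show "\<exists>w. w \<noteq> [] \<and> (\<forall>k\<in>set w. 3 \<le> \<bar>k\<bar>) \<and> foldl next_state s w = t"
    if "s \<in> states" "t \<in> states" for s t
    using reachable_all[OF that] unfolding reachable_def .
qed

definition cusp_states :: "real option set \<Rightarrow> ((real^2^2) set set \<times> int) set" where
  "cusp_states \<kappa> = {c \<in> cosets. \<exists>g\<in>c. act g (Some 0) \<in> \<kappa>} \<times> {1, -1}"

lemma cusp_states_subset: "cusp_states \<kappa> \<subseteq> states"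
  by (auto simp: cusp_states_def states_def)

lemma cusp_states_density:
  assumes "\<kappa> \<in> cusps m H"
  shows "card (cusp_states \<kappa>) / card states = cusp_width m H \<kappa> / group_index G H"
  using card_cusp_cosets[OF assms]
  by (simp add: cusp_states_def states_def card_cartesian_product group_index_def)

text \<open>The columns are the approximants n - 1 and n of y in homogeneous form, translated by s.
  The factor \<sigma> on the first column is there to normalise the determinant to 1; it does not
  affect the value at 0.\<close>

definition approximant_matrix :: "real \<Rightarrow> real \<Rightarrow> int \<Rightarrow> nat \<Rightarrow> real^2^2" where
  "approximant_matrix s y \<sigma> n = mat2
     (\<sigma> * (rosen_p_shifted m y n + s * rosen_q_shifted m y n))
     (rosen_p_shifted m y (Suc n) + s * rosen_q_shifted m y (Suc n))
     (\<sigma> * rosen_q_shifted m y n) (rosen_q_shifted m y (Suc n))"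

lemma state_approximant:
  assumes y: "y \<in> I0" "\<And>n. (T ^^ n) y \<noteq> 0"
  shows "\<exists>\<sigma>\<in>{1,-1}. det (approximant_matrix (r * L) y \<sigma> n) = 1 \<and>
    proj_class (approximant_matrix (r * L) y \<sigma> n) \<in> carrier G \<and>
    state n y (H #>\<^bsub>G\<^esub> trans_class m r, 1) = (H #>\<^bsub>G\<^esub> proj_class (approximant_matrix (r * L) y \<sigma> n), \<sigma>)"
proof (induction n)
  case 0
  have "proj_class (approximant_matrix (r * L) y 1 0) = trans_class m r"
    by (simp add: approximant_matrix_def trans_class_def)
  then show ?case using trans_class_Hecke by (intro bexI[of _ 1]) (auto simp: approximant_matrix_def)
next
  case (Suc n)
  let ?A = "approximant_matrix (r * L) y"
  obtain \<sigma> where \<sigma>: "\<sigma> \<in> {1,-1}" and A: "det (?A \<sigma> n) = 1" "proj_class (?A \<sigma> n) \<in> carrier G"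
    and state: "state n y (H #>\<^bsub>G\<^esub> trans_class m r, 1) = (H #>\<^bsub>G\<^esub> proj_class (?A \<sigma> n), \<sigma>)"
    using Suc by blast
  define z where "z = (T ^^ n) y"
  have z: "z \<noteq> 0" "\<bar>z\<bar> \<le> L/2"
    using y(2)[of n] y(1) map_range[of "(T ^^ (n - 1)) y"]
    by (cases n; auto simp: z_def mem_I0 abs_le_iff)+
  define k where "k = signed_digit z"
  have rz: "rosen_digit m z \<ge> 1" using digit_pos z by blast
  have k: "k \<noteq> 0" "rosen_digit m z = \<bar>k\<bar>" "sgn z = of_int (sgn k)"
    using rz z by (auto simp: k_def signed_digit_def sgn_if)
  define \<sigma>' where "\<sigma>' = - sgn k * \<sigma>"
  have \<sigma>': "\<sigma>' \<in> {1,-1}" using \<sigma> k(1) by (auto simp: \<sigma>'_def sgn_if)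
  have r: "rosen_r m y (Suc n) = \<bar>k\<bar>" "rosen_eps m y (Suc n) = of_int (sgn k)"
    using k by (simp_all add: rosen_r_def rosen_eps_def z_def)
  have s1: "- \<sigma> * k = \<sigma>' * \<bar>k\<bar>" by (simp add: \<sigma>'_def abs_sgn sgn_if)
  let ?M = "?A \<sigma> n ** (mat2 0 (-1) 1 0 ** mat2 1 (real_of_int (- \<sigma> * k) * L) 0 1)"
  \<comment> \<open>The recursions of p and q amount to multiplication on the right by an inversion
    and a translation, up to the scalar \<open>\<sigma>'\<close>, which disappears in
    PSL(2,R).\<close>
  have A_eq: "?A \<sigma>' (Suc n) = ?M \<or> ?A \<sigma>' (Suc n) = - ?M"
    using \<sigma> k(1) unfolding approximant_matrix_def mat2_mult minus_mat2 rosen_p_shifted.simps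
        rosen_q_shifted.simps r
    by (auto simp: \<sigma>'_def sgn_if algebra_simps abs_if split: if_splits intro!: mat2_eqI)
  have detM: "det ?M = 1" using A(1) by (simp add: det_mul)
  have "proj_class ?M = proj_class (?A \<sigma> n) \<otimes>\<^bsub>G\<^esub> (inversion_class \<otimes>\<^bsub>G\<^esub> trans_class m (- \<sigma> * k))"
    using A(1) by (simp add: inversion_class_def trans_class_def proj_class_mult mat2_mult)
  then have pM: "proj_class (?A \<sigma>' (Suc n)) =
      proj_class (?A \<sigma> n) \<otimes>\<^bsub>G\<^esub> (inversion_class \<otimes>\<^bsub>G\<^esub> trans_class m (- \<sigma> * k))"
    using A_eq proj_class_minus[of ?M] by metis
  have "det (?A \<sigma>' (Suc n)) = 1" using A_eq detM det_minus2[of ?M] by metis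
  moreover have "proj_class (?A \<sigma>' (Suc n)) \<in> carrier G"
    unfolding pM by (rule G.m_closed[OF A(2) inv_trans_carrier])
  moreover have "state (Suc n) y (H #>\<^bsub>G\<^esub> trans_class m r, 1) = (H #>\<^bsub>G\<^esub> proj_class (?A \<sigma>' (Suc n)),
      \<sigma>')"
  proof -
    have "state (Suc n) y (H #>\<^bsub>G\<^esub> trans_class m r, 1) = next_state (H #>\<^bsub>G\<^esub> proj_class (?A \<sigma> n), \<sigma>) k"
      unfolding state_Suc state k_def z_def ..
    also have "\<dots> = ((H #>\<^bsub>G\<^esub> proj_class (?A \<sigma> n)) #>\<^bsub>G\<^esub> (inversion_class \<otimes>\<^bsub>G\<^esub> trans_class m (- \<sigma> *
        k)), \<sigma>')"
      using k(1) by (simp add: next_state_def \<sigma>'_def del: Hecke_simps)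
    also have "\<dots> = (H #>\<^bsub>G\<^esub> proj_class (?A \<sigma>' (Suc n)), \<sigma>')"
      unfolding pM coset_mult_assoc'[OF A(2) inv_trans_carrier] ..
    finally show ?thesis .
  qed
  ultimately show ?case using \<sigma>' by blast
qed

lemma state_in_cusp_iff:
  assumes y: "y \<in> I0" "\<And>n. (T ^^ n) y \<noteq> 0" and \<kappa>: "\<kappa> \<in> cusps m H"
  shows "state n y (H #>\<^bsub>G\<^esub> trans_class m r, 1) \<in> cusp_states \<kappa> \<longleftrightarrow>
    map_option (\<lambda>v. r * L + v) (ratio (rosen_p m y n) (rosen_q m y n)) \<in> \<kappa>"
proof -
  obtain \<sigma> where \<sigma>: "\<sigma> \<in> {1,-1}" and A: "proj_class (approximant_matrix (r * L) y \<sigma> n) \<in> carrier G"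
    and state: "state n y (H #>\<^bsub>G\<^esub> trans_class m r, 1) = (H #>\<^bsub>G\<^esub> proj_class (approximant_matrix (r
        * L) y \<sigma> n), \<sigma>)"
    using state_approximant[OF y] by blast
  have "state n y (H #>\<^bsub>G\<^esub> trans_class m r, 1) \<in> cusp_states \<kappa> \<longleftrightarrow>
      (\<exists>g\<in>H #>\<^bsub>G\<^esub> proj_class (approximant_matrix (r * L) y \<sigma> n). act g (Some 0) \<in> \<kappa>)"
    unfolding state cusp_states_def using \<sigma> A cosets_iff by auto
  also have "\<dots> \<longleftrightarrow> act (proj_class (approximant_matrix (r * L) y \<sigma> n)) (Some 0) \<in> \<kappa>"
    by (rule cusp_hit_iff[OF \<kappa> A])
  also have "act (proj_class (approximant_matrix (r * L) y \<sigma> n)) (Some 0) =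
      map_option (\<lambda>v. r * L + v) (ratio (rosen_p m y n) (rosen_q m y n))"
    by (simp add: proj_action_class approximant_matrix_def rosen_p_def rosen_q_def ratio_def
        add_divide_distrib)
  finally show ?thesis .
qed

section \<open>Passage to almost every real number\<close>

lemma countable_preimages_0: "countable {x. (T ^^ n) x = 0}"
proof (induction n)
  case (Suc n)
  have "{x. (T ^^ Suc n) x = 0} = (\<Union>y\<in>{x. (T ^^ n) x = 0}. {x. T x = y})"
    by (auto simp: funpow_swap1)
  then show ?case using Suc countable_fibre by auto
qed simp

text \<open>All starting states are included because the start depends on the multiple of L by which
  x is shifted, and all target sets because one null set has to serve every cusp.\<close>

definition generic :: "real \<Rightarrow> bool" where
  "generic y \<longleftrightarrow> y \<in> I0 \<and> (\<forall>n. (T ^^ n) y \<noteq> 0) \<and>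
     (\<forall>C\<in>Pow states. \<forall>s\<in>states. (\<lambda>N. card {n \<in> {1..N}. state n y s \<in> C} / N) \<longlonglongrightarrow> card C / card states)"

lemma AE_generic: "AE y in lebesgue. y \<in> I0 \<longrightarrow> generic y"
proof -
  have 1: "AE y in lebesgue. \<forall>C\<in>Pow states. \<forall>s\<in>states. y \<in> I0 \<longrightarrow>
      (\<lambda>N. card {n \<in> {1..N}. state n y s \<in> C} / N) \<longlonglongrightarrow> card C / card states"
    using finite_states AE_frequency by (intro AE_finite_allI) auto
  have "negligible (\<Union>n. {x. (T ^^ n) x = 0})"
    using countable_preimages_0 by (intro countable_negligible) auto
  then have "AE y in lebesgue. \<forall>n. (T ^^ n) y \<noteq> 0"
    unfolding eventually_ae_filter_negligible
    by (intro exI[of _ "\<Union>n. {x. (T ^^ n) x = 0}"]) auto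
  with 1 show ?thesis
    by eventually_elim (auto simp: generic_def)
qed

lemma rosen_r0_eq:
  assumes "x - real_of_int r * L \<in> I0" shows "rosen_r0 m x = r"
  unfolding rosen_r0_def
proof (rule the_equality)
  show "x - real_of_int r * L \<in> rosen_interval m"
    using assms by (auto simp: rosen_interval_def mem_I0)
  fix r' :: int assume "x - real_of_int r' * L \<in> rosen_interval m"
  then have "- L < (real_of_int r' - real_of_int r) * L" "(real_of_int r' - real_of_int r) * L < L"
    using assms unfolding rosen_interval_def mem_I0 atLeastLessThan_iff left_diff_distrib by argo+
  then have "- 1 < real_of_int r' - real_of_int r" "real_of_int r' - real_of_int r < 1"
    using L_pos mult_less_cancel_right_pos[of L "-1"] mult_less_cancel_right_pos[of L _ 1] by auto
  then show "r' = r" by linarith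
qed

text \<open>The exceptional x lie in countably many translates of a null set enlarged by the left
  end.\<close>

lemma AE_generic_translate: "AE x in lebesgue. \<exists>r::int. generic (x - r * L)"
proof -
  obtain N where N: "negligible N" "{y. \<not> (y \<in> I0 \<longrightarrow> generic y)} \<subseteq> N"
    using AE_generic unfolding eventually_ae_filter_negligible by blast
  let ?B = "\<Union>r::int. (+) (r * L) ` (N \<union> {- (L/2)})"
  have "negligible ?B"
  proof (rule negligible_countable_Union)
    have "negligible ((+) c ` (N \<union> {- (L/2)}))" for c
      using N(1) by (intro negligible_translation) simp
    then show "negligible A" if "A \<in> range (\<lambda>r::int. (+) (r * L) ` (N \<union> {- (L/2)}))" for A
      using that by blast
  qed simp
  moreover have "{x. \<not> (\<exists>r::int. generic (x - r * L))} \<subseteq> ?B"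
  proof
    fix x assume x: "x \<in> {x. \<not> (\<exists>r::int. generic (x - r * L))}"
    \<comment> \<open>The index of a multiple of L nearest to x.\<close>
    define r where "r = \<lfloor>x / L + 1/2\<rfloor>"
    define y where "y = x - r * L"
    have "real_of_int r \<le> x / L + 1/2" "x / L + 1/2 < real_of_int r + 1" unfolding r_def by linarith+
    then have "real_of_int r * L \<le> (x / L + 1/2) * L" "(x / L + 1/2) * L < (real_of_int r + 1) * L"
      by (auto intro: mult_right_mono mult_strict_right_mono)
    moreover have "(x / L + 1/2) * L = x + L/2" "(real_of_int r + 1) * L = real_of_int r * L + L"
      by (simp_all add: distrib_right)
    ultimately have "y = - (L/2) \<or> y \<in> I0" unfolding y_def mem_I0 by argo
    then have "y \<in> N \<union> {- (L/2)}" using x N(2) by (auto simp: y_def)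
    moreover have "x = r * L + y" by (simp add: y_def)
    ultimately show "x \<in> ?B" by blast
  qed
  ultimately show ?thesis unfolding eventually_ae_filter_negligible by blast
qed

lemma cusp_distribution:
  "AE x in lebesgue. \<forall>\<kappa>\<in>cusps m H.
    (\<lambda>N. real (card {n \<in> {1..N}. rosen_approximant m x n \<in> \<kappa>}) / real N)
      \<longlonglongrightarrow> real (cusp_width m H \<kappa>) / real (group_index G H)"
  using AE_generic_translate
proof eventually_elim
  case (elim x)
  then obtain r :: int where gen: "generic (x - r * L)" by blast
  define y where "y = x - r * L"
  have y: "y \<in> I0" "\<And>n. (T ^^ n) y \<noteq> 0" using gen by (auto simp: generic_def y_def)
  have r0: "rosen_r0 m x = r" using rosen_r0_eq y(1) by (simp add: y_def)
  show ?case
  proof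
    fix \<kappa> assume \<kappa>: "\<kappa> \<in> cusps m H"
    \<comment> \<open>The translation by \<open>r * L\<close> that turns approximants of y into
      those of x enters as the starting coset.\<close>
    define s where "s = (H #>\<^bsub>G\<^esub> trans_class m r, 1 :: int)"
    have s: "s \<in> states" using trans_class_Hecke cosets_iff by (auto simp: s_def states_def)
    have "rosen_approximant m x n \<in> \<kappa> \<longleftrightarrow> state n y s \<in> cusp_states \<kappa>" for n
      using state_in_cusp_iff[OF y \<kappa>, of n r] by (simp add: rosen_approximant_def r0 s_def y_def
          Let_def)
    moreover have "(\<lambda>N. card {n \<in> {1..N}. state n y s \<in> cusp_states \<kappa>} / N)
        \<longlonglongrightarrow> card (cusp_states \<kappa>) / card states"
      using gen s cusp_states_subset by (auto simp: generic_def y_def)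
    ultimately show "(\<lambda>N. real (card {n \<in> {1..N}. rosen_approximant m x n \<in> \<kappa>}) / real N)
      \<longlonglongrightarrow> real (cusp_width m H \<kappa>) / real (group_index G H)"
      using cusp_states_density[OF \<kappa>] by simp
  qed
qed

end

theorem theorem6:
  fixes m :: nat and H :: "(real^2^2) set set"
  assumes "m \<ge> 3"
    and "subgroup H (Hecke_group m)"
    and "finite (rcosets\<^bsub>Hecke_group m\<^esub> H)"
  shows "AE x in lebesgue. \<forall>\<kappa>\<in>cusps m H.
    (\<lambda>N. real (card {n \<in> {1..N}. rosen_approximant m x n \<in> \<kappa>}) / real N)
      \<longlonglongrightarrow> real (cusp_width m H \<kappa>) / real (group_index (Hecke_group m) H)"
proof -
  interpret hecke_rosen m H using assms
    by (intro hecke_rosen.intro rosen_expansion.intro hecke_subgroup.intro)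
  show ?thesis by (rule cusp_distribution)
qed

end
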